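(* Let $n,m,d_1,\dots,d_m$ be positive integers, $D=\sum_{j=1}^m d_j$, and let $\mathcal X^j=\{v^j_1,\dots,v^j_n\}\subseteq\mathbb R^{d_j}$, $j\in[m]$, be an $m$-tuple of data sets. Then there exist a deterministic polynomial time algorithm and a probabilistic algorithm to decide whether $(\mathcal X^1,\dots,\mathcal X^m)$ has an SRSR solution and to compute such a solution in case it exists. Moreover, if $(\mathcal X^1,\dots,\mathcal X^m)$ admits an SRSR solution, then any output $(T_1,\dots,T_m)$ of the deterministic or of the probabilistic algorithm is an optimal SRSR solution in the following sense: if $(T'_1,\dots,T'_m)$ is any SRSR solution for $(\mathcal X^1,\dots,\mathcal X^m)$, then $$|\mathcal I_T|-\frac{\sum_{j=1}^m\dim T_j}{D}\cdot n\;\geq\;|\mathcal I_{T'}|-\frac{\sum_{j=1}^m\dim T'_j}{D}\cdot n .$$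
   Context: Notation: $[L]=\{1,\dots,L\}$. The data sets are indexed families: $v^j_i\in\mathbb R^{d_j}$ for $i\in[n]$, $j\in[m]$, all of the same size $n$. For an $m$-tuple of (linear) subspaces $T=(T_1,\dots,T_m)$ with $T_j\subseteq\mathbb R^{d_j}$, set $\mathcal I_T:=\{i\in[n]\mid v^j_i\in T_j\text{ for all }j\in[m]\}$. An SRSR (simultaneous robust subspace recovery) solution for $(\mathcal X^1,\dots,\mathcal X^m)$ is an $m$-tuple of subspaces $T=(T_1,\dots,T_m)$, $T_j\subseteq\mathbb R^{d_j}$, such that $$|\mathcal I_T|>\frac{\sum_{j=1}^m\dim T_j}{D}\cdot n .$$ Computational conventions: for algorithmic purposes the data points are taken to have rational coordinates, and polynomial time means polynomial in the size of the input data. A probabilistic algorithm here is a randomized procedure performing independent rounds, each of which draws finitely many scalars independently and uniformly from a finite sample set; for any prescribed $\epsilon>0$ (with the sample set chosen large enough in terms of $\epsilon$) a round produces an output with probability at least $1-\epsilon$, a round that does not produce an output is repeated, and any output produced is correct. *)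

theory Defs
  imports
    "HOL-Library.Log_Nat"
    "HOL-Computational_Algebra.Polynomial"
    "HOL-Probability.Probability"
    "Jordan_Normal_Form.VS_Connect"
begin

section \<open>Simultaneous robust subspace recovery\<close>

text \<open>The Euclidean space of dimension \<open>k\<close> is \<open>carrier_vec k\<close>, viewed as the vector
  space \<open>module_vec TYPE(real) k\<close> over \<open>class_ring\<close>. Families indexed by \<open>1,...,m\<close> or
  \<open>1,...,n\<close> are functions on \<open>nat\<close>; only their values on these ranges matter.\<close>

abbreviation is_subspace :: "nat \<Rightarrow> real vec set \<Rightarrow> bool" where
  "is_subspace k W \<equiv> VectorSpace.subspace class_ring W (module_vec TYPE(real) k)"

abbreviation subspace_dim :: "nat \<Rightarrow> real vec set \<Rightarrow> nat" where
  "subspace_dim k W \<equiv>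
     vectorspace.dim class_ring ((module_vec TYPE(real) k)\<lparr>carrier := W\<rparr>)"

abbreviation is_basis :: "nat \<Rightarrow> real vec set \<Rightarrow> real vec set \<Rightarrow> bool" where
  "is_basis k W A \<equiv>
     vectorspace.basis class_ring ((module_vec TYPE(real) k)\<lparr>carrier := W\<rparr>) A"

definition inliers ::
  "nat \<Rightarrow> nat \<Rightarrow> (nat \<Rightarrow> nat \<Rightarrow> real vec) \<Rightarrow> (nat \<Rightarrow> real vec set) \<Rightarrow> nat set" where
  "inliers n m X T = {i \<in> {1..n}. \<forall>j\<in>{1..m}. X j i \<in> T j}"

definition threshold :: "nat \<Rightarrow> nat \<Rightarrow> (nat \<Rightarrow> nat) \<Rightarrow> (nat \<Rightarrow> real vec set) \<Rightarrow> real" where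
  "threshold n m d T =
     real (\<Sum>j=1..m. subspace_dim (d j) (T j)) / real (\<Sum>j=1..m. d j) * real n"

definition srsr_solution ::
  "nat \<Rightarrow> nat \<Rightarrow> (nat \<Rightarrow> nat) \<Rightarrow> (nat \<Rightarrow> nat \<Rightarrow> real vec) \<Rightarrow> (nat \<Rightarrow> real vec set) \<Rightarrow> bool" where
  "srsr_solution n m d X T \<longleftrightarrow>
     (\<forall>j\<in>{1..m}. is_subspace (d j) (T j)) \<and>
     real (card (inliers n m X T)) > threshold n m d T"

definition optimal_srsr_solution ::
  "nat \<Rightarrow> nat \<Rightarrow> (nat \<Rightarrow> nat) \<Rightarrow> (nat \<Rightarrow> nat \<Rightarrow> real vec) \<Rightarrow> (nat \<Rightarrow> real vec set) \<Rightarrow> bool" where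
  "optimal_srsr_solution n m d X T \<longleftrightarrow>
     srsr_solution n m d X T \<and>
     (\<forall>T'. srsr_solution n m d X T' \<longrightarrow>
        real (card (inliers n m X T)) - threshold n m d T
        \<ge> real (card (inliers n m X T')) - threshold n m d T')"

section \<open>Programs and their running time\<close>

text \<open>The model of computation is a random access machine with logarithmic (bit) cost,
  presented as a structured language. The memory consists of named arrays of integers, indexed
  by integers; a program mentions finitely many names, and a scalar variable is cell 0 of an
  array. Every operation is charged the bit lengths of its operands, and every memory access
  the bit lengths of the address and of the content. Up to polynomials this is
  the running time of a Turing machine.\<close>

type_synonym mem = "string \<Rightarrow> int \<Rightarrow> int"

datatype aexp =
    Lit int
  | Read string aexp
  | Add aexp aexp
  | Sub aexp aexp
  | Mul aexp aexp
  | Div aexp aexp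

datatype bexp =
    Less aexp aexp
  | Equal aexp aexp
  | Neg bexp
  | Conj bexp bexp

datatype com =
    Skip
  | Store string aexp aexp
  | Seq com com
  | Cond bexp com com
  | Loop bexp com

text \<open>One bit for the sign, followed by the binary digits of the absolute value.\<close>

definition bit_size :: "int \<Rightarrow> nat" where
  "bit_size z = 1 + nat (bitlen \<bar>z\<bar>)"

fun aval :: "mem \<Rightarrow> aexp \<Rightarrow> int" where
  "aval s (Lit z) = z"
| "aval s (Read x a) = s x (aval s a)"
| "aval s (Add a b) = aval s a + aval s b"
| "aval s (Sub a b) = aval s a - aval s b"
| "aval s (Mul a b) = aval s a * aval s b"
| "aval s (Div a b) = aval s a div aval s b"

fun acost :: "mem \<Rightarrow> aexp \<Rightarrow> nat" where
  "acost s (Lit z) = bit_size z"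
| "acost s (Read x a) = acost s a + bit_size (aval s a) + bit_size (s x (aval s a))"
| "acost s (Add a b) = acost s a + acost s b + bit_size (aval s a) + bit_size (aval s b)"
| "acost s (Sub a b) = acost s a + acost s b + bit_size (aval s a) + bit_size (aval s b)"
| "acost s (Mul a b) = acost s a + acost s b + bit_size (aval s a) + bit_size (aval s b)"
| "acost s (Div a b) = acost s a + acost s b + bit_size (aval s a) + bit_size (aval s b)"

fun bval :: "mem \<Rightarrow> bexp \<Rightarrow> bool" where
  "bval s (Less a b) \<longleftrightarrow> aval s a < aval s b"
| "bval s (Equal a b) \<longleftrightarrow> aval s a = aval s b"
| "bval s (Neg b) \<longleftrightarrow> \<not> bval s b"
| "bval s (Conj b c) \<longleftrightarrow> bval s b \<and> bval s c"

fun bcost :: "mem \<Rightarrow> bexp \<Rightarrow> nat" where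
  "bcost s (Less a b) = acost s a + acost s b + bit_size (aval s a) + bit_size (aval s b)"
| "bcost s (Equal a b) = acost s a + acost s b + bit_size (aval s a) + bit_size (aval s b)"
| "bcost s (Neg b) = 1 + bcost s b"
| "bcost s (Conj b c) = 1 + bcost s b + bcost s c"

text \<open>\<open>exec c s k t\<close>: started in memory \<open>s\<close>, the program \<open>c\<close> halts in memory \<open>t\<close> after
  time \<open>k\<close>.\<close>

inductive exec :: "com \<Rightarrow> mem \<Rightarrow> nat \<Rightarrow> mem \<Rightarrow> bool" where
  Skip: "exec Skip s 1 s"
| Store: "exec (Store x a b) s
     (1 + acost s a + acost s b + bit_size (aval s a) + bit_size (aval s b))
     (s(x := (s x)(aval s a := aval s b)))"
| Seq: "exec c s k t \<Longrightarrow> exec c' t k' u \<Longrightarrow> exec (Seq c c') s (k + k') u"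
| CondTrue: "bval s b \<Longrightarrow> exec c s k t \<Longrightarrow> exec (Cond b c c') s (1 + bcost s b + k) t"
| CondFalse: "\<not> bval s b \<Longrightarrow> exec c' s k t \<Longrightarrow> exec (Cond b c c') s (1 + bcost s b + k) t"
| LoopFalse: "\<not> bval s b \<Longrightarrow> exec (Loop b c) s (1 + bcost s b) s"
| LoopTrue: "bval s b \<Longrightarrow> exec c s k t \<Longrightarrow> exec (Loop b c) t k' u \<Longrightarrow>
     exec (Loop b c) s (1 + bcost s b + k + k') u"

inductive_cases SkipE: "exec Skip s k t"
inductive_cases StoreE: "exec (Store x a b) s k t"
inductive_cases SeqE: "exec (Seq c c') s k t"
inductive_cases CondE: "exec (Cond b c c') s k t"
inductive_cases LoopE: "exec (Loop b c) s k t"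

lemma exec_deterministic:
  "exec c s k t \<Longrightarrow> exec c s k' t' \<Longrightarrow> k' = k \<and> t' = t"
proof (induction arbitrary: k' t' rule: exec.induct)
  case (Skip s)
  then show ?case by (auto elim: SkipE)
next
  case (Store x a b s)
  then show ?case by (auto elim: StoreE)
next
  case (Seq c s k t c' l u)
  from Seq.prems obtain k1 t1 k2
    where "k' = k1 + k2" "exec c s k1 t1" "exec c' t1 k2 t'"
    by (rule SeqE)
  with Seq.IH show ?case by metis
next
  case (CondTrue s b c k t c')
  from CondTrue.prems CondTrue.hyps(1) obtain k1
    where "k' = 1 + bcost s b + k1" "exec c s k1 t'"
    by (auto elim: CondE)
  with CondTrue.IH show ?case by metis
next
  case (CondFalse s b c' k t c)
  from CondFalse.prems CondFalse.hyps(1) obtain k1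
    where "k' = 1 + bcost s b + k1" "exec c' s k1 t'"
    by (auto elim: CondE)
  with CondFalse.IH show ?case by metis
next
  case (LoopFalse s b c)
  then show ?case by (auto elim: LoopE)
next
  case (LoopTrue s b c k t l u)
  from LoopTrue.prems LoopTrue.hyps(1) obtain k1 t1 k2
    where "k' = 1 + bcost s b + k1 + k2" "exec c s k1 t1" "exec (Loop b c) t1 k2 t'"
    by (auto elim: LoopE)
  with LoopTrue.IH show ?case by metis
qed

text \<open>Lists are passed in arrays: the length in cell 0, the entries in the following cells.
  All other cells are initially 0.\<close>

definition list_array :: "int list \<Rightarrow> int \<Rightarrow> int" where
  "list_array xs a =
     (if a = 0 then int (length xs)
      else if 1 \<le> a \<and> a \<le> int (length xs) then xs ! (nat a - 1)
      else 0)"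

definition initial_mem :: "int list \<Rightarrow> int list \<Rightarrow> mem" where
  "initial_mem xs rs = (\<lambda>x.
     if x = ''input'' then list_array xs
     else if x = ''random'' then list_array rs
     else (\<lambda>_. 0))"

definition output_of :: "mem \<Rightarrow> int list" where
  "output_of s = map (\<lambda>i. s ''output'' (int i)) [1..<Suc (nat (s ''output'' 0))]"

text \<open>\<open>run P xs rs k ys\<close>: on input \<open>xs\<close> and drawn scalars \<open>rs\<close>, the program \<open>P\<close> halts
  after time \<open>k\<close> with output \<open>ys\<close>.\<close>

definition run :: "com \<Rightarrow> int list \<Rightarrow> int list \<Rightarrow> nat \<Rightarrow> int list \<Rightarrow> bool" where
  "run P xs rs k ys \<longleftrightarrow> (\<exists>s. exec P (initial_mem xs rs) k s \<and> output_of s = ys)"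

lemma run_deterministic: "run P xs rs k ys \<Longrightarrow> run P xs rs k' ys' \<Longrightarrow> k' = k \<and> ys' = ys"
  unfolding run_def using exec_deterministic by blast

definition input_size :: "int list \<Rightarrow> nat" where
  "input_size xs = (\<Sum>x\<leftarrow>xs. bit_size x)"

section \<open>Deterministic and probabilistic algorithms\<close>

definition deterministic_output :: "com \<Rightarrow> int list \<Rightarrow> int list \<Rightarrow> bool" where
  "deterministic_output P xs ys \<longleftrightarrow> (\<exists>k. run P xs [] k ys)"

definition polynomial_time :: "com \<Rightarrow> int list set \<Rightarrow> bool" where
  "polynomial_time P I \<longleftrightarrow>
     (\<exists>p :: nat poly. \<forall>xs\<in>I. \<exists>k ys. run P xs [] k ys \<and> k \<le> poly p (input_size xs))"

definition encode_rat :: "rat \<Rightarrow> int list" where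
  "encode_rat q = [fst (quotient_of q), snd (quotient_of q)]"

text \<open>A probabilistic algorithm is a pair \<open>(S, R)\<close> of programs. From the input and the error
  bound \<open>e\<close>, a rational so that it can be part of the input, the setup \<open>S\<close> computes \<open>N\<close> and
  \<open>K\<close>. Each round draws \<open>K\<close> scalars independently and uniformly from the sample set
  \<open>{1,...,N}\<close> and runs \<open>R\<close> on the same input and these scalars. Leaving the output list empty
  means that the round produces no output.\<close>

definition draws :: "nat \<Rightarrow> nat \<Rightarrow> int list pmf" where
  "draws N K = replicate_pmf K (pmf_of_set {1..int N})"

definition setup_result :: "com \<Rightarrow> int list \<Rightarrow> rat \<Rightarrow> nat \<Rightarrow> nat \<Rightarrow> bool" where
  "setup_result S xs e N K \<longleftrightarrow>
     N > 0 \<and> deterministic_output S (encode_rat e @ xs) [int N, int K]"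

text \<open>Whenever \<open>R\<close> halts, the output is unique by \<open>run_deterministic\<close>.\<close>

definition round_result :: "com \<Rightarrow> int list \<Rightarrow> rat \<Rightarrow> int list \<Rightarrow> int list option" where
  "round_result R xs e rs =
     (let ys = (THE ys. \<exists>k. run R (encode_rat e @ xs) rs k ys)
      in if ys = [] then None else Some ys)"

definition round_pmf :: "com \<Rightarrow> int list \<Rightarrow> rat \<Rightarrow> nat \<Rightarrow> nat \<Rightarrow> int list option pmf" where
  "round_pmf R xs e N K = map_pmf (round_result R xs e) (draws N K)"

text \<open>The result of at most \<open>t\<close> independent rounds, stopping at the first output.\<close>

fun rounds_pmf ::
  "com \<Rightarrow> int list \<Rightarrow> rat \<Rightarrow> nat \<Rightarrow> nat \<Rightarrow> nat \<Rightarrow> int list option pmf" where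
  "rounds_pmf R xs e N K 0 = return_pmf None"
| "rounds_pmf R xs e N K (Suc t) =
     bind_pmf (round_pmf R xs e N K) (\<lambda>r. case r of
         None \<Rightarrow> rounds_pmf R xs e N K t
       | Some ys \<Rightarrow> return_pmf (Some ys))"

definition probabilistic_algorithm :: "com \<Rightarrow> com \<Rightarrow> int list set \<Rightarrow> bool" where
  "probabilistic_algorithm S R I \<longleftrightarrow>
     (\<forall>xs\<in>I. \<forall>e>0. \<exists>N K. setup_result S xs e N K \<and>
        (\<forall>rs\<in>set_pmf (draws N K). \<exists>k ys. run R (encode_rat e @ xs) rs k ys) \<and>
        measure_pmf.prob (round_pmf R xs e N K) {r. r \<noteq> None} \<ge> 1 - real_of_rat e)"

definition probabilistic_output :: "com \<Rightarrow> com \<Rightarrow> int list \<Rightarrow> int list \<Rightarrow> bool" where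
  "probabilistic_output S R xs ys \<longleftrightarrow>
     (\<exists>e>0. \<exists>N K t. setup_result S xs e N K \<and> Some ys \<in> set_pmf (rounds_pmf R xs e N K t))"

section \<open>Inputs and outputs of the recovery problem\<close>

abbreviation real_vec :: "rat vec \<Rightarrow> real vec" where
  "real_vec \<equiv> map_vec real_of_rat"

definition srsr_instance ::
  "nat \<Rightarrow> nat \<Rightarrow> (nat \<Rightarrow> nat) \<Rightarrow> (nat \<Rightarrow> nat \<Rightarrow> rat vec) \<Rightarrow> bool" where
  "srsr_instance n m d v \<longleftrightarrow> n > 0 \<and> m > 0 \<and> (\<forall>j\<in>{1..m}. d j > 0) \<and>
     (\<forall>j\<in>{1..m}. \<forall>i\<in>{1..n}. v j i \<in> carrier_vec (d j))"

definition encode_vec :: "rat vec \<Rightarrow> int list" where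
  "encode_vec u = concat (map encode_rat (list_of_vec u))"

definition encode_instance ::
  "nat \<Rightarrow> nat \<Rightarrow> (nat \<Rightarrow> nat) \<Rightarrow> (nat \<Rightarrow> nat \<Rightarrow> rat vec) \<Rightarrow> int list" where
  "encode_instance n m d v =
     [int n, int m] @ map (\<lambda>j. int (d j)) [1..<Suc m] @
     concat (map (\<lambda>j. concat (map (\<lambda>i. encode_vec (v j i)) [1..<Suc n])) [1..<Suc m])"

definition srsr_inputs :: "int list set" where
  "srsr_inputs = {encode_instance n m d v | n m d v. srsr_instance n m d v}"

text \<open>The answer that there is no solution is the list \<open>[0]\<close>. A tuple of subspaces is
  output as 1 followed, for each \<open>j\<close>, by the number and the coordinates of the vectors
  of a rational basis of \<open>T j\<close>.\<close>

definition no_solution_answer :: "int list" where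
  "no_solution_answer = [0]"

definition answers ::
  "nat \<Rightarrow> (nat \<Rightarrow> nat) \<Rightarrow> int list \<Rightarrow> (nat \<Rightarrow> real vec set) \<Rightarrow> bool" where
  "answers m d ys T \<longleftrightarrow> (\<exists>B :: nat \<Rightarrow> rat vec list.
     (\<forall>j\<in>{1..m}. is_subspace (d j) (T j) \<and> distinct (B j) \<and>
        is_basis (d j) (T j) (real_vec ` set (B j))) \<and>
     ys = 1 # concat (map (\<lambda>j. int (length (B j)) # concat (map encode_vec (B j)))
                       [1..<Suc m]))"

definition decides_and_computes_srsr ::
  "nat \<Rightarrow> nat \<Rightarrow> (nat \<Rightarrow> nat) \<Rightarrow> (nat \<Rightarrow> nat \<Rightarrow> real vec) \<Rightarrow> int list \<Rightarrow> bool" where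
  "decides_and_computes_srsr n m d X ys \<longleftrightarrow>
     (if \<exists>T. srsr_solution n m d X T
      then \<exists>T. answers m d ys T \<and> srsr_solution n m d X T
      else ys = no_solution_answer)"

end

theory Submission
  imports Defs "Jordan_Normal_Form.Determinant" "Jordan_Normal_Form.Ring_Hom_Matrix"
begin

text \<open>
  Let \<open>D\<close> be the sum of the dimensions. A tuple \<open>T\<close> of subspaces is an SRSR solution iff its
  defect \<open>n * (\<Sum>j. dim T\<^sub>j) - D * card (inliers of T)\<close> is negative, and it is optimal iff its
  defect is least (\<open>srsr_solution_iff\<close>, \<open>optimal_srsr_solutionI\<close>). For a prescribed set \<open>S\<close> of
  inliers the best tuple consists of the spans of the data points in \<open>S\<close>. The problem therefore
  is to minimise the integer valued function
  \<open>g(S) = n * (\<Sum>j. dim span {v\<^sup>j\<^sub>i | i \<in> S}) - D * card S\<close> (\<open>objective\<close>) over the subsets of the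
  index set. This function is submodular, since ranks are.

  It is minimised by a projected subgradient descent on its Lovasz extension, with integer
  coordinates in the cube \<open>[0, K]\<^sup>n\<close>, where \<open>K = n * (n * D)\<^sup>2\<close>. At a point \<open>x\<close>, the greedy
  algorithm goes through the indices by decreasing \<open>x\<^sub>i\<close> and takes as \<open>w\<^sub>i\<close> the increment of \<open>g\<close>
  caused by \<open>i\<close>. Two facts about \<open>w\<close> suffice, and submodularity is hidden in the second one. The
  sum of \<open>w\<close> over an upper level set of \<open>x\<close> is the value of \<open>g\<close> there. The sum of \<open>w\<close> over the
  inliers of an arbitrary tuple \<open>T\<close> is at most the defect of \<open>T\<close>, because the independent points
  selected among these inliers lie in \<open>T\<close> (\<open>sum_gain_members_le\<close>). As long as every level set seen
  has a value above the defect of \<open>T\<close>, a step from \<open>x\<close> to the projection of \<open>x - w\<close> reduces the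
  squared distance to the vertex \<open>K * indicator (inliers of T)\<close> by at least \<open>K\<close>
  (\<open>potential_step\<close>). This distance is at most \<open>n * K\<^sup>2\<close> at the start, so after \<open>n * K + 1\<close> steps
  the best level set seen is at least as good as every \<open>T\<close> (\<open>descent_correct\<close>).

  The ranks come from a single elimination: the data point \<open>v\<^sup>j\<^sub>i\<close> becomes an integer vector of
  length \<open>D\<close> supported in block \<open>j\<close>, and the number of independent vectors of this kind is the sum
  of the ranks. The elimination is fraction free. All its entries are minors of the integer matrix
  (\<open>minor_row\<close>, \<open>minor_row_step\<close>), so the divisions are exact and the entries have polynomially
  many bits.

  The running time is bounded once and for all. The algorithm is a program in a small loop
  language in which every assignment of a value larger than the content of a cell \<open>''B''\<close> is
  skipped and every loop is cut off after as many rounds as a cell \<open>''L''\<close> says. Such programs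
  compile to commands of polynomial cost whatever they compute (\<open>exec_compile\<close>). The correctness
  proof shows that with suitable \<open>''B''\<close> and \<open>''L''\<close>, which a short prelude computes from the
  input, no assignment is skipped and no loop is cut off (\<open>main_correct\<close>, \<open>body_prog_correct\<close>).

  A deterministic algorithm that always answers is also a probabilistic one: its rounds draw no
  scalars and succeed with probability one. Finally, an output determines the subspaces it
  describes (\<open>answers_unique\<close>), so whatever tuple is read off an output is the optimal one.
\<close>

unbundle no vec_syntax

section \<open>Minors and fraction-free elimination\<close>

text \<open>The minor of the rows \<open>b 0, ..., b (k - 1)\<close> in the columns \<open>c 0, ..., c (k - 1)\<close>.\<close>
definition lead_minor :: "(nat \<Rightarrow> nat \<Rightarrow> int) \<Rightarrow> (nat \<Rightarrow> nat) \<Rightarrow> nat \<Rightarrow> int" where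
  "lead_minor b c k = det (mat k k (\<lambda>(i, j). b i (c j)))"

text \<open>What is left of the row \<open>v\<close> after \<open>k\<close> rounds of fraction-free elimination with rows \<open>b\<close>
  and pivot columns \<open>c\<close>: its entry \<open>x\<close> is the previous minor bordered by \<open>v\<close> and column \<open>x\<close>.\<close>
definition minor_row ::
  "(nat \<Rightarrow> nat \<Rightarrow> int) \<Rightarrow> (nat \<Rightarrow> nat) \<Rightarrow> nat \<Rightarrow> (nat \<Rightarrow> int) \<Rightarrow> nat \<Rightarrow> int" where
  "minor_row b c k v x =
     det (mat (Suc k) (Suc k) (\<lambda>(i, j). (if i < k then b i else v) (if j < k then c j else x)))"

text \<open>Expansion along the last column. The cofactors do not involve that column, hence are the
  same for all \<open>x\<close>. So eliminating means subtracting a combination of the earlier rows from a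
  multiple of \<open>v\<close>.\<close>
lemma minor_row_expansion:
  "\<exists>\<beta>. \<forall>x. minor_row b c k v x = lead_minor b c k * v x + (\<Sum>l<k. \<beta> l * b l x)"
proof -
  define A where "A x = mat (Suc k) (Suc k)
    (\<lambda>(i, j). (if i < k then b i else v) (if j < k then c j else x))" for x
  have A: "A x \<in> carrier_mat (Suc k) (Suc k)" for x by (simp add: A_def)
  \<comment> \<open>Deleting column \<open>k\<close> removes all dependence on \<open>x\<close>.\<close>
  have del: "mat_delete (A x) i k = mat_delete (A 0) i k" for x i
    unfolding mat_delete_def by (rule eq_matI) (auto simp: A_def)
  define \<beta> where "\<beta> i = cofactor (A 0) i k" for i
  have cof: "cofactor (A x) i k = \<beta> i" for x i
    unfolding cofactor_def \<beta>_def using del[of x i] by simp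
  have "mat_delete (A 0) k k = mat k k (\<lambda>(i, j). b i (c j))"
    unfolding mat_delete_def by (rule eq_matI) (auto simp: A_def)
  hence last: "\<beta> k = lead_minor b c k"
    unfolding \<beta>_def cofactor_def lead_minor_def by (simp flip: mult_2)
  have "minor_row b c k v x = lead_minor b c k * v x + (\<Sum>l<k. \<beta> l * b l x)" for x
  proof -
    have "minor_row b c k v x = (\<Sum>i<Suc k. A x $$ (i, k) * cofactor (A x) i k)"
      unfolding minor_row_def A_def[symmetric] by (rule laplace_expansion_column[OF A]) simp
    also have "\<dots> = A x $$ (k, k) * lead_minor b c k
        + (\<Sum>l<k. A x $$ (l, k) * \<beta> l)"
      by (simp add: cof last)
    also have "(\<Sum>l<k. A x $$ (l, k) * \<beta> l) = (\<Sum>l<k. \<beta> l * b l x)"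
      by (rule sum.cong) (auto simp: A_def)
    also have "A x $$ (k, k) = v x" by (simp add: A_def)
    finally show ?thesis by simp
  qed
  thus ?thesis by blast
qed

lemma minor_row_vanishes:
  assumes "l < k"
  shows "minor_row b c k v (c l) = 0"
  unfolding minor_row_def
  by (rule det_identical_columns[of _ "Suc k" l k]) (use assms in \<open>auto intro!: eq_vecI\<close>)

lemma minor_row_0 [simp]: "minor_row b c 0 v x = v x"
  unfolding minor_row_def by (subst det_single) auto

lemma lead_minor_0 [simp]: "lead_minor b c 0 = 1"
  unfolding lead_minor_def by simp

text \<open>The entry of a reduced row in its own pivot column is the next leading minor; the divisors of
  the elimination need not be computed separately.\<close>
lemma minor_row_own [simp]: "minor_row b c k (b k) (c k) = lead_minor b c (Suc k)"
  unfolding minor_row_def lead_minor_def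
  by (rule arg_cong[where f = det]) (auto intro!: eq_matI simp: less_Suc_eq)

lemma lead_minor_cong:
  "(\<And>i. i < k \<Longrightarrow> b i = b' i) \<Longrightarrow> (\<And>i. i < k \<Longrightarrow> c i = c' i) \<Longrightarrow> lead_minor b c k = lead_minor b' c' k"
  unfolding lead_minor_def by (rule arg_cong[where f = det]) (auto intro!: eq_matI)

lemma minor_row_cong:
  "(\<And>i. i < k \<Longrightarrow> b i = b' i) \<Longrightarrow> (\<And>i. i < k \<Longrightarrow> c i = c' i) \<Longrightarrow> minor_row b c k v = minor_row b' c' k v"
  unfolding minor_row_def
  by (intro ext arg_cong[where f = det]) (auto intro!: eq_matI)

lemma nonsingular_combination_eq_0:
  fixes M :: "nat \<Rightarrow> nat \<Rightarrow> 'a :: idom"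
  assumes det: "det (mat k k (\<lambda>(i, j). M i j)) \<noteq> 0"
    and sum: "\<And>j. j < k \<Longrightarrow> (\<Sum>i<k. \<beta> i * M i j) = 0"
    and i: "i < k"
  shows "\<beta> i = 0"
proof -
  define A where "A = mat k k (\<lambda>(i, j). M i j)"
  have A: "transpose_mat A \<in> carrier_mat k k" by (simp add: A_def)
  have "det (transpose_mat A) \<noteq> 0"
    using det det_transpose[of A k] by (simp add: A_def)
  moreover have "transpose_mat A *\<^sub>v Matrix.vec k \<beta> = 0\<^sub>v k"
  proof (rule eq_vecI)
    fix j assume "j < dim_vec (0\<^sub>v k :: 'a vec)"
    thus "(transpose_mat A *\<^sub>v Matrix.vec k \<beta>) $ j = 0\<^sub>v k $ j"
      using sum[of j] by (simp add: A_def scalar_prod_def lessThan_atLeast0 mult.commute)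
  qed (simp add: A_def)
  moreover have "Matrix.vec k \<beta> \<in> carrier_vec k" by simp
  ultimately have "Matrix.vec k \<beta> = 0\<^sub>v k"
    unfolding det_0_iff_vec_prod_zero[OF A] by metis
  hence "vec_index (Matrix.vec k \<beta>) i = vec_index (0\<^sub>v k) i" by simp
  thus ?thesis using i by simp
qed

lemma lead_minor_independent:
  fixes \<beta> :: "nat \<Rightarrow> real"
  assumes "lead_minor b c k \<noteq> 0"
    and "\<And>j. j < k \<Longrightarrow> (\<Sum>i<k. \<beta> i * real_of_int (b i (c j))) = 0"
    and "i < k"
  shows "\<beta> i = 0"
proof (rule nonsingular_combination_eq_0[where M = "\<lambda>i j. real_of_int (b i (c j))" and k = k])
  have "mat k k (\<lambda>(i, j). real_of_int (b i (c j))) = map_mat of_int (mat k k (\<lambda>(i, j). b i (c j)))"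
    by (rule eq_matI) auto
  thus "det (mat k k (\<lambda>(i, j). real_of_int (b i (c j)))) \<noteq> 0"
    using assms(1) by (simp add: lead_minor_def)
qed (use assms(2,3) in simp_all)

text \<open>Bareiss' identity (a case of Sylvester's determinant identity): one elimination round maps
  minors to minors after an exact division by the previous leading minor.\<close>
lemma minor_row_step:
  assumes k: "lead_minor b c k \<noteq> 0" and Sk: "lead_minor b c (Suc k) \<noteq> 0"
  shows "lead_minor b c k * minor_row b c (Suc k) v x =
    lead_minor b c (Suc k) * minor_row b c k v x - minor_row b c k v (c k) * minor_row b c k (b k) x"
proof -
  \<comment> \<open>The multiples of \<open>v\<close> cancel in \<open>\<delta>\<close>, which is thus a combination of the rows \<open>b 0, ..., b k\<close>. It
    vanishes in the columns \<open>c 0, ..., c k\<close>, where these rows are independent.\<close>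
  define \<delta> where "\<delta> x = lead_minor b c (Suc k) * minor_row b c k v x
    - minor_row b c k v (c k) * minor_row b c k (b k) x
    - lead_minor b c k * minor_row b c (Suc k) v x" for x
  obtain \<beta>1 where 1: "\<And>x. minor_row b c k v x = lead_minor b c k * v x + (\<Sum>l<k. \<beta>1 l * b l x)"
    using minor_row_expansion by metis
  obtain \<beta>2 where 2: "\<And>x. minor_row b c k (b k) x = lead_minor b c k * b k x + (\<Sum>l<k. \<beta>2 l * b l x)"
    using minor_row_expansion by metis
  obtain \<beta>3 where 3: "\<And>x. minor_row b c (Suc k) v x
      = lead_minor b c (Suc k) * v x + (\<Sum>l<Suc k. \<beta>3 l * b l x)"
    using minor_row_expansion by metis
  define q where "q = minor_row b c k v (c k)"
  define \<gamma> where "\<gamma> l = lead_minor b c (Suc k) * (if l < k then \<beta>1 l else 0)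
     - q * (if l < k then \<beta>2 l else lead_minor b c k) - lead_minor b c k * \<beta>3 l" for l
  have \<delta>: "\<delta> x = (\<Sum>l<Suc k. \<gamma> l * b l x)" for x
  proof -
    have "(\<Sum>l<k. \<gamma> l * b l x) = lead_minor b c (Suc k) * (\<Sum>l<k. \<beta>1 l * b l x)
        - q * (\<Sum>l<k. \<beta>2 l * b l x) - lead_minor b c k * (\<Sum>l<k. \<beta>3 l * b l x)"
      unfolding sum_distrib_left sum_subtractf[symmetric]
      by (rule sum.cong) (auto simp: \<gamma>_def algebra_simps)
    moreover have "\<delta> x = lead_minor b c (Suc k) * (lead_minor b c k * v x + (\<Sum>l<k. \<beta>1 l * b l x))
      - q * (lead_minor b c k * b k x + (\<Sum>l<k. \<beta>2 l * b l x))
      - lead_minor b c k * (lead_minor b c (Suc k) * v x + ((\<Sum>l<k. \<beta>3 l * b l x) + \<beta>3 k * b k x))"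
      unfolding \<delta>_def q_def[symmetric] using 1 2 3 by simp
    ultimately show ?thesis by (simp add: \<gamma>_def algebra_simps)
  qed
  have "\<delta> (c j) = 0" if "j < Suc k" for j
  proof (cases "j = k")
    case True
    thus ?thesis using minor_row_vanishes[of k "Suc k" b c v]
      by (simp add: \<delta>_def)
  next
    case False
    with that have "j < k" by simp
    thus ?thesis using that by (simp add: \<delta>_def minor_row_vanishes)
  qed
  hence "\<gamma> l = 0" if "l < Suc k" for l
    using nonsingular_combination_eq_0[of "Suc k" "\<lambda>i j. b i (c j)" \<gamma> l] that Sk
    by (simp add: \<delta> lead_minor_def del: sum.lessThan_Suc)
  hence "\<delta> x = 0" unfolding \<delta> by simp
  thus ?thesis by (simp add: \<delta>_def)
qed

text \<open>Equal pivot columns would give a minor with two equal columns.\<close>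
lemma lead_minor_inj:
  assumes "lead_minor b c k \<noteq> 0"
  shows "inj_on c {..<k}"
proof (rule inj_onI, rule ccontr)
  fix i j assume ij: "i \<in> {..<k}" "j \<in> {..<k}" "c i = c j" "i \<noteq> j"
  have "lead_minor b c k = 0" unfolding lead_minor_def
    by (rule det_identical_columns[of _ k i j]) (use ij in \<open>auto intro!: eq_vecI\<close>)
  with assms show False ..
qed

text \<open>The crude bound by the Leibniz formula; it is all that is needed for polynomial bit size.\<close>
lemma abs_det_le:
  fixes A :: "int mat"
  assumes A: "A \<in> carrier_mat n n" and a: "\<And>i j. i < n \<Longrightarrow> j < n \<Longrightarrow> \<bar>A $$ (i, j)\<bar> \<le> a"
  shows "\<bar>det A\<bar> \<le> fact n * a ^ n"
proof -
  have "\<bar>det A\<bar> \<le> (\<Sum>p | p permutes {0..<n}. \<bar>of_int (sign p) * (\<Prod>i = 0..<n. A $$ (i, p i))\<bar>)"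
    unfolding det_def'[OF A] by (rule sum_abs)
  also have "\<dots> \<le> (\<Sum>p | p permutes {0..<n}. a ^ n)"
  proof (rule sum_mono)
    fix p assume "p \<in> {p. p permutes {0..<n}}"
    hence p: "p i < n" if "i < n" for i using that permutes_in_image[of p "{0..<n}" i] by simp
    have "\<bar>of_int (sign p) * (\<Prod>i = 0..<n. A $$ (i, p i))\<bar> = (\<Prod>i = 0..<n. \<bar>A $$ (i, p i)\<bar>)"
      by (simp add: abs_mult sign_def abs_prod)
    also have "\<dots> \<le> (\<Prod>i = 0..<n. a)" by (rule prod_mono) (use a p in auto)
    finally show "\<bar>of_int (sign p) * (\<Prod>i = 0..<n. A $$ (i, p i))\<bar> \<le> a ^ n" by simp
  qed
  also have "\<dots> = fact n * a ^ n" by (simp add: card_permutations)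
  finally show ?thesis .
qed

lemma abs_minor_row_le:
  assumes "\<And>i x. i < k \<Longrightarrow> \<bar>b i x\<bar> \<le> a" "\<And>x. \<bar>v x\<bar> \<le> a"
  shows "\<bar>minor_row b c k v x\<bar> \<le> fact (Suc k) * a ^ Suc k"
  unfolding minor_row_def by (rule abs_det_le) (use assms in auto)

section \<open>Independence and spans of finite families\<close>

context vec_space begin

lemma lincomb_image_index:
  assumes "finite A" "inj_on f A" "f ` A \<subseteq> carrier_vec n" "x < n"
  shows "lincomb g (f ` A) $ x = (\<Sum>i\<in>A. g (f i) * f i $ x)"
  using lincomb_index[OF assms(4,3)] assms(2) by (simp add: sum.reindex)

text \<open>Coordinatewise criterion for families instead of sets: with coefficients indexed by \<open>A\<close>,
  independence also yields injectivity.\<close>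
lemma independent_familyI:
  assumes fin: "finite A" and car: "f ` A \<subseteq> carrier_vec n"
    and ind: "\<And>\<beta>. \<forall>x<n. (\<Sum>i\<in>A. \<beta> i * f i $ x) = 0 \<Longrightarrow> \<forall>i\<in>A. \<beta> i = 0"
  shows "inj_on f A" "lin_indpt (f ` A)"
proof -
  show inj: "inj_on f A"
  proof (rule inj_onI, rule ccontr)
    fix i j assume ij: "i \<in> A" "j \<in> A" "f i = f j" "i \<noteq> j"
    \<comment> \<open>A repeated vector would allow the coefficients \<open>1\<close> and \<open>-1\<close>.\<close>
    define \<beta> where "\<beta> l = (if l = i then 1 else if l = j then - 1 else 0 :: 'a)" for l
    have sum0: "(\<Sum>l\<in>A. \<beta> l * f l $ x) = 0" for x
    proof -
      have "(\<Sum>l\<in>A. \<beta> l * f l $ x) = (\<Sum>l\<in>{i, j}. \<beta> l * f l $ x)"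
        by (rule sum.mono_neutral_right) (use ij(1,2) fin in \<open>auto simp: \<beta>_def\<close>)
      also have "\<dots> = \<beta> i * f i $ x + \<beta> j * f j $ x" using ij(4) by simp
      also have "\<dots> = 0" unfolding ij(3) using ij(4) by (simp add: \<beta>_def)
      finally show ?thesis .
    qed
    have "\<forall>l\<in>A. \<beta> l = 0" by (rule ind) (simp only: sum0 simp_thms)
    hence "\<beta> i = 0" using ij(1) by (rule bspec)
    thus False by (simp add: \<beta>_def)
  qed
  show "lin_indpt (f ` A)"
  proof (rule finite_lin_indpt2)
    show "finite (f ` A)" using fin by simp
    show "f ` A \<subseteq> carrier_vec n" using car by simp
    fix a assume z: "lincomb a (f ` A) = 0\<^sub>v n"
    have sum0: "(\<Sum>i\<in>A. a (f i) * f i $ x) = 0" if "x < n" for x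
      using lincomb_image_index[OF fin inj car that, of a, symmetric] that unfolding z by simp
    have "\<forall>i\<in>A. a (f i) = 0" by (rule ind) (use sum0 in blast)
    thus "\<forall>v\<in>f ` A. a v = 0" by simp
  qed
qed

lemma in_span_familyI:
  assumes fin: "finite A" and inj: "inj_on f A" and car: "f ` A \<subseteq> carrier_vec n"
    and w: "w \<in> carrier_vec n" "\<And>x. x < n \<Longrightarrow> w $ x = (\<Sum>i\<in>A. \<alpha> i * f i $ x)"
  shows "w \<in> span (f ` A)"
proof -
  define a where "a u = \<alpha> (inv_into A f u)" for u
  have "lincomb a (f ` A) \<in> carrier_vec n"
    using lincomb_closed[of "f ` A" a] car by (auto simp: module_vec_simps class_ring_simps)
  hence "w = lincomb a (f ` A)"
    using w(1) by (intro eq_vecI)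
      (auto simp add: lincomb_image_index[OF fin inj car] w(2) a_def inj intro!: sum.cong simp del: index_mult_mat)
  thus ?thesis unfolding span_def using fin by (auto simp: class_ring_simps)
qed

text \<open>A subspace is finite dimensional because independent sets in it are independent in the whole
  space, hence of bounded size; a maximal one is a basis.\<close>
lemma independent_card_le_subspace_dim:
  assumes W: "VectorSpace.subspace class_ring W V" and B: "B \<subseteq> W" "lin_indpt B"
  shows "card B \<le> vectorspace.dim class_ring (vs W)"
proof -
  interpret W: vectorspace class_ring "vs W" by (rule subspace_is_vs[OF W])
  have sub: "submodule class_ring W V" using W unfolding subspace_def by simp
  have WV: "W \<subseteq> carrier V" using sub unfolding submodule_def by simp
  have W_indep: "S \<subseteq> W \<Longrightarrow> W.lin_indpt S \<longleftrightarrow> lin_indpt S" for S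
    using span_li_not_depend(2)[OF _ sub] by simp
  have "\<exists>E. finite E \<and> maximal E (\<lambda>S. S \<subseteq> W \<and> W.lin_indpt S)"
  proof (rule maximal_exists[of _ n B])
    fix S assume S: "S \<subseteq> W \<and> W.lin_indpt S"
    hence "lin_indpt S" "S \<subseteq> carrier_vec n" using W_indep[of S] WV by auto
    from li_le_dim[OF fin_dim this(2,1)] show "finite S \<and> card S \<le> n"
      by (simp add: dim_is_n)
  next
    show "B \<subseteq> W \<and> W.lin_indpt B" using B W_indep[of B] by simp
  qed
  then obtain E where E: "finite E" "maximal E (\<lambda>S. S \<subseteq> W \<and> W.lin_indpt S)" by blast
  have bas: "W.basis E" using W.max_li_is_basis[of E] E(2) by simp
  hence "W.fin_dim" unfolding W.fin_dim_def W.basis_def using E(1) by auto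
  thus ?thesis using W.li_le_dim(2)[of B] B W_indep[of B] by simp
qed

lemma span_is_basis:
  assumes B: "finite B" "B \<subseteq> carrier_vec n" "lin_indpt B"
  shows "VectorSpace.subspace class_ring (span B) V"
    "vectorspace.basis class_ring (vs (span B)) B"
    "vectorspace.dim class_ring (vs (span B)) = card B"
proof -
  have BV: "B \<subseteq> carrier V" using B(2) by simp
  show sub: "VectorSpace.subspace class_ring (span B) V"
    using span_is_subspace[of B] BV by simp
  interpret S: vectorspace class_ring "vs (span B)" by (rule subspace_is_vs[OF sub])
  have sm: "submodule class_ring (span B) V" using sub unfolding subspace_def by simp
  have in_s: "B \<subseteq> span B" using in_own_span[OF B(2)] .
  show bas: "S.basis B"
    unfolding S.basis_def
    using span_li_not_depend[OF in_s sm] B(3) in_s by simp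
  show "S.dim = card B" by (rule S.dim_basis[OF B(1) bas])
qed

end

section \<open>Independent lists of integer vectors with pivot columns\<close>

text \<open>The list \<open>ps\<close> names the vectors accepted by the elimination and \<open>c\<close> their pivot columns. Nonzero
  leading minors certify that the vectors are independent.\<close>
definition pivoted :: "nat \<Rightarrow> ('p \<Rightarrow> nat \<Rightarrow> int) \<Rightarrow> 'p list \<Rightarrow> (nat \<Rightarrow> nat) \<Rightarrow> bool" where
  "pivoted N U ps c \<longleftrightarrow>
     (\<forall>k\<le>length ps. lead_minor (\<lambda>i. U (ps ! i)) c k \<noteq> 0) \<and> (\<forall>k<length ps. c k < N)"

text \<open>Linear dependence over the rationals, with cleared denominators.\<close>
definition dependent_on :: "nat \<Rightarrow> ('p \<Rightarrow> nat \<Rightarrow> int) \<Rightarrow> 'p list \<Rightarrow> (nat \<Rightarrow> int) \<Rightarrow> bool" where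
  "dependent_on N U ps v \<longleftrightarrow>
     (\<exists>a \<alpha>. a \<noteq> 0 \<and> (\<forall>x<N. a * v x = (\<Sum>k<length ps. \<alpha> k * U (ps ! k) x)))"

lemma pivoted_Nil [simp]: "pivoted N U [] c"
  by (simp add: pivoted_def)

text \<open>A nonzero entry \<open>x\<close> of the reduced row is the next leading minor for the pivot column \<open>x\<close>.\<close>
lemma pivoted_snoc:
  assumes "pivoted N U ps c" "x < N" "minor_row (\<lambda>i. U (ps ! i)) c (length ps) (U q) x \<noteq> 0"
  shows "pivoted N U (ps @ [q]) (c(length ps := x))"
  unfolding pivoted_def
proof (intro conjI allI impI)
  let ?U = "\<lambda>i. U ((ps @ [q]) ! i)" and ?c = "c(length ps := x)"
  fix k
  show "?c k < N" if "k < length (ps @ [q])"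
    using assms(1,2) that by (auto simp: pivoted_def)
  assume k: "k \<le> length (ps @ [q])"
  show "lead_minor ?U ?c k \<noteq> 0"
  proof (cases "k = Suc (length ps)")
    case True
    have "lead_minor ?U ?c k = minor_row ?U ?c (length ps) (?U (length ps)) (?c (length ps))"
      unfolding True by (rule minor_row_own[symmetric])
    also have "\<dots> = minor_row (\<lambda>i. U (ps ! i)) c (length ps) (U q) x"
      by (simp, rule fun_cong[OF minor_row_cong]) (auto simp: nth_append)
    finally show ?thesis using assms(3) by simp
  next
    case False
    hence "k \<le> length ps" using k by simp
    moreover have "lead_minor ?U ?c k = lead_minor (\<lambda>i. U (ps ! i)) c k"
      by (rule lead_minor_cong) (use \<open>k \<le> length ps\<close> in \<open>auto simp: nth_append\<close>)
    ultimately show ?thesis using assms(1) by (simp add: pivoted_def)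
  qed
qed

text \<open>There are at most as many pivots as columns.\<close>
lemma pivoted_length_le:
  assumes "pivoted N U ps c"
  shows "length ps \<le> N"
proof -
  have "inj_on c {..<length ps}" "c ` {..<length ps} \<subseteq> {..<N}"
    using assms lead_minor_inj[of "\<lambda>i. U (ps ! i)" c "length ps"] by (auto simp: pivoted_def)
  from card_inj_on_le[OF this] show ?thesis by simp
qed

text \<open>If the reduced row vanishes, its expansion is the dependence.\<close>
lemma dependent_on_if_minor_row_0:
  assumes "pivoted N U ps c" "\<And>x. x < N \<Longrightarrow> minor_row (\<lambda>i. U (ps ! i)) c (length ps) v x = 0"
  shows "dependent_on N U ps v"
proof -
  obtain \<beta> where \<beta>: "minor_row (\<lambda>i. U (ps ! i)) c (length ps) v x
      = lead_minor (\<lambda>i. U (ps ! i)) c (length ps) * v x + (\<Sum>l<length ps. \<beta> l * U (ps ! l) x)" for x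
    using minor_row_expansion by metis
  have "lead_minor (\<lambda>i. U (ps ! i)) c (length ps) * v x = (\<Sum>l<length ps. - \<beta> l * U (ps ! l) x)"
    if "x < N" for x
    using \<beta>[of x] assms(2)[OF that] by (simp add: sum_negf)
  moreover have "lead_minor (\<lambda>i. U (ps ! i)) c (length ps) \<noteq> 0"
    using assms(1) by (simp add: pivoted_def)
  ultimately show ?thesis unfolding dependent_on_def
    by (intro exI[of _ "lead_minor (\<lambda>i. U (ps ! i)) c (length ps)"] exI[of _ "\<lambda>l. - \<beta> l"]) simp
qed

lemma dependent_on_append:
  assumes "dependent_on N U ps v"
  shows "dependent_on N U (ps @ qs) v"
proof -
  obtain a \<alpha> where a: "a \<noteq> 0" and \<alpha>: "\<And>x. x < N \<Longrightarrow> a * v x = (\<Sum>k<length ps. \<alpha> k * U (ps ! k) x)"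
    using assms by (auto simp: dependent_on_def)
  define \<alpha>' where "\<alpha>' k = (if k < length ps then \<alpha> k else 0)" for k
  have "(\<Sum>k<length (ps @ qs). \<alpha>' k * U ((ps @ qs) ! k) x) = (\<Sum>k<length ps. \<alpha> k * U (ps ! k) x)" for x
    by (rule sum.mono_neutral_cong_right) (auto simp: \<alpha>'_def nth_append)
  thus ?thesis unfolding dependent_on_def using a \<alpha>
    by (intro exI[of _ a] exI[of _ \<alpha>']) simp
qed

lemma dependent_on_member:
  assumes "p \<in> set ps"
  shows "dependent_on N U ps (U p)"
proof -
  obtain l where l: "l < length ps" "ps ! l = p" using assms by (auto simp: in_set_conv_nth)
  have "1 * U p x = (\<Sum>k<length ps. (if k = l then 1 else 0) * U (ps ! k) x)" for x
    using l by (simp add: if_distrib[of "\<lambda>t. t * _"] cong: if_cong)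
  thus ?thesis unfolding dependent_on_def
    by (intro exI[of _ 1] exI[of _ "\<lambda>k. if k = l then 1 else 0"]) simp
qed

lemma pivoted_independent_nth:
  fixes \<beta> :: "nat \<Rightarrow> real"
  assumes "pivoted N U ps c"
    and "\<And>x. x < N \<Longrightarrow> (\<Sum>k<length ps. \<beta> k * real_of_int (U (ps ! k) x)) = 0"
    and "k < length ps"
  shows "\<beta> k = 0"
  by (rule lead_minor_independent[of "\<lambda>i. U (ps ! i)" c "length ps"])
    (use assms in \<open>simp_all add: pivoted_def\<close>)

lemma pivoted_distinct:
  assumes "pivoted N U ps c"
  shows "distinct ps"
  unfolding distinct_conv_nth
proof (intro allI impI notI)
  fix i j assume ij: "i < length ps" "j < length ps" "i \<noteq> j" "ps ! i = ps ! j"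
  \<comment> \<open>A repeated entry would allow the coefficients \<open>1\<close> and \<open>-1\<close>.\<close>
  define \<beta> where "\<beta> l = (if l = i then 1 else if l = j then - 1 else 0 :: real)" for l
  have "\<beta> i = 0"
  proof (rule pivoted_independent_nth[OF assms _ ij(1)])
    fix x
    have "(\<Sum>l<length ps. \<beta> l * real_of_int (U (ps ! l) x)) = (\<Sum>l\<in>{i, j}. \<beta> l * real_of_int (U (ps ! l) x))"
      by (rule sum.mono_neutral_right) (use ij(1,2) in \<open>auto simp: \<beta>_def\<close>)
    also have "\<dots> = 0" using ij(3,4) by (simp add: \<beta>_def)
    finally show "(\<Sum>l<length ps. \<beta> l * real_of_int (U (ps ! l) x)) = 0" .
  qed
  thus False by (simp add: \<beta>_def)
qed

lemma sum_nth_eq_sum_set: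
  assumes "distinct ps"
  shows "(\<Sum>k<length ps. f (ps ! k)) = (\<Sum>p\<in>set ps. f p)"
  using sum.reindex_bij_betw[OF bij_betw_nth[OF assms refl refl], of f] by simp

lemma pivoted_independent:
  fixes \<beta> :: "'p \<Rightarrow> real"
  assumes piv: "pivoted N U ps c"
    and z: "\<And>x. x < N \<Longrightarrow> (\<Sum>p\<in>set ps. \<beta> p * real_of_int (U p x)) = 0"
    and p: "p \<in> set ps"
  shows "\<beta> p = 0"
proof -
  obtain k where k: "k < length ps" "ps ! k = p" using p by (auto simp: in_set_conv_nth)
  have "\<beta> (ps ! k) = 0"
  proof (rule pivoted_independent_nth[OF piv _ k(1)])
    fix x assume "x < N"
    thus "(\<Sum>k<length ps. \<beta> (ps ! k) * real_of_int (U (ps ! k) x)) = 0"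
      using sum_nth_eq_sum_set[OF pivoted_distinct[OF piv], of "\<lambda>p. \<beta> p * real_of_int (U p x)"]
        z[of x] by simp
  qed
  thus ?thesis using k by simp
qed

text \<open>Coefficients indexed by the vectors themselves instead of their positions: the form in which
  spans are computed.\<close>
lemma dependent_on_real_combination:
  assumes "pivoted N U ps c" "dependent_on N U ps v"
  shows "\<exists>\<alpha> :: 'p \<Rightarrow> real. \<forall>x<N. real_of_int (v x) = (\<Sum>p\<in>set ps. \<alpha> p * real_of_int (U p x))"
proof -
  have dist: "distinct ps" by (rule pivoted_distinct[OF assms(1)])
  obtain a \<alpha> where a: "a \<noteq> 0" and \<alpha>: "\<And>x. x < N \<Longrightarrow> a * v x = (\<Sum>k<length ps. \<alpha> k * U (ps ! k) x)"
    using assms(2) by (auto simp: dependent_on_def)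
  define g where "g p = real_of_int (\<alpha> (THE k. k < length ps \<and> ps ! k = p)) / real_of_int a" for p
  have the: "(THE l. l < length ps \<and> ps ! l = ps ! k) = k" if "k < length ps" for k
    using dist that by (intro the_equality) (auto simp: nth_eq_iff_index_eq)
  have "real_of_int (v x) = (\<Sum>p\<in>set ps. g p * real_of_int (U p x))" if "x < N" for x
  proof -
    have "real_of_int a * real_of_int (v x) = (\<Sum>k<length ps. real_of_int (\<alpha> k) * real_of_int (U (ps ! k) x))"
      using arg_cong[OF \<alpha>[OF that], of real_of_int] by simp
    hence "real_of_int (v x) = (\<Sum>k<length ps. real_of_int (\<alpha> k) * real_of_int (U (ps ! k) x)) / real_of_int a"
      using a by (simp add: field_simps)
    also have "\<dots> = (\<Sum>k<length ps. g (ps ! k) * real_of_int (U (ps ! k) x))"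
      unfolding sum_divide_distrib by (rule sum.cong) (auto simp: g_def the)
    also have "\<dots> = (\<Sum>p\<in>set ps. g p * real_of_int (U p x))"
      by (rule sum_nth_eq_sum_set[OF dist])
    finally show ?thesis .
  qed
  thus ?thesis by blast
qed

section \<open>Subspace recovery as minimisation of a set function\<close>

locale srsr_data =
  fixes n m :: nat and d :: "nat \<Rightarrow> nat" and v :: "nat \<Rightarrow> nat \<Rightarrow> rat vec"
  assumes inst: "srsr_instance n m d v"
begin

text \<open>Data sets and data points are numbered from 1 in an instance. Here they are numbered from 0,
  with \<open>Suc\<close> as translation. Block \<open>j\<close> of a vector of length \<open>D\<close> starts at \<open>off j\<close>.\<close>
definition off :: "nat \<Rightarrow> nat" where
  "off j = (\<Sum>j'<j. d (Suc j'))"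

definition D :: nat where "D = off m"

definition X :: "nat \<Rightarrow> nat \<Rightarrow> real vec" where
  "X j i = real_vec (v j i)"

abbreviation dp :: "nat \<Rightarrow> nat \<Rightarrow> real vec" where
  "dp j i \<equiv> X (Suc j) (Suc i)"

abbreviation pairs :: "nat set \<Rightarrow> (nat \<times> nat) set" where
  "pairs S \<equiv> S \<times> {..<m}"

lemma n_pos: "n > 0" and m_pos: "m > 0" and d_pos: "j < m \<Longrightarrow> d (Suc j) > 0"
  using inst by (auto simp: srsr_instance_def)

lemma v_carrier: "i < n \<Longrightarrow> j < m \<Longrightarrow> v (Suc j) (Suc i) \<in> carrier_vec (d (Suc j))"
  using inst by (auto simp: srsr_instance_def)

lemma dp_carrier [simp]: "i < n \<Longrightarrow> j < m \<Longrightarrow> dp j i \<in> carrier_vec (d (Suc j))"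
  using v_carrier[of i j] by (simp add: X_def)

lemma sum_Suc_shift: "(\<Sum>j = 1..k. f j) = (\<Sum>j<k. f (Suc j))"
  by (simp add: sum.atLeast1_atMost_eq)

lemma D_eq: "D = (\<Sum>j = 1..m. d j)"
  unfolding D_def off_def by (rule sum_Suc_shift[symmetric])

lemma off_Suc: "off (Suc j) = off j + d (Suc j)"
  by (simp add: off_def)

lemma off_mono: "j \<le> j' \<Longrightarrow> off j \<le> off j'"
  unfolding off_def by (rule sum_mono2) auto

lemma m_le_D: "m \<le> D"
proof -
  have "(\<Sum>j<m. 1) \<le> (\<Sum>j<m. d (Suc j))"
    by (rule sum_mono) (use d_pos in \<open>simp add: Suc_le_eq\<close>)
  thus ?thesis by (simp add: D_def off_def)
qed

lemma D_pos: "D > 0"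
  using m_le_D m_pos by simp

lemma off_less_D: "j < m \<Longrightarrow> x < d (Suc j) \<Longrightarrow> off j + x < D"
  using off_mono[of "Suc j" m] by (simp add: off_Suc D_def)

definition correct_output :: "int list \<Rightarrow> bool" where
  "correct_output ys \<longleftrightarrow> decides_and_computes_srsr n m d X ys \<and>
     ((\<exists>T. srsr_solution n m d X T) \<longrightarrow> (\<forall>T. answers m d ys T \<longrightarrow> optimal_srsr_solution n m d X T))"

end

text \<open>\<open>W\<close> is a common multiple of all denominators.\<close>
locale srsr_problem = srsr_data +
  fixes W :: int
  assumes W_pos: "W > 0"
    and denominator_dvd_W: "\<And>i j x. i < n \<Longrightarrow> j < m \<Longrightarrow> x < d (Suc j) \<Longrightarrow>
          snd (quotient_of (v (Suc j) (Suc i) $ x)) dvd W"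
begin

text \<open>The data point \<open>v\<^sup>j\<^sub>i\<close>, scaled to an integer vector and placed into block \<open>j\<close> of a vector of
  length \<open>D\<close>. Vectors of different blocks are independent of each other, so the rank of a family of
  these vectors is the sum of the ranks of its blocks.\<close>
definition U :: "nat \<times> nat \<Rightarrow> nat \<Rightarrow> int" where
  "U = (\<lambda>(i, j) x.
     if off j \<le> x \<and> x < off (Suc j)
     then fst (quotient_of (v (Suc j) (Suc i) $ (x - off j))) * W
            div snd (quotient_of (v (Suc j) (Suc i) $ (x - off j)))
     else 0)"

lemma U_block:
  assumes "i < n" "j < m" "x < d (Suc j)"
  shows "real_of_int (U (i, j) (off j + x)) = real_of_int W * dp j i $ x"
proof -
  obtain a b where q: "quotient_of (v (Suc j) (Suc i) $ x) = (a, b)" by force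
  have b: "b dvd W" "b > 0" using denominator_dvd_W[OF assms] q quotient_of_denom_pos[OF q] by auto
  obtain w where w: "W = b * w" using b(1) by (auto simp: dvd_def)
  have "U (i, j) (off j + x) = a * W div b"
    using assms q by (simp add: U_def off_Suc)
  also have "\<dots> = a * w" using b(2) by (simp add: w mult.left_commute)
  finally have "U (i, j) (off j + x) = a * w" .
  moreover have "dp j i $ x = real_of_int a / real_of_int b"
    using v_carrier[OF assms(1,2)] assms(3) quotient_of_div[OF q] by (simp add: X_def of_rat_divide)
  ultimately show ?thesis using b(2) w by simp
qed

lemma U_other_block:
  assumes "j \<noteq> j'" "x < d (Suc j')"
  shows "U (i, j) (off j' + x) = 0"
proof (cases "j < j'")
  case True
  thus ?thesis using off_mono[of "Suc j" j'] by (simp add: U_def)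
next
  case False
  hence "Suc j' \<le> j" using assms(1) by simp
  thus ?thesis using off_mono[of "Suc j'" j] assms(2) by (simp add: U_def off_Suc)
qed

definition subspaces :: "(nat \<Rightarrow> real vec set) \<Rightarrow> bool" where
  "subspaces T \<longleftrightarrow> (\<forall>j\<in>{1..m}. is_subspace (d j) (T j))"

text \<open>The integer whose negative sign characterises solutions and whose minimisers are the optimal
  ones.\<close>
definition defect :: "(nat \<Rightarrow> real vec set) \<Rightarrow> int" where
  "defect T = int n * (\<Sum>j = 1..m. int (subspace_dim (d j) (T j))) - int D * int (card (inliers n m X T))"

lemma card_minus_threshold:
  "real (card (inliers n m X T)) - threshold n m d T = - real_of_int (defect T) / real D"
  using D_pos unfolding threshold_def defect_def D_eq[symmetric]
  by (simp add: field_simps)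

lemma srsr_solution_iff: "srsr_solution n m d X T \<longleftrightarrow> subspaces T \<and> defect T < 0"
proof -
  have "real (card (inliers n m X T)) > threshold n m d T \<longleftrightarrow> - real_of_int (defect T) / real D > 0"
    using card_minus_threshold[of T] by linarith
  also have "\<dots> \<longleftrightarrow> defect T < 0"
    using D_pos by (simp add: field_simps)
  finally show ?thesis by (simp add: srsr_solution_def subspaces_def)
qed

lemma optimal_srsr_solutionI:
  assumes "srsr_solution n m d X T" "\<And>T'. subspaces T' \<Longrightarrow> defect T \<le> defect T'"
  shows "optimal_srsr_solution n m d X T"
  unfolding optimal_srsr_solution_def card_minus_threshold
  using assms D_pos by (auto simp: srsr_solution_iff divide_right_mono)

definition chosen :: "(nat \<times> nat) list \<Rightarrow> nat \<Rightarrow> nat set" where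
  "chosen ps j = {i. (i, j) \<in> set ps}"

lemma chosen_finite [simp]: "finite (chosen ps j)"
proof -
  have "chosen ps j \<subseteq> fst ` set ps" by (force simp: chosen_def)
  thus ?thesis by (rule finite_subset) simp
qed

lemma card_eq_sum_chosen:
  assumes "set ps \<subseteq> pairs {..<n}"
  shows "card {p \<in> set ps. fst p \<in> I} = (\<Sum>j<m. card (chosen ps j \<inter> I))"
proof -
  have "{p \<in> set ps. fst p \<in> I} = (\<Union>j\<in>{..<m}. (\<lambda>i. (i, j)) ` (chosen ps j \<inter> I))"
    using assms by (force simp: chosen_def)
  also have "card \<dots> = (\<Sum>j<m. card ((\<lambda>i. (i, j)) ` (chosen ps j \<inter> I)))"
    by (rule card_UN_disjoint) auto
  also have "\<dots> = (\<Sum>j<m. card (chosen ps j \<inter> I))"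
    by (intro sum.cong refl card_image inj_onI) simp
  finally show ?thesis .
qed

text \<open>A relation within block \<open>j\<close>, extended by zero, is a relation between all vectors of \<open>ps\<close>.\<close>
lemma chosen_independent:
  assumes piv: "pivoted D U ps c" and ps: "set ps \<subseteq> pairs {..<n}" and j: "j < m"
  shows "inj_on (dp j) (chosen ps j)"
    "\<not> module.lin_dep class_ring (module_vec TYPE(real) (d (Suc j))) (dp j ` chosen ps j)"
proof -
  interpret vs: vec_space "TYPE(real)" "d (Suc j)" .
  have car: "dp j ` chosen ps j \<subseteq> carrier_vec (d (Suc j))"
    using ps j by (auto simp: chosen_def)
  have ind: "\<forall>i\<in>chosen ps j. \<beta> i = 0"
    if z: "\<forall>x<d (Suc j). (\<Sum>i\<in>chosen ps j. \<beta> i * dp j i $ x) = 0" for \<beta> :: "nat \<Rightarrow> real"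
  proof
    fix i assume i: "i \<in> chosen ps j"
    \<comment> \<open>The given coefficients in block \<open>j\<close>, zero in the other blocks.\<close>
    define \<gamma> where "\<gamma> p = (if snd p = j then \<beta> (fst p) else 0)" for p :: "nat \<times> nat"
    have "\<gamma> (i, j) = 0"
    proof (rule pivoted_independent[OF piv])
      show "(i, j) \<in> set ps" using i by (simp add: chosen_def)
      fix x assume "x < D"
      have "(\<Sum>p\<in>set ps. \<gamma> p * real_of_int (U p x))
          = (\<Sum>p\<in>(\<lambda>i. (i, j)) ` chosen ps j. \<gamma> p * real_of_int (U p x))"
        by (rule sum.mono_neutral_right) (auto simp: \<gamma>_def chosen_def image_iff)
      also have "\<dots> = (\<Sum>i\<in>chosen ps j. \<beta> i * real_of_int (U (i, j) x))"
        by (subst sum.reindex) (auto simp: \<gamma>_def inj_on_def)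
      also have "\<dots> = 0"
      proof (cases "off j \<le> x \<and> x < off (Suc j)")
        case True
        define y where "y = x - off j"
        have y: "x = off j + y" "y < d (Suc j)" using True by (auto simp: y_def off_Suc)
        have "(\<Sum>i\<in>chosen ps j. \<beta> i * real_of_int (U (i, j) x))
            = (\<Sum>i\<in>chosen ps j. real_of_int W * (\<beta> i * dp j i $ y))"
          unfolding y(1) by (rule sum.cong) (use ps j y(2) in \<open>auto simp: U_block chosen_def\<close>)
        also have "\<dots> = 0"
          unfolding sum_distrib_left[symmetric] using z y(2) by simp
        finally show ?thesis .
      next
        case False
        thus ?thesis by (auto simp: U_def)
      qed
      finally show "(\<Sum>p\<in>set ps. \<gamma> p * real_of_int (U p x)) = 0" .
    qed
    thus "\<beta> i = 0" by (simp add: \<gamma>_def)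
  qed
  show "inj_on (dp j) (chosen ps j)" "vs.lin_indpt (dp j ` chosen ps j)"
    by (rule vs.independent_familyI[OF chosen_finite car ind]; assumption)+
qed

text \<open>Only the vectors of block \<open>j\<close> have nonzero entries there, so the relation restricts to them.\<close>
lemma chosen_spans:
  assumes piv: "pivoted D U ps c" and ps: "set ps \<subseteq> pairs {..<n}" and ij: "i < n" "j < m"
    and dep: "dependent_on D U ps (U (i, j))"
  shows "dp j i \<in> module.span class_ring (module_vec TYPE(real) (d (Suc j))) (dp j ` chosen ps j)"
proof -
  interpret vs: vec_space "TYPE(real)" "d (Suc j)" .
  have car: "dp j ` chosen ps j \<subseteq> carrier_vec (d (Suc j))"
    using ps ij by (auto simp: chosen_def)
  obtain \<alpha> :: "nat \<times> nat \<Rightarrow> real"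
    where \<alpha>: "\<And>x. x < D \<Longrightarrow> real_of_int (U (i, j) x) = (\<Sum>p\<in>set ps. \<alpha> p * real_of_int (U p x))"
    using dependent_on_real_combination[OF piv dep] by blast
  show ?thesis
  proof (rule vs.in_span_familyI[OF chosen_finite chosen_independent(1)[OF piv ps ij(2)] car])
    show "dp j i \<in> carrier_vec (d (Suc j))" using ij by simp
    fix x assume x: "x < d (Suc j)"
    have "real_of_int W * dp j i $ x = (\<Sum>p\<in>set ps. \<alpha> p * real_of_int (U p (off j + x)))"
      using \<alpha>[OF off_less_D[OF ij(2) x]] U_block[OF ij x] by simp
    also have "\<dots> = (\<Sum>p\<in>(\<lambda>i. (i, j)) ` chosen ps j. \<alpha> p * real_of_int (U p (off j + x)))"
    proof (rule sum.mono_neutral_right)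
      show "\<forall>p\<in>set ps - (\<lambda>i. (i, j)) ` chosen ps j. \<alpha> p * real_of_int (U p (off j + x)) = 0"
      proof
        fix p assume p: "p \<in> set ps - (\<lambda>i. (i, j)) ` chosen ps j"
        hence "snd p \<noteq> j" by (cases p) (auto simp: chosen_def)
        hence "U p (off j + x) = 0" using U_other_block[OF _ x, of "snd p" "fst p"] by simp
        thus "\<alpha> p * real_of_int (U p (off j + x)) = 0" by simp
      qed
    qed (auto simp: chosen_def)
    also have "\<dots> = (\<Sum>i\<in>chosen ps j. \<alpha> (i, j) * real_of_int (U (i, j) (off j + x)))"
      by (subst sum.reindex) (auto simp: inj_on_def)
    also have "\<dots> = (\<Sum>i\<in>chosen ps j. real_of_int W * (\<alpha> (i, j) * dp j i $ x))"
      by (rule sum.cong) (use ps ij(2) x in \<open>auto simp: U_block chosen_def\<close>)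
    also have "\<dots> = real_of_int W * (\<Sum>i\<in>chosen ps j. \<alpha> (i, j) * dp j i $ x)"
      by (simp add: sum_distrib_left)
    finally show "dp j i $ x = (\<Sum>i\<in>chosen ps j. \<alpha> (i, j) * dp j i $ x)"
      using W_pos by simp
  qed
qed

text \<open>The upper bound behind optimality: among the accepted vectors, those that belong to inliers of
  \<open>T\<close> are independent in each block and lie in \<open>T\<close>.\<close>
lemma chosen_le_dim:
  assumes piv: "pivoted D U ps c" and ps: "set ps \<subseteq> pairs {..<n}" and T: "subspaces T"
  shows "card {p \<in> set ps. fst p \<in> {i. i < n \<and> Suc i \<in> inliers n m X T}}
    \<le> (\<Sum>j = 1..m. subspace_dim (d j) (T j))"
proof -
  let ?I = "{i. i < n \<and> Suc i \<in> inliers n m X T}"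
  have "card (chosen ps j \<inter> ?I) \<le> subspace_dim (d (Suc j)) (T (Suc j))" if j: "j < m" for j
  proof -
    interpret vs: vec_space "TYPE(real)" "d (Suc j)" .
    let ?B = "dp j ` (chosen ps j \<inter> ?I)"
    have car: "dp j ` chosen ps j \<subseteq> carrier_vec (d (Suc j))"
      using ps j by (auto simp: chosen_def)
    have "?B \<subseteq> T (Suc j)" using j by (auto simp: inliers_def)
    moreover have "vs.lin_indpt ?B"
      using vs.subset_li_is_li[of "dp j ` chosen ps j" ?B] chosen_independent(2)[OF piv ps j] car
      by auto
    moreover have "is_subspace (d (Suc j)) (T (Suc j))" using T j by (auto simp: subspaces_def)
    ultimately have "card ?B \<le> subspace_dim (d (Suc j)) (T (Suc j))"
      by (intro vs.independent_card_le_subspace_dim)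
    moreover have "card ?B = card (chosen ps j \<inter> ?I)"
      by (rule card_image) (rule inj_on_subset[OF chosen_independent(1)[OF piv ps j]], simp)
    ultimately show ?thesis by simp
  qed
  thus ?thesis unfolding card_eq_sum_chosen[OF ps] sum_Suc_shift by (intro sum_mono) simp
qed

definition spans :: "nat set \<Rightarrow> nat \<Rightarrow> real vec set" where
  "spans S j = module.span class_ring (module_vec TYPE(real) (d j)) (X j ` Suc ` S)"

text \<open>If the accepted vectors generate those of all indices in \<open>S\<close>, they form a basis in each block.\<close>
lemma spans_basis:
  assumes piv: "pivoted D U ps c" and S: "S \<subseteq> {..<n}" and ps: "set ps \<subseteq> pairs S"
    and dep: "\<And>p. p \<in> pairs S \<Longrightarrow> dependent_on D U ps (U p)" and j: "j < m"
  shows "is_subspace (d (Suc j)) (spans S (Suc j))"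
    "is_basis (d (Suc j)) (spans S (Suc j)) (dp j ` chosen ps j)"
    "subspace_dim (d (Suc j)) (spans S (Suc j)) = card (chosen ps j)"
proof -
  interpret vs: vec_space "TYPE(real)" "d (Suc j)" .
  have ps': "set ps \<subseteq> pairs {..<n}" using ps S by auto
  have car: "dp j ` chosen ps j \<subseteq> carrier_vec (d (Suc j))"
    using ps' j by (auto simp: chosen_def)
  have carS: "X (Suc j) ` Suc ` S \<subseteq> carrier_vec (d (Suc j))"
    using S j by auto
  have sub: "dp j ` chosen ps j \<subseteq> X (Suc j) ` Suc ` S" using ps by (auto simp: chosen_def)
  have "X (Suc j) ` Suc ` S \<subseteq> vs.span (dp j ` chosen ps j)"
  proof clarify
    fix i assume "i \<in> S"
    thus "dp j i \<in> vs.span (dp j ` chosen ps j)"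
      using chosen_spans[OF piv ps' _ j dep] S j by auto
  qed
  hence "vs.span (X (Suc j) ` Suc ` S) \<subseteq> vs.span (dp j ` chosen ps j)"
    using vs.span_subsetI[OF car] by simp
  moreover have "vs.span (dp j ` chosen ps j) \<subseteq> vs.span (X (Suc j) ` Suc ` S)"
    by (rule vs.span_is_monotone[OF sub])
  ultimately have eq: "spans S (Suc j) = vs.span (dp j ` chosen ps j)" by (simp add: spans_def)
  have fin: "finite (dp j ` chosen ps j)" by simp
  note basis = vs.span_is_basis[OF fin car chosen_independent(2)[OF piv ps' j]]
  show "is_subspace (d (Suc j)) (spans S (Suc j))"
    "is_basis (d (Suc j)) (spans S (Suc j)) (dp j ` chosen ps j)"
    unfolding eq by (rule basis)+
  show "subspace_dim (d (Suc j)) (spans S (Suc j)) = card (chosen ps j)"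
    unfolding eq basis(3) by (rule card_image[OF chosen_independent(1)[OF piv ps' j]])
qed

lemma inliers_spans:
  assumes S: "S \<subseteq> {..<n}"
  shows "Suc ` S \<subseteq> inliers n m X (spans S)"
proof -
  have "dp j i \<in> spans S (Suc j)" if "i \<in> S" "j < m" for i j
  proof -
    interpret vs: vec_space "TYPE(real)" "d (Suc j)" .
    have "X (Suc j) ` Suc ` S \<subseteq> carrier_vec (d (Suc j))" using S that by auto
    from vs.in_own_span[OF this] show ?thesis using that by (auto simp: spans_def)
  qed
  moreover have "\<exists>j'. j = Suc j' \<and> j' < m" if "j \<in> {1..m}" for j
    using that by (intro exI[of _ "j - 1"]) auto
  ultimately show ?thesis using S by (fastforce simp: inliers_def)
qed

lemma dim_spans:
  assumes "pivoted D U ps c" "S \<subseteq> {..<n}" "set ps \<subseteq> pairs S"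
    and "\<And>p. p \<in> pairs S \<Longrightarrow> dependent_on D U ps (U p)"
  shows "(\<Sum>j = 1..m. subspace_dim (d j) (spans S j)) = length ps"
proof -
  have ps: "set ps \<subseteq> pairs {..<n}" using assms(2,3) by auto
  have "(\<Sum>j = 1..m. subspace_dim (d j) (spans S j)) = (\<Sum>j<m. card (chosen ps j))"
    unfolding sum_Suc_shift using spans_basis(3)[OF assms] by simp
  also have "\<dots> = card (set ps)"
    using card_eq_sum_chosen[OF ps, of UNIV] by simp
  also have "\<dots> = length ps" by (rule distinct_card[OF pivoted_distinct[OF assms(1)]])
  finally show ?thesis .
qed

lemma subspaces_spans:
  assumes "S \<subseteq> {..<n}"
  shows "subspaces (spans S)"
  unfolding subspaces_def spans_def
proof
  fix j assume j: "j \<in> {1..m}"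
  interpret vs: vec_space "TYPE(real)" "d j" .
  have "X j ` Suc ` S \<subseteq> carrier_vec (d j)"
    using assms j inst by (auto simp: srsr_instance_def X_def)
  thus "is_subspace (d j) (vs.span (X j ` Suc ` S))" using vs.span_is_subspace by simp
qed

text \<open>The defect of the spans of \<open>S\<close>, with \<open>card S\<close> in place of the number of inliers of these spans,
  which may be larger. It is submodular in \<open>S\<close>, and its minimum is the minimum of the defect.\<close>
definition objective :: "nat set \<Rightarrow> int" where
  "objective S = int n * int (\<Sum>j = 1..m. subspace_dim (d j) (spans S j)) - int D * int (card S)"

lemma defect_spans_le: "S \<subseteq> {..<n} \<Longrightarrow> defect (spans S) \<le> objective S"
proof -
  assume S: "S \<subseteq> {..<n}"
  have "card (Suc ` S) \<le> card (inliers n m X (spans S))"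
    by (rule card_mono[OF _ inliers_spans[OF S]]) (simp add: inliers_def)
  hence "int D * int (card S) \<le> int D * int (card (inliers n m X (spans S)))"
    by (simp add: card_image mult_left_mono)
  thus ?thesis unfolding defect_def objective_def by simp
qed

end

section \<open>The potential of projected subgradient descent\<close>

text \<open>Layer cake: \<open>X i\<close> is the number of thresholds \<open>\<theta> \<in> {1..K}\<close> below it, so the right-hand side is the
  sum over these \<open>\<theta>\<close> of the sums over the level sets.\<close>
lemma layer_cake_bound:
  fixes X w :: "nat \<Rightarrow> int" and K best :: int
  assumes X: "\<And>i. i < n \<Longrightarrow> 0 \<le> X i \<and> X i \<le> K"
    and best: "\<And>\<theta>. 1 \<le> \<theta> \<Longrightarrow> \<theta> \<le> K \<Longrightarrow> best \<le> (\<Sum>i | i < n \<and> X i \<ge> \<theta>. w i)"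
    and K: "K \<ge> 0"
  shows "K * best \<le> (\<Sum>i<n. X i * w i)"
proof -
  have "K * best = (\<Sum>\<theta>\<in>{1..K}. best)" using K by simp
  also have "\<dots> \<le> (\<Sum>\<theta>\<in>{1..K}. \<Sum>i | i < n \<and> X i \<ge> \<theta>. w i)"
    by (rule sum_mono) (use best in simp)
  also have "\<dots> = (\<Sum>\<theta>\<in>{1..K}. \<Sum>i<n. if X i \<ge> \<theta> then w i else 0)"
  proof (rule sum.cong[OF refl])
    fix \<theta>
    have "{i. i < n \<and> X i \<ge> \<theta>} = {i \<in> {..<n}. X i \<ge> \<theta>}" by auto
    thus "(\<Sum>i | i < n \<and> X i \<ge> \<theta>. w i) = (\<Sum>i<n. if X i \<ge> \<theta> then w i else 0)"
      by (simp only: sum.inter_filter[OF finite_lessThan])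
  qed
  also have "\<dots> = (\<Sum>i<n. \<Sum>\<theta>\<in>{1..K}. if X i \<ge> \<theta> then w i else 0)"
    by (rule sum.swap)
  also have "\<dots> = (\<Sum>i<n. X i * w i)"
  proof (rule sum.cong[OF refl])
    fix i assume "i \<in> {..<n}"
    hence Xi: "0 \<le> X i" "X i \<le> K" using X by auto
    have "(\<Sum>\<theta>\<in>{1..K}. if X i \<ge> \<theta> then w i else 0) = (\<Sum>\<theta>\<in>{\<theta>\<in>{1..K}. \<theta> \<le> X i}. w i)"
      by (rule sum.inter_filter[symmetric]) simp
    also have "{\<theta>\<in>{1..K}. \<theta> \<le> X i} = {1..X i}" using Xi by auto
    finally show "(\<Sum>\<theta>\<in>{1..K}. if X i \<ge> \<theta> then w i else 0) = X i * w i" using Xi by simp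
  qed
  finally show ?thesis .
qed

text \<open>The squared distance of \<open>X\<close> to the vertex of the cube \<open>[0, K]\<^sup>n\<close> that belongs to \<open>I\<close>.\<close>
definition potential :: "nat \<Rightarrow> int \<Rightarrow> nat set \<Rightarrow> (nat \<Rightarrow> int) \<Rightarrow> int" where
  "potential n K I X = (\<Sum>i<n. (X i - (if i \<in> I then K else 0))\<^sup>2)"

lemma potential_nonneg: "potential n K I X \<ge> 0"
  by (simp add: potential_def sum_nonneg)

lemma potential_start: "K \<ge> 0 \<Longrightarrow> potential n K I (\<lambda>_. 0) \<le> int n * K\<^sup>2"
proof -
  have "potential n K I (\<lambda>_. 0) \<le> (\<Sum>i<n. K\<^sup>2)"
    unfolding potential_def by (rule sum_mono) simp
  thus ?thesis by simp
qed

text \<open>Projection onto an interval does not increase the distance to a point of the interval.\<close>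
lemma clamp_contraction:
  fixes x w K a :: int
  assumes "0 \<le> a" "a \<le> K"
  shows "(max 0 (min K (x - w)) - a)\<^sup>2 \<le> (x - w - a)\<^sup>2"
proof -
  have "\<bar>max 0 (min K (x - w)) - a\<bar> \<le> \<bar>x - w - a\<bar>" using assms by auto
  thus ?thesis by (rule abs_le_square_iff[THEN iffD1])
qed

text \<open>The usual estimate for a subgradient step of length one. The integers \<open>g < best\<close> differ by at
  least one, and over a cube of side \<open>K\<close> this amounts to \<open>K\<close>: the linear term gains \<open>2 * K\<close>, of which
  the square of the step takes at most \<open>n * b\<^sup>2 = K\<close>.\<close>
lemma potential_step:
  fixes X w :: "nat \<Rightarrow> int" and K b g best :: int
  assumes K: "K = int n * b\<^sup>2"
    and X: "\<And>i. i < n \<Longrightarrow> 0 \<le> X i \<and> X i \<le> K"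
    and w: "\<And>i. i < n \<Longrightarrow> \<bar>w i\<bar> \<le> b"
    and best: "\<And>\<theta>. 1 \<le> \<theta> \<Longrightarrow> \<theta> \<le> K \<Longrightarrow> best \<le> (\<Sum>i | i < n \<and> X i \<ge> \<theta>. w i)"
    and I: "I \<subseteq> {..<n}" "(\<Sum>i\<in>I. w i) \<le> g" and gap: "g < best"
  shows "potential n K I (\<lambda>i. max 0 (min K (X i - w i))) + K \<le> potential n K I X"
proof -
  have K0: "K \<ge> 0" unfolding K by simp
  let ?k = "\<lambda>i. if i \<in> I then K else 0"
  have "(\<Sum>i<n. w i * ?k i) = (\<Sum>i<n. if i \<in> I then K * w i else 0)"
    by (rule sum.cong) auto
  also have "\<dots> = (\<Sum>i\<in>{i \<in> {..<n}. i \<in> I}. K * w i)"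
    by (rule sum.inter_filter[symmetric]) simp
  also have "{i \<in> {..<n}. i \<in> I} = I" using I(1) by auto
  finally have wk: "(\<Sum>i<n. w i * ?k i) = K * (\<Sum>i\<in>I. w i)" by (simp add: sum_distrib_left)
  have "(\<Sum>i<n. (w i)\<^sup>2) \<le> (\<Sum>i<n. b\<^sup>2)"
    by (rule sum_mono) (use w in \<open>auto simp: abs_le_square_iff[symmetric] intro: order_trans[OF _ abs_ge_self]\<close>)
  hence w2: "(\<Sum>i<n. (w i)\<^sup>2) \<le> K" by (simp add: K)
  have "K * best \<le> (\<Sum>i<n. X i * w i)" by (rule layer_cake_bound[OF X best K0])
  moreover have "K * (\<Sum>i\<in>I. w i) + K \<le> K * best"
  proof -
    have "K * ((\<Sum>i\<in>I. w i) + 1) \<le> K * best" by (rule mult_left_mono) (use I(2) gap K0 in auto)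
    thus ?thesis by (simp add: algebra_simps)
  qed
  (* The scalar product of \<open>w\<close> with the difference of \<open>X\<close> and the vertex. *)
  ultimately have lin: "(\<Sum>i<n. w i * (X i - ?k i)) \<ge> K"
    using wk by (simp add: right_diff_distrib sum_subtractf mult.commute)
  have "potential n K I (\<lambda>i. max 0 (min K (X i - w i))) \<le> (\<Sum>i<n. (X i - w i - ?k i)\<^sup>2)"
    unfolding potential_def by (rule sum_mono) (rule clamp_contraction, use K0 in auto)
  also have "\<dots> = (\<Sum>i<n. (X i - ?k i)\<^sup>2 - 2 * (w i * (X i - ?k i)) + (w i)\<^sup>2)"
    by (rule sum.cong) (auto simp: power2_eq_square algebra_simps)
  also have "\<dots> = potential n K I X - 2 * (\<Sum>i<n. w i * (X i - ?k i)) + (\<Sum>i<n. (w i)\<^sup>2)"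
    by (simp add: potential_def sum.distrib sum_subtractf sum_distrib_left)
  finally show ?thesis using lin w2 by linarith
qed

section \<open>A loop language with clamped assignments\<close>

definition upd :: "mem \<Rightarrow> string \<Rightarrow> int \<Rightarrow> int \<Rightarrow> mem" where
  "upd s x a z = s(x := (s x)(a := z))"

lemma upd_same [simp]: "upd s x a z x b = (if b = a then z else s x b)"
  and upd_other [simp]: "y \<noteq> x \<Longrightarrow> upd s x a z y = s y"
  by (auto simp: upd_def)

text \<open>The language of the algorithm. \<open>For x y p\<close> counts the cell \<open>x\<close> from 0 up to the content of the
  cell \<open>y\<close>.\<close>
datatype prog =
    Nop
  | Asg string aexp aexp
  | Sq prog prog
  | If bexp prog prog
  | For string string prog

text \<open>A total semantics: an assignment whose value exceeds the content of \<open>''B''\<close> has no effect, and the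
  number of rounds of a loop is fixed on entry and at most the content of \<open>''L''\<close>. The values in
  the memory and the number of steps are thus bounded independently of what the program does.\<close>
primrec sem :: "prog \<Rightarrow> mem \<Rightarrow> mem" where
  "sem Nop s = s"
| "sem (Asg x a e) s = (if \<bar>aval s e\<bar> \<le> s ''B'' 0 then upd s x (aval s a) (aval s e) else s)"
| "sem (Sq p q) s = sem q (sem p s)"
| "sem (If b p q) s = (if bval s b then sem p s else sem q s)"
| "sem (For x y p) s =
     fold (\<lambda>k s. upd (sem p s) x 0 (int (Suc k))) [0..<nat (min (s y 0) (s ''L'' 0))] (upd s x 0 0)"

primrec compile :: "prog \<Rightarrow> com" where
  "compile Nop = Skip"
| "compile (Asg x a e) =
     Cond (Conj (Neg (Less (Read ''B'' (Lit 0)) e)) (Neg (Less (Read ''B'' (Lit 0)) (Sub (Lit 0) e))))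
       (Store x a e) Skip"
| "compile (Sq p q) = Seq (compile p) (compile q)"
| "compile (If b p q) = Cond b (compile p) (compile q)"
| "compile (For x y p) = Seq (Store x (Lit 0) (Lit 0))
     (Loop (Conj (Less (Read x (Lit 0)) (Read y (Lit 0))) (Less (Read x (Lit 0)) (Read ''L'' (Lit 0))))
       (Seq (compile p) (Store x (Lit 0) (Add (Read x (Lit 0)) (Lit 1)))))"

primrec writes :: "prog \<Rightarrow> string set" where
  "writes Nop = {}"
| "writes (Asg x a e) = {x}"
| "writes (Sq p q) = writes p \<union> writes q"
| "writes (If b p q) = writes p \<union> writes q"
| "writes (For x y p) = insert x (writes p)"

text \<open>The compiled loop reads its counter and its bound anew in every round, and reads both caps. That
  it runs as often as \<open>sem\<close> says requires that the body does not write these cells.\<close>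
primrec wf_prog :: "prog \<Rightarrow> bool" where
  "wf_prog Nop \<longleftrightarrow> True"
| "wf_prog (Asg x a e) \<longleftrightarrow> x \<noteq> ''B'' \<and> x \<noteq> ''L''"
| "wf_prog (Sq p q) \<longleftrightarrow> wf_prog p \<and> wf_prog q"
| "wf_prog (If b p q) \<longleftrightarrow> wf_prog p \<and> wf_prog q"
| "wf_prog (For x y p) \<longleftrightarrow> x \<noteq> ''B'' \<and> x \<noteq> ''L'' \<and> x \<noteq> y \<and> x \<notin> writes p \<and> y \<notin> writes p \<and> wf_prog p"

lemma wf_prog_writes: "wf_prog p \<Longrightarrow> ''B'' \<notin> writes p \<and> ''L'' \<notin> writes p"
  by (induction p) auto

lemma fold_frame:
  assumes "\<And>k s. f k s z = s z"
  shows "fold f ks s z = s z"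
  by (induction ks arbitrary: s) (auto simp: assms)

lemma sem_frame: "z \<notin> writes p \<Longrightarrow> sem p s z = s z"
proof (induction p arbitrary: s)
  case (For x y p)
  have "fold (\<lambda>k s. upd (sem p s) x 0 (int (Suc k))) ks t z = t z" for ks t
    by (rule fold_frame) (use For in auto)
  thus ?case using For.prems by (simp del: of_nat_Suc)
qed auto

text \<open>\<open>I k\<close> speaks about the memory in which the counter has just been set to \<open>k\<close>.\<close>
lemma sem_For_invariant:
  assumes N: "N = nat (min (s y 0) (s ''L'' 0))"
    and init: "I 0 (upd s x 0 0)"
    and step: "\<And>k t. k < N \<Longrightarrow> I k t \<Longrightarrow> t x 0 = int k \<Longrightarrow> I (Suc k) (upd (sem p t) x 0 (int (Suc k)))"
  shows "I N (sem (For x y p) s)"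
proof -
  let ?f = "\<lambda>k s. upd (sem p s) x 0 (int (Suc k))"
  have "k \<le> N \<Longrightarrow> I k (fold ?f [0..<k] (upd s x 0 0)) \<and> fold ?f [0..<k] (upd s x 0 0) x 0 = int k" for k
  proof (induction k)
    case (Suc k)
    thus ?case using step[of k "fold ?f [0..<k] (upd s x 0 0)"] by simp
  qed (use init in simp)
  from this[of N] show ?thesis by (simp add: N)
qed

declare sem.simps(5) [simp del]

text \<open>Only the arrays named in \<open>A\<close> may have changed.\<close>
definition frame :: "string set \<Rightarrow> mem \<Rightarrow> mem \<Rightarrow> bool" where
  "frame A s t \<longleftrightarrow> (\<forall>z. z \<notin> A \<longrightarrow> t z = s z)"

lemma frameD: "frame A s t \<Longrightarrow> z \<notin> A \<Longrightarrow> t z = s z"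
  by (simp add: frame_def)

lemma frame_refl [simp]: "frame A s s"
  by (simp add: frame_def)

lemma frame_trans: "frame A s t \<Longrightarrow> frame A t u \<Longrightarrow> frame A s u"
  by (simp add: frame_def)

lemma frame_mono: "frame A s t \<Longrightarrow> A \<subseteq> A' \<Longrightarrow> frame A' s t"
  by (auto simp: frame_def)

lemma frame_updI: "frame A s t \<Longrightarrow> z \<in> A \<Longrightarrow> frame A s (upd t z a y)"
  by (auto simp: frame_def upd_def)

lemma frame_sem: "frame (writes p) s (sem p s)"
  by (simp add: frame_def sem_frame)

text \<open>Loops with a single assignment that fill the cells \<open>g 0, g 1, ...\<close> of one array. A value may depend
  on the old content of the cells that are not yet filled, as in an update in place.\<close>
lemma sem_For_fill:
  assumes N: "N = nat (min (s y 0) (s ''L'' 0))"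
    and names: "x \<noteq> z" "x \<noteq> ''B''" "z \<noteq> ''B''"
    and inj: "inj_on g {..<N}"
    and step: "\<And>k t. k < N \<Longrightarrow> frame {x, z} s t \<Longrightarrow> t x 0 = int k \<Longrightarrow>
        (\<And>a. a \<notin> g ` {..<k} \<Longrightarrow> t z a = s z a) \<Longrightarrow>
        aval t a = g k \<and> aval t e = val k \<and> \<bar>val k\<bar> \<le> s ''B'' 0"
  shows "frame {x, z} s (sem (For x y (Asg z a e)) s) \<and>
    (\<forall>k<N. sem (For x y (Asg z a e)) s z (g k) = val k) \<and>
    (\<forall>a'. a' \<notin> g ` {..<N} \<longrightarrow> sem (For x y (Asg z a e)) s z a' = s z a')"
proof -
  let ?I = "\<lambda>k t. frame {x, z} s t \<and> (\<forall>l<k. t z (g l) = val l) \<and> (\<forall>a. a \<notin> g ` {..<k} \<longrightarrow> t z a = s z a)"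
  show "?I N (sem (For x y (Asg z a e)) s)"
  proof (rule sem_For_invariant[where I = ?I and s = s and y = y])
    show "N = nat (min (s y 0) (s ''L'' 0))" by (rule N)
    show "?I 0 (upd s x 0 0)" using names by (auto intro: frame_updI)
    fix k t assume k: "k < N" and I: "?I k t" and x: "t x 0 = int k"
    have B: "t ''B'' = s ''B''" using I names by (simp add: frame_def)
    have v: "aval t a = g k" "aval t e = val k" "\<bar>val k\<bar> \<le> s ''B'' 0"
      using step[of k t] k x I by blast+
    have t': "sem (Asg z a e) t = upd t z (g k) (val k)" using v B by simp
    have "g l \<noteq> g k" if "l < k" for l
      using inj_onD[OF inj, of l k] that k by auto
    thus "?I (Suc k) (upd (sem (Asg z a e) t) x 0 (int (Suc k)))"
      unfolding t' using I names by (auto intro!: frame_updI simp: less_Suc_eq lessThan_Suc)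
  qed
qed

section \<open>Bit sizes and the cost of single commands\<close>

lemma abs_less_iff_bit_size: "\<bar>z\<bar> < 2 ^ k \<longleftrightarrow> bit_size z \<le> Suc k"
proof -
  have "bitlen \<bar>z\<bar> \<le> int k \<longleftrightarrow> \<bar>z\<bar> < 2 ^ k"
    using bitlen_le_iff_power[of "\<bar>z\<bar>" "int k"] by simp
  thus ?thesis unfolding bit_size_def by linarith
qed

lemma bit_size_pos: "bit_size z \<ge> 1"
  by (simp add: bit_size_def)

lemma abs_less_bit_size: "\<bar>z\<bar> < 2 ^ (bit_size z - 1)"
  unfolding abs_less_iff_bit_size using bit_size_pos[of z] by simp

lemma bit_size_le_if_abs_le:
  assumes "\<bar>a\<bar> \<le> \<bar>b\<bar>"
  shows "bit_size a \<le> bit_size b"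
proof -
  have "\<bar>a\<bar> < 2 ^ (bit_size b - 1)" using assms abs_less_bit_size[of b] by linarith
  thus ?thesis unfolding abs_less_iff_bit_size using bit_size_pos[of b] by simp
qed

lemma bit_size_sum: "bit_size (a + b) \<le> bit_size a + bit_size b"
proof -
  obtain p q where p: "bit_size a = Suc p" and q: "bit_size b = Suc q"
    using bit_size_pos[of a] bit_size_pos[of b] by (metis One_nat_def Suc_le_D)
  have "\<bar>a\<bar> < 2 ^ p" "\<bar>b\<bar> < 2 ^ q" using p q by (simp_all add: abs_less_iff_bit_size)
  moreover have "(2::int) ^ p \<le> 2 ^ (p + q)" "(2::int) ^ q \<le> 2 ^ (p + q)" by simp_all
  ultimately have "\<bar>a + b\<bar> < 2 ^ (p + q + 1)" by (simp, linarith)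
  thus ?thesis unfolding abs_less_iff_bit_size p q by simp
qed

lemma bit_size_minus [simp]: "bit_size (- a) = bit_size a"
  by (simp add: bit_size_def)

lemma bit_size_diff: "bit_size (a - b) \<le> bit_size a + bit_size b"
  using bit_size_sum[of a "- b"] by simp

lemma bit_size_mult: "bit_size (a * b) \<le> bit_size a + bit_size b"
proof -
  obtain p q where p: "bit_size a = Suc p" and q: "bit_size b = Suc q"
    using bit_size_pos[of a] bit_size_pos[of b] by (metis One_nat_def Suc_le_D)
  have ab: "\<bar>a\<bar> < 2 ^ p" "\<bar>b\<bar> < 2 ^ q" using p q by (simp_all add: abs_less_iff_bit_size)
  have "\<bar>a * b\<bar> < 2 ^ p * 2 ^ q"
    unfolding abs_mult by (rule mult_strict_mono'[OF ab]) simp_all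
  hence "\<bar>a * b\<bar> < 2 ^ (p + q)" by (simp add: power_add)
  thus ?thesis unfolding abs_less_iff_bit_size p q by simp
qed

lemma abs_div_le: "\<bar>a div b\<bar> \<le> \<bar>a :: int\<bar>"
proof -
  have pos: "\<bar>a div b\<bar> \<le> \<bar>a\<bar>" if b: "b > 0" for a b :: int
  proof (cases "a \<ge> 0")
    case True
    have "a div b \<le> a div 1" using True b by (intro zdiv_mono2) auto
    thus ?thesis using True b by (simp add: pos_imp_zdiv_nonneg_iff)
  next
    case False
    have "a div 1 \<le> a div b" using False b by (intro zdiv_mono2_neg) auto
    moreover have "a div b < 0" using False b by (simp add: pos_imp_zdiv_neg_iff)
    ultimately show ?thesis using False by simp
  qed
  consider "b > 0" | "b = 0" | "b < 0" by linarith
  thus ?thesis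
  proof cases
    case 3
    have "\<bar>(- a) div (- b)\<bar> \<le> \<bar>- a\<bar>" using 3 by (intro pos) simp
    thus ?thesis by (simp add: div_minus_minus)
  qed (use pos in auto)
qed

lemma bit_size_div: "bit_size (a div b) \<le> bit_size a"
  by (rule bit_size_le_if_abs_le[OF abs_div_le])

definition mem_bounded :: "nat \<Rightarrow> mem \<Rightarrow> bool" where
  "mem_bounded \<beta> s \<longleftrightarrow> (\<forall>x a. \<bar>s x a\<bar> < 2 ^ \<beta>)"

lemma bounded_bit_size: "mem_bounded \<beta> s \<Longrightarrow> bit_size (s x a) \<le> \<beta> + 1"
  using abs_less_iff_bit_size[of "s x a" \<beta>] by (simp add: mem_bounded_def)

lemma bounded_upd: "mem_bounded \<beta> s \<Longrightarrow> \<bar>z\<bar> < 2 ^ \<beta> \<Longrightarrow> mem_bounded \<beta> (upd s x a z)"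
  by (auto simp: mem_bounded_def upd_def)

text \<open>The shape of \<open>e\<close> is fixed, and each operation adds at most the sizes of its arguments. So cost
  and size of the value are linear in the bit size of the memory.\<close>
lemma acost_bound: "\<exists>C. \<forall>s \<beta>. mem_bounded \<beta> s \<longrightarrow> acost s e + bit_size (aval s e) \<le> C * (\<beta> + 1)"
proof (induction e)
  case (Lit z)
  show ?case by (rule exI[of _ "2 * bit_size z"]) (simp add: algebra_simps)
next
  case (Read x a)
  then obtain C where C: "\<And>s \<beta>. mem_bounded \<beta> s \<Longrightarrow> acost s a + bit_size (aval s a) \<le> C * (\<beta> + 1)" by blast
  have "acost s (Read x a) + bit_size (aval s (Read x a)) \<le> (C + 2) * (\<beta> + 1)" if "mem_bounded \<beta> s" for s \<beta>
    using C[OF that] bounded_bit_size[OF that, of x "aval s a"] by (simp add: algebra_simps)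
  thus ?case by blast
next
  case (Add a b)
  then obtain C C' where C: "\<And>s \<beta>. mem_bounded \<beta> s \<Longrightarrow> acost s a + bit_size (aval s a) \<le> C * (\<beta> + 1)"
      "\<And>s \<beta>. mem_bounded \<beta> s \<Longrightarrow> acost s b + bit_size (aval s b) \<le> C' * (\<beta> + 1)" by blast
  have "acost s (Add a b) + bit_size (aval s (Add a b)) \<le> (2 * C + 2 * C') * (\<beta> + 1)"
    if "mem_bounded \<beta> s" for s \<beta>
    using C(1)[OF that] C(2)[OF that] bit_size_sum[of "aval s a" "aval s b"] by (simp add: algebra_simps)
  thus ?case by blast
next
  case (Sub a b)
  then obtain C C' where C: "\<And>s \<beta>. mem_bounded \<beta> s \<Longrightarrow> acost s a + bit_size (aval s a) \<le> C * (\<beta> + 1)"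
      "\<And>s \<beta>. mem_bounded \<beta> s \<Longrightarrow> acost s b + bit_size (aval s b) \<le> C' * (\<beta> + 1)" by blast
  have "acost s (Sub a b) + bit_size (aval s (Sub a b)) \<le> (2 * C + 2 * C') * (\<beta> + 1)"
    if "mem_bounded \<beta> s" for s \<beta>
    using C(1)[OF that] C(2)[OF that] bit_size_diff[of "aval s a" "aval s b"] by (simp add: algebra_simps)
  thus ?case by blast
next
  case (Mul a b)
  then obtain C C' where C: "\<And>s \<beta>. mem_bounded \<beta> s \<Longrightarrow> acost s a + bit_size (aval s a) \<le> C * (\<beta> + 1)"
      "\<And>s \<beta>. mem_bounded \<beta> s \<Longrightarrow> acost s b + bit_size (aval s b) \<le> C' * (\<beta> + 1)" by blast
  have "acost s (Mul a b) + bit_size (aval s (Mul a b)) \<le> (2 * C + 2 * C') * (\<beta> + 1)"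
    if "mem_bounded \<beta> s" for s \<beta>
    using C(1)[OF that] C(2)[OF that] bit_size_mult[of "aval s a" "aval s b"] by (simp add: algebra_simps)
  thus ?case by blast
next
  case (Div a b)
  then obtain C C' where C: "\<And>s \<beta>. mem_bounded \<beta> s \<Longrightarrow> acost s a + bit_size (aval s a) \<le> C * (\<beta> + 1)"
      "\<And>s \<beta>. mem_bounded \<beta> s \<Longrightarrow> acost s b + bit_size (aval s b) \<le> C' * (\<beta> + 1)" by blast
  have "acost s (Div a b) + bit_size (aval s (Div a b)) \<le> (2 * C + 2 * C') * (\<beta> + 1)"
    if "mem_bounded \<beta> s" for s \<beta>
    using C(1)[OF that] C(2)[OF that] bit_size_div[of "aval s a" "aval s b"] by (simp add: algebra_simps)
  thus ?case by blast
qed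

lemma bcost_bound: "\<exists>C. \<forall>s \<beta>. mem_bounded \<beta> s \<longrightarrow> bcost s b \<le> C * (\<beta> + 1)"
proof (induction b)
  case (Less a b)
  obtain C C' where C: "\<And>s \<beta>. mem_bounded \<beta> s \<Longrightarrow> acost s a + bit_size (aval s a) \<le> C * (\<beta> + 1)"
      "\<And>s \<beta>. mem_bounded \<beta> s \<Longrightarrow> acost s b + bit_size (aval s b) \<le> C' * (\<beta> + 1)"
    using acost_bound by metis
  have "bcost s (Less a b) \<le> (C + C') * (\<beta> + 1)" if "mem_bounded \<beta> s" for s \<beta>
    using C(1)[OF that] C(2)[OF that] by (simp add: algebra_simps)
  thus ?case by blast
next
  case (Equal a b)
  obtain C C' where C: "\<And>s \<beta>. mem_bounded \<beta> s \<Longrightarrow> acost s a + bit_size (aval s a) \<le> C * (\<beta> + 1)"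
      "\<And>s \<beta>. mem_bounded \<beta> s \<Longrightarrow> acost s b + bit_size (aval s b) \<le> C' * (\<beta> + 1)"
    using acost_bound by metis
  have "bcost s (Equal a b) \<le> (C + C') * (\<beta> + 1)" if "mem_bounded \<beta> s" for s \<beta>
    using C(1)[OF that] C(2)[OF that] by (simp add: algebra_simps)
  thus ?case by blast
next
  case (Neg b)
  then obtain C where C: "\<And>s \<beta>. mem_bounded \<beta> s \<Longrightarrow> bcost s b \<le> C * (\<beta> + 1)" by blast
  have "bcost s (Neg b) \<le> (C + 1) * (\<beta> + 1)" if "mem_bounded \<beta> s" for s \<beta>
    using C[OF that] by (simp add: algebra_simps)
  thus ?case by blast
next
  case (Conj a b)
  then obtain C C' where C: "\<And>s \<beta>. mem_bounded \<beta> s \<Longrightarrow> bcost s a \<le> C * (\<beta> + 1)"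
      "\<And>s \<beta>. mem_bounded \<beta> s \<Longrightarrow> bcost s b \<le> C' * (\<beta> + 1)" by blast
  have "bcost s (Conj a b) \<le> (C + C' + 1) * (\<beta> + 1)" if "mem_bounded \<beta> s" for s \<beta>
    using C(1)[OF that] C(2)[OF that] by (simp add: algebra_simps)
  thus ?case by blast
qed

lemma exec_Store_bound:
  "\<exists>C. \<forall>s \<beta>. mem_bounded \<beta> s \<longrightarrow> (\<exists>t. exec (Store x a e) s t (upd s x (aval s a) (aval s e)) \<and> t \<le> C * (\<beta> + 1))"
proof -
  obtain C C' where C: "\<And>s \<beta>. mem_bounded \<beta> s \<Longrightarrow> acost s a + bit_size (aval s a) \<le> C * (\<beta> + 1)"
      "\<And>s \<beta>. mem_bounded \<beta> s \<Longrightarrow> acost s e + bit_size (aval s e) \<le> C' * (\<beta> + 1)"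
    using acost_bound by metis
  have "\<exists>t. exec (Store x a e) s t (upd s x (aval s a) (aval s e)) \<and> t \<le> (C + C' + 1) * (\<beta> + 1)"
    if b: "mem_bounded \<beta> s" for s \<beta>
    unfolding upd_def
    by (rule exI, rule conjI, rule exec.Store) (use C(1)[OF b] C(2)[OF b] in \<open>simp add: algebra_simps\<close>)
  thus ?thesis by blast
qed

lemma exec_Loop_count:
  assumes step: "\<And>k s. k < N \<Longrightarrow> I k s \<Longrightarrow>
      bval s b \<and> bcost s b \<le> c \<and> (\<exists>t s'. exec p s t s' \<and> t \<le> c \<and> I (Suc k) s')"
    and stop: "\<And>s. I N s \<Longrightarrow> \<not> bval s b \<and> bcost s b \<le> c"
    and init: "I 0 s"
  shows "\<exists>t s'. exec (Loop b p) s t s' \<and> t \<le> (N + 1) * (2 * c + 1) \<and> I N s'"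
proof -
  have "k \<le> N \<Longrightarrow> I (N - k) s \<Longrightarrow>
    \<exists>t s'. exec (Loop b p) s t s' \<and> t \<le> (k + 1) * (2 * c + 1) \<and> I N s'" for k s
  proof (induction k arbitrary: s)
    case 0
    hence "\<not> bval s b" "bcost s b \<le> c" using stop[of s] by auto
    thus ?case using 0 exec.LoopFalse[of s b p] by (intro exI[of _ "1 + bcost s b"] exI[of _ s]) auto
  next
    case (Suc k)
    have I: "N - Suc k < N" "Suc (N - Suc k) = N - k" using Suc.prems(1) by auto
    obtain t s' where 1: "bval s b" "bcost s b \<le> c" "exec p s t s'" "t \<le> c" "I (N - k) s'"
      using step[OF I(1) Suc.prems(2)] unfolding I(2) by blast
    obtain t' s'' where 2: "exec (Loop b p) s' t' s''" "t' \<le> (k + 1) * (2 * c + 1)" "I N s''"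
      using Suc.IH[OF _ 1(5)] Suc.prems(1) by auto
    have "exec (Loop b p) s (1 + bcost s b + t + t') s''"
      by (rule exec.LoopTrue[OF 1(1,3) 2(1)])
    moreover have "1 + bcost s b + t + t' \<le> (Suc k + 1) * (2 * c + 1)"
      using 1(2,4) 2(2) by simp
    ultimately show ?case using 2(3) by blast
  qed
  from this[of N s] init show ?thesis by simp
qed

section \<open>Compiled programs run in polynomial time\<close>

text \<open>Besides the time bound this says that the memory stays within \<open>\<beta>\<close> bits, which makes it
  composable: cells that hold at most \<open>\<beta>\<close> bits are overwritten by values below \<open>''B''\<close> or counters
  below \<open>''L''\<close>, and these two are themselves among the cells.\<close>
definition poly_cost :: "prog \<Rightarrow> nat \<Rightarrow> nat \<Rightarrow> bool" where
  "poly_cost p C e \<longleftrightarrow> (\<forall>s \<beta> M. mem_bounded \<beta> s \<longrightarrow> s ''L'' 0 \<le> int M \<longrightarrow>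
     mem_bounded \<beta> (sem p s) \<and>
     (\<exists>t. exec (compile p) s t (sem p s) \<and> t \<le> C * (M + 1) ^ e * (\<beta> + 1)))"

lemma poly_cost_mono:
  assumes "poly_cost p C e" "C \<le> C'" "e \<le> e'"
  shows "poly_cost p C' e'"
proof -
  have "C * (M + 1) ^ e * (\<beta> + 1) \<le> C' * (M + 1) ^ e' * (\<beta> + 1)" for M \<beta>
    using assms(2,3) by (intro mult_mono power_increasing) auto
  thus ?thesis using assms(1) unfolding poly_cost_def by (meson order_trans)
qed

lemma poly_costD:
  assumes "poly_cost p C e" "mem_bounded \<beta> s" "s ''L'' 0 \<le> int M"
  obtains t where "mem_bounded \<beta> (sem p s)" "exec (compile p) s t (sem p s)" "t \<le> C * (M + 1) ^ e * (\<beta> + 1)"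
  using assms unfolding poly_cost_def by blast

text \<open>The degree \<open>e\<close> is the nesting depth of loops. Sequences and branches add the constants, and a
  loop multiplies by the cap \<open>M\<close> on the number of its rounds.\<close>
lemma exec_compile: "wf_prog p \<Longrightarrow> \<exists>C e. poly_cost p C e"
proof (induction p)
  case Nop
  have "poly_cost Nop 1 0"
    unfolding poly_cost_def using exec.Skip by fastforce
  thus ?case by blast
next
  case (Asg x a e)
  let ?b = "Conj (Neg (Less (Read ''B'' (Lit 0)) e)) (Neg (Less (Read ''B'' (Lit 0)) (Sub (Lit 0) e)))"
  obtain C where C: "\<And>s \<beta>. mem_bounded \<beta> s \<Longrightarrow> bcost s ?b \<le> C * (\<beta> + 1)"
    using bcost_bound by metis
  obtain C' where C': "\<And>s \<beta>. mem_bounded \<beta> s \<Longrightarrow>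
      \<exists>t. exec (Store x a e) s t (upd s x (aval s a) (aval s e)) \<and> t \<le> C' * (\<beta> + 1)"
    using exec_Store_bound by metis
  have b: "bval s ?b \<longleftrightarrow> \<bar>aval s e\<bar> \<le> s ''B'' 0" for s by auto
  have "poly_cost (Asg x a e) (C + C' + 2) 0"
    unfolding poly_cost_def
  proof (intro allI impI)
    fix s \<beta> M assume s: "mem_bounded \<beta> s" "s ''L'' 0 \<le> int M"
    show "mem_bounded \<beta> (sem (Asg x a e) s) \<and> (\<exists>t. exec (compile (Asg x a e)) s t (sem (Asg x a e) s) \<and>
        t \<le> (C + C' + 2) * (M + 1) ^ 0 * (\<beta> + 1))"
    proof (cases "\<bar>aval s e\<bar> \<le> s ''B'' 0")
      case True
      have "s ''B'' 0 < 2 ^ \<beta>" using s(1) unfolding mem_bounded_def by (metis abs_ge_self order_le_less_trans)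
      hence "mem_bounded \<beta> (upd s x (aval s a) (aval s e))" using bounded_upd[OF s(1)] True by simp
      moreover obtain t where t: "exec (Store x a e) s t (upd s x (aval s a) (aval s e))" "t \<le> C' * (\<beta> + 1)"
        using C'[OF s(1)] by blast
      have "exec (compile (Asg x a e)) s (1 + bcost s ?b + t) (upd s x (aval s a) (aval s e))"
        unfolding compile.simps using exec.CondTrue[OF _ t(1)] b True by blast
      moreover have "1 + bcost s ?b + t \<le> (C + C' + 2) * (M + 1) ^ 0 * (\<beta> + 1)"
        using C[OF s(1)] t(2) by (simp add: algebra_simps)
      ultimately show ?thesis using True by auto
    next
      case False
      have "exec (compile (Asg x a e)) s (1 + bcost s ?b + 1) s"
        unfolding compile.simps using exec.CondFalse[OF _ exec.Skip] b False by blast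
      moreover have "1 + bcost s ?b + 1 \<le> (C + C' + 2) * (M + 1) ^ 0 * (\<beta> + 1)"
        using C[OF s(1)] by (simp add: algebra_simps)
      ultimately show ?thesis using False s(1) by auto
    qed
  qed
  thus ?case by blast
next
  case (Sq p q)
  then obtain C e C' e' where "poly_cost p C e" "poly_cost q C' e'" by auto
  hence p: "poly_cost p C (max e e')" and q: "poly_cost q C' (max e e')"
    by (auto intro: poly_cost_mono)
  have L: "sem p s ''L'' 0 = s ''L'' 0" for s
    using sem_frame wf_prog_writes Sq.prems by auto
  have "poly_cost (Sq p q) (C + C') (max e e')"
    unfolding poly_cost_def
  proof (intro allI impI)
    fix s \<beta> M assume s: "mem_bounded \<beta> s" "s ''L'' 0 \<le> int M"
    obtain t where t: "mem_bounded \<beta> (sem p s)" "exec (compile p) s t (sem p s)"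
        "t \<le> C * (M + 1) ^ max e e' * (\<beta> + 1)"
      by (rule poly_costD[OF p s])
    obtain t' where t': "mem_bounded \<beta> (sem q (sem p s))" "exec (compile q) (sem p s) t' (sem q (sem p s))"
        "t' \<le> C' * (M + 1) ^ max e e' * (\<beta> + 1)"
      by (rule poly_costD[OF q t(1)]) (use L s(2) in auto)
    have "exec (compile (Sq p q)) s (t + t') (sem (Sq p q) s)"
      using exec.Seq[OF t(2) t'(2)] by simp
    moreover have "t + t' \<le> (C + C') * (M + 1) ^ max e e' * (\<beta> + 1)"
      using t(3) t'(3) by (simp add: algebra_simps)
    ultimately show "mem_bounded \<beta> (sem (Sq p q) s) \<and> (\<exists>t. exec (compile (Sq p q)) s t (sem (Sq p q) s) \<and>
        t \<le> (C + C') * (M + 1) ^ max e e' * (\<beta> + 1))"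
      using t'(1) by auto
  qed
  thus ?case by blast
next
  case (If b p q)
  then obtain C e C' e' where "poly_cost p C e" "poly_cost q C' e'" by auto
  hence p: "poly_cost p (C + C') (max e e')" and q: "poly_cost q (C + C') (max e e')"
    by (auto intro: poly_cost_mono)
  obtain C0 where C0: "\<And>s \<beta>. mem_bounded \<beta> s \<Longrightarrow> bcost s b \<le> C0 * (\<beta> + 1)"
    using bcost_bound by metis
  have "poly_cost (If b p q) (C + C' + C0 + 1) (max e e')"
    unfolding poly_cost_def
  proof (intro allI impI)
    fix s \<beta> M assume s: "mem_bounded \<beta> s" "s ''L'' 0 \<le> int M"
    let ?r = "if bval s b then p else q"
    have "poly_cost ?r (C + C') (max e e')" using p q by simp
    from poly_costD[OF this s] obtain t where t: "mem_bounded \<beta> (sem ?r s)" "exec (compile ?r) s t (sem ?r s)"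
        "t \<le> (C + C') * (M + 1) ^ max e e' * (\<beta> + 1)" by blast
    have "exec (compile (If b p q)) s (1 + bcost s b + t) (sem (If b p q) s)"
      using t(2) exec.CondTrue[of s b "compile p" t _ "compile q"]
        exec.CondFalse[of s b "compile q" t _ "compile p"] by auto
    moreover have "1 + bcost s b + t \<le> (C + C' + C0 + 1) * (M + 1) ^ max e e' * (\<beta> + 1)"
    proof -
      have "(C0 + 1) * 1 * (\<beta> + 1) \<le> (C0 + 1) * (M + 1) ^ max e e' * (\<beta> + 1)"
        by (intro mult_le_mono order_refl) simp
      hence "(C0 + 1) * (\<beta> + 1) \<le> (C0 + 1) * (M + 1) ^ max e e' * (\<beta> + 1)"
        by (simp only: mult_1_right)
      moreover have "1 + bcost s b \<le> (C0 + 1) * (\<beta> + 1)" using C0[OF s(1)] by (simp add: algebra_simps)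
      moreover have "(C + C' + C0 + 1) * (M + 1) ^ max e e' * (\<beta> + 1)
          = (C + C') * (M + 1) ^ max e e' * (\<beta> + 1) + (C0 + 1) * (M + 1) ^ max e e' * (\<beta> + 1)"
        by (simp only: add_mult_distrib)
      ultimately show ?thesis using t(3) by linarith
    qed
    ultimately show "mem_bounded \<beta> (sem (If b p q) s) \<and> (\<exists>t. exec (compile (If b p q)) s t (sem (If b p q) s) \<and>
        t \<le> (C + C' + C0 + 1) * (M + 1) ^ max e e' * (\<beta> + 1))"
      using t(1) by (auto split: if_splits)
  qed
  thus ?case by blast
next
  case (For x y p)
  hence wf: "x \<noteq> ''B''" "x \<noteq> ''L''" "x \<noteq> y" "x \<notin> writes p" "y \<notin> writes p" "wf_prog p" by auto
  obtain C e where p: "poly_cost p C e" using For.IH wf(6) by blast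
  let ?b = "Conj (Less (Read x (Lit 0)) (Read y (Lit 0))) (Less (Read x (Lit 0)) (Read ''L'' (Lit 0)))"
  let ?inc = "Store x (Lit 0) (Add (Read x (Lit 0)) (Lit 1))"
  obtain C0 where C0: "\<And>s \<beta>. mem_bounded \<beta> s \<Longrightarrow> bcost s ?b \<le> C0 * (\<beta> + 1)"
    using bcost_bound by metis
  obtain C1 where C1: "\<And>s \<beta>. mem_bounded \<beta> s \<Longrightarrow>
      \<exists>t. exec ?inc s t (upd s x (aval s (Lit 0)) (aval s (Add (Read x (Lit 0)) (Lit 1)))) \<and> t \<le> C1 * (\<beta> + 1)"
    using exec_Store_bound by metis
  obtain C2 where C2: "\<And>s \<beta>. mem_bounded \<beta> s \<Longrightarrow>
      \<exists>t. exec (Store x (Lit 0) (Lit 0)) s t (upd s x (aval s (Lit 0)) (aval s (Lit 0))) \<and> t \<le> C2 * (\<beta> + 1)"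
    using exec_Store_bound by metis
  \<comment> \<open>Body, test and increment together cost at most \<open>c\<close> in each round.\<close>
  let ?K = "C + C0 + C1"
  have "poly_cost (For x y p) (C2 + 2 * ?K + 1) (Suc e)"
    unfolding poly_cost_def
  proof (intro allI impI)
    fix s \<beta> M assume s: "mem_bounded \<beta> s" "s ''L'' 0 \<le> int M"
    let ?f = "\<lambda>k s. upd (sem p s) x 0 (int (Suc k))"
    define s0 where "s0 = upd s x 0 0"
    define N where "N = nat (min (s y 0) (s ''L'' 0))"
    define I where "I k t \<longleftrightarrow> t = fold ?f [0..<k] s0 \<and> mem_bounded \<beta> t \<and> t x 0 = int k
        \<and> t y = s y \<and> t ''L'' = s ''L''" for k t
    define c where "c = ?K * (M + 1) ^ e * (\<beta> + 1)"
    have pow: "1 \<le> (M + 1) ^ e" by simp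
    have small: "a * (\<beta> + 1) \<le> a * (M + 1) ^ e * (\<beta> + 1)" for a
    proof -
      have "a * 1 * (\<beta> + 1) \<le> a * (M + 1) ^ e * (\<beta> + 1)"
        by (intro mult_le_mono order_refl) simp
      thus ?thesis by (simp only: mult_1_right)
    qed
    have s0: "mem_bounded \<beta> s0" unfolding s0_def by (rule bounded_upd[OF s(1)]) simp
    have init: "I 0 s0" using wf s0 by (simp add: I_def s0_def)
    have bv: "bval t ?b \<longleftrightarrow> k < N" if "I k t" for k t
      using that unfolding I_def N_def by (auto simp: nat_less_iff zless_nat_conj)
    have bc: "bcost t ?b \<le> c" if "I k t" for k t
    proof -
      have "bcost t ?b \<le> C0 * (\<beta> + 1)" using that C0 unfolding I_def by blast
      also have "\<dots> \<le> C0 * (M + 1) ^ e * (\<beta> + 1)" by (rule small)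
      also have "\<dots> \<le> c" unfolding c_def by (intro mult_le_mono order_refl) simp
      finally show ?thesis .
    qed
    have body: "\<exists>u t'. exec (Seq (compile p) ?inc) t u t' \<and> u \<le> c \<and> I (Suc k) t'"
      if k: "k < N" and I: "I k t" for k t
    proof -
      have t: "mem_bounded \<beta> t" "t ''L'' 0 \<le> int M" using I s(2) unfolding I_def by auto
      obtain u where u: "mem_bounded \<beta> (sem p t)" "exec (compile p) t u (sem p t)"
          "u \<le> C * (M + 1) ^ e * (\<beta> + 1)"
        by (rule poly_costD[OF p t])
      have "t x 0 = int k" using I unfolding I_def by blast
      hence x: "sem p t x 0 = int k" by (simp only: sem_frame[OF wf(4)])
      obtain u' where u': "exec ?inc (sem p t) u' (upd (sem p t) x 0 (int (Suc k)))" "u' \<le> C1 * (\<beta> + 1)"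
        using C1[OF u(1)] x by (auto simp: add.commute)
      \<comment> \<open>The counter stays below \<open>''L''\<close>, itself a cell of at most \<open>\<beta>\<close> bits.\<close>
      have "int (Suc k) \<le> s ''L'' 0" using k unfolding N_def by linarith
      also have "s ''L'' 0 < 2 ^ \<beta>" using s(1) unfolding mem_bounded_def by (metis abs_ge_self order_le_less_trans)
      finally have bnd: "mem_bounded \<beta> (upd (sem p t) x 0 (int (Suc k)))"
        by (intro bounded_upd[OF u(1)]) simp
      have "t = fold ?f [0..<k] s0" using I unfolding I_def by blast
      hence fold: "upd (sem p t) x 0 (int (Suc k)) = fold ?f [0..<Suc k] s0" by simp
      have "t y = s y" "t ''L'' = s ''L''" using I unfolding I_def by blast+
      hence keep: "sem p t y = s y" "sem p t ''L'' = s ''L''"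
        using sem_frame[OF wf(5), of t] sem_frame[of "''L''" p t] wf_prog_writes[OF wf(6)] by argo+
      have "I (Suc k) (upd (sem p t) x 0 (int (Suc k)))"
        unfolding I_def
      proof (intro conjI)
        show "upd (sem p t) x 0 (int (Suc k)) y = s y"
          "upd (sem p t) x 0 (int (Suc k)) ''L'' = s ''L''"
          using keep wf(2,3) by (auto simp del: of_nat_Suc)
      qed (use bnd fold in simp_all)
      moreover have "exec (Seq (compile p) ?inc) t (u + u') (upd (sem p t) x 0 (int (Suc k)))"
        by (rule exec.Seq[OF u(2) u'(1)])
      moreover have "u + u' \<le> c"
      proof -
        have "u' \<le> C1 * (M + 1) ^ e * (\<beta> + 1)" using u'(2) small[of C1] by linarith
        thus ?thesis using u(3) by (simp add: c_def add_mult_distrib)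
      qed
      ultimately show ?thesis by blast
    qed
    obtain u t where ut: "exec (Loop ?b (Seq (compile p) ?inc)) s0 u t" "u \<le> (N + 1) * (2 * c + 1)" "I N t"
      using exec_Loop_count[of N I ?b c "Seq (compile p) ?inc" s0] bv bc body init by blast
    have sem: "sem (For x y p) s = t" using ut(3) by (simp add: I_def N_def s0_def sem.simps(5))
    obtain w where w: "exec (Store x (Lit 0) (Lit 0)) s w s0" "w \<le> C2 * (\<beta> + 1)"
      using C2[OF s(1)] by (auto simp: s0_def)
    have "exec (compile (For x y p)) s (w + u) t"
      using exec.Seq[OF w(1) ut(1)] by simp
    moreover have "w + u \<le> (C2 + 2 * ?K + 1) * (M + 1) ^ Suc e * (\<beta> + 1)"
    proof -
      have "N \<le> M" using s(2) unfolding N_def by linarith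
      hence "u \<le> (M + 1) * (2 * c + 1)"
        using ut(2) by (meson add_le_mono1 mult_le_mono1 order_trans)
      also have "\<dots> = 2 * ?K * ((M + 1) ^ Suc e * (\<beta> + 1)) + (M + 1)"
        by (simp add: c_def algebra_simps)
      finally have "u \<le> 2 * ?K * ((M + 1) ^ Suc e * (\<beta> + 1)) + (M + 1)" .
      moreover have "M + 1 \<le> (M + 1) ^ Suc e * (\<beta> + 1)"
      proof -
        have "1 * 1 \<le> (M + 1) ^ e * (\<beta> + 1)" by (rule mult_le_mono) simp_all
        hence "(M + 1) * 1 \<le> (M + 1) * ((M + 1) ^ e * (\<beta> + 1))" by (intro mult_le_mono2) simp
        thus ?thesis by (simp only: power_Suc mult.assoc mult_1_right)
      qed
      moreover have "w \<le> C2 * ((M + 1) ^ Suc e * (\<beta> + 1))"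
      proof -
        have "1 * (\<beta> + 1) \<le> (M + 1) ^ Suc e * (\<beta> + 1)"
          by (intro mult_le_mono order_refl one_le_power) simp
        hence "C2 * (\<beta> + 1) \<le> C2 * ((M + 1) ^ Suc e * (\<beta> + 1))"
          by (intro mult_le_mono2) (simp only: mult_1_left)
        thus ?thesis using w(2) by linarith
      qed
      moreover have "(C2 + 2 * ?K + 1) * (M + 1) ^ Suc e * (\<beta> + 1)
          = C2 * ((M + 1) ^ Suc e * (\<beta> + 1)) + 2 * ?K * ((M + 1) ^ Suc e * (\<beta> + 1))
            + (M + 1) ^ Suc e * (\<beta> + 1)"
        by (simp only: add_mult_distrib mult.assoc mult_1)
      ultimately show ?thesis by linarith
    qed
    moreover have "mem_bounded \<beta> t" using ut(3) unfolding I_def by blast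
    ultimately show "mem_bounded \<beta> (sem (For x y p) s) \<and> (\<exists>t. exec (compile (For x y p)) s t (sem (For x y p) s) \<and>
        t \<le> (C2 + 2 * ?K + 1) * (M + 1) ^ Suc e * (\<beta> + 1))"
      unfolding sem by blast
  qed
  thus ?case by blast
qed

section \<open>Inserting a vector into the elimination state\<close>

abbreviation V :: "string \<Rightarrow> aexp" where "V x \<equiv> Read x (Lit 0)"
abbreviation SetVar :: "string \<Rightarrow> aexp \<Rightarrow> prog" where "SetVar x e \<equiv> Asg x (Lit 0) e"

text \<open>The cells of the program. Constant after the setup: \<open>''n''\<close>, \<open>''m''\<close>, \<open>''D''\<close>, \<open>''W''\<close>, \<open>''K''\<close>,
  \<open>''k'' = K + 1\<close>, \<open>''T'' = n * K + 1\<close> and for each \<open>j\<close> the dimension \<open>''d''\<close>, the block offset \<open>''o''\<close> and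
  the position \<open>''b''\<close> just before the data points in the input. The elimination state: \<open>''r''\<close> accepted
  rows, stored one after the other in \<open>''w''\<close>, with pivot columns \<open>''c''\<close> and leading minors \<open>''p''\<close>;
  \<open>''v''\<close> is the row under work and \<open>''f''\<close> its pivot column. The descent: the point \<open>''X''\<close>, the
  subgradient \<open>''u''\<close>, the size \<open>''y''\<close> of the current level set, the best set \<open>''S''\<close> so far and its
  value \<open>''A''\<close>.

  Numerator and denominator of an entry occupy neighbouring cells of the input.\<close>
definition numerator_cell :: aexp where
  "numerator_cell = Add (Read ''b'' (V ''j''))
     (Add (Mul (Lit 2) (Add (Mul (V ''i'') (Read ''d'' (V ''j''))) (V ''x''))) (Lit 1))"

definition load_row :: prog where
  "load_row =
     Sq (For ''x'' ''D'' (Asg ''v'' (V ''x'') (Lit 0)))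
    (Sq (SetVar ''e'' (Read ''d'' (V ''j'')))
        (For ''x'' ''e'' (Asg ''v'' (Add (Read ''o'' (V ''j'')) (V ''x''))
           (Div (Mul (Read ''input'' numerator_cell) (V ''W''))
                (Read ''input'' (Add numerator_cell (Lit 1)))))))"

text \<open>One elimination round for each accepted row, as in \<open>minor_row_step\<close>.\<close>
definition reduce_row :: prog where
  "reduce_row = For ''h'' ''r''
     (Sq (SetVar ''q'' (Read ''v'' (Read ''c'' (V ''h''))))
         (For ''x'' ''D'' (Asg ''v'' (V ''x'')
            (Div (Sub (Mul (Read ''p'' (Add (V ''h'') (Lit 1))) (Read ''v'' (V ''x'')))
                      (Mul (V ''q'') (Read ''w'' (Add (Mul (V ''h'') (V ''D'')) (V ''x'')))))
                 (Read ''p'' (V ''h''))))))"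

text \<open>The pivot column is the last nonzero one, and \<open>-1\<close> if there is none.\<close>
definition find_pivot :: prog where
  "find_pivot = Sq (SetVar ''f'' (Lit (- 1)))
     (For ''x'' ''D'' (If (Equal (Read ''v'' (V ''x'')) (Lit 0)) Nop (SetVar ''f'' (V ''x''))))"

definition push_row :: prog where
  "push_row = If (Less (V ''f'') (Lit 0)) Nop
     (Sq (For ''x'' ''D'' (Asg ''w'' (Add (Mul (V ''r'') (V ''D'')) (V ''x'')) (Read ''v'' (V ''x''))))
     (Sq (Asg ''c'' (V ''r'') (V ''f''))
     (Sq (Asg ''p'' (Add (V ''r'') (Lit 1)) (Read ''v'' (V ''f'')))
         (SetVar ''r'' (Add (V ''r'') (Lit 1))))))"

definition insert_row :: prog where
  "insert_row = Sq load_row (Sq reduce_row (Sq find_pivot push_row))"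

definition statics :: "string set" where
  "statics = {''input'', ''B'', ''L'', ''W'', ''n'', ''m'', ''D'', ''d'', ''o'', ''b'', ''K'', ''k'', ''T''}"

text \<open>The memory \<open>\<sigma>\<close> after the setup. The inequalities state that the caps \<open>''B''\<close> and \<open>''L''\<close> are large enough
  for all values and all numbers of rounds that occur; \<open>A\<close> bounds the entries of the vectors.\<close>
locale machine = srsr_problem +
  fixes \<sigma> :: mem and A :: int
  assumes \<sigma>_scalars: "\<sigma> ''n'' 0 = int n" "\<sigma> ''m'' 0 = int m" "\<sigma> ''D'' 0 = int D" "\<sigma> ''W'' 0 = W"
      "\<sigma> ''K'' 0 = int (n ^ 3 * D ^ 2)" "\<sigma> ''k'' 0 = \<sigma> ''K'' 0 + 1" "\<sigma> ''T'' 0 = int n * \<sigma> ''K'' 0 + 1"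
    and \<sigma>_arrays: "\<And>j. j < m \<Longrightarrow> \<sigma> ''d'' (int j) = int (d (Suc j))"
      "\<And>j. j < m \<Longrightarrow> \<sigma> ''o'' (int j) = int (off j)"
    and \<sigma>_input: "\<And>i j x. i < n \<Longrightarrow> j < m \<Longrightarrow> x < d (Suc j) \<Longrightarrow>
        \<sigma> ''input'' (\<sigma> ''b'' (int j) + (2 * (int i * int (d (Suc j)) + int x) + 1))
          = fst (quotient_of (v (Suc j) (Suc i) $ x)) \<and>
        \<sigma> ''input'' (\<sigma> ''b'' (int j) + (2 * (int i * int (d (Suc j)) + int x) + 1) + 1)
          = snd (quotient_of (v (Suc j) (Suc i) $ x))"
    and input_le_B: "\<And>a. \<bar>\<sigma> ''input'' a\<bar> \<le> \<sigma> ''B'' 0"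
    and U_le: "\<And>p x. p \<in> pairs {..<n} \<Longrightarrow> \<bar>U p x\<bar> \<le> A" and A_pos: "1 \<le> A"
    and minors_le_B: "fact (Suc D) * A ^ Suc D \<le> \<sigma> ''B'' 0"
    and L_le_B: "\<sigma> ''L'' 0 \<le> \<sigma> ''B'' 0"
    and L_ge: "int n * \<sigma> ''K'' 0 + 2 * \<sigma> ''K'' 0 + 2 \<le> \<sigma> ''L'' 0"
begin

definition static :: "mem \<Rightarrow> bool" where
  "static s \<longleftrightarrow> (\<forall>z\<in>statics. s z = \<sigma> z)"

lemma static_simps:
  assumes "static s"
  shows "s ''input'' = \<sigma> ''input''" "s ''B'' = \<sigma> ''B''" "s ''L'' = \<sigma> ''L''"
    "s ''n'' 0 = int n" "s ''m'' 0 = int m" "s ''D'' 0 = int D" "s ''W'' 0 = W"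
    "s ''d'' = \<sigma> ''d''" "s ''o'' = \<sigma> ''o''" "s ''b'' = \<sigma> ''b''"
    "s ''K'' = \<sigma> ''K''" "s ''k'' 0 = \<sigma> ''K'' 0 + 1" "s ''T'' 0 = int n * \<sigma> ''K'' 0 + 1"
proof -
  have "s z = \<sigma> z" if "z \<in> statics" for z using assms that by (simp add: static_def)
  note eq = this[unfolded statics_def]
  show "s ''input'' = \<sigma> ''input''" "s ''B'' = \<sigma> ''B''" "s ''L'' = \<sigma> ''L''"
    "s ''d'' = \<sigma> ''d''" "s ''o'' = \<sigma> ''o''" "s ''b'' = \<sigma> ''b''" "s ''K'' = \<sigma> ''K''"
    by (rule eq, simp)+
  have scalars: "s ''n'' = \<sigma> ''n''" "s ''m'' = \<sigma> ''m''" "s ''D'' = \<sigma> ''D''" "s ''W'' = \<sigma> ''W''"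
    "s ''k'' = \<sigma> ''k''" "s ''T'' = \<sigma> ''T''"
    by (rule eq, simp)+
  show "s ''n'' 0 = int n" "s ''m'' 0 = int m" "s ''D'' 0 = int D" "s ''W'' 0 = W"
    "s ''k'' 0 = \<sigma> ''K'' 0 + 1" "s ''T'' 0 = int n * \<sigma> ''K'' 0 + 1"
    unfolding scalars by (fact \<sigma>_scalars)+
qed

lemma static_frame:
  assumes "static s" "frame Z s t" "Z \<inter> statics = {}"
  shows "static t"
  unfolding static_def
proof
  fix z assume z: "z \<in> statics"
  hence "z \<notin> Z" using assms(3) by (meson disjoint_iff)
  thus "t z = \<sigma> z" using assms(1,2) z by (simp add: static_def frame_def)
qed

lemma D_le_K: "int D \<le> \<sigma> ''K'' 0" and nD_le_K: "int n * int D \<le> \<sigma> ''K'' 0" and n_le_K: "int n \<le> \<sigma> ''K'' 0"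
proof -
  have "1 * (n * D) \<le> (n * n * D) * (n * D)"
    by (rule mult_le_mono1) (use n_pos D_pos in \<open>simp add: Suc_le_eq\<close>)
  hence nD: "n * D \<le> n ^ 3 * D ^ 2" by (simp add: power2_eq_square power3_eq_cube ac_simps)
  thus "int n * int D \<le> \<sigma> ''K'' 0" unfolding \<sigma>_scalars by (metis of_nat_le_iff of_nat_mult)
  have "1 * D \<le> n * D" "n * 1 \<le> n * D" using n_pos D_pos by (auto intro: mult_le_mono)
  hence "D \<le> n ^ 3 * D ^ 2" "n \<le> n ^ 3 * D ^ 2" using nD by linarith+
  thus "int D \<le> \<sigma> ''K'' 0" "int n \<le> \<sigma> ''K'' 0" unfolding \<sigma>_scalars by (simp_all only: of_nat_le_iff)
qed

lemma K_pos: "1 \<le> \<sigma> ''K'' 0" using n_le_K n_pos by linarith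

lemma caps: "int D \<le> \<sigma> ''L'' 0" "int n \<le> \<sigma> ''L'' 0" "int m \<le> \<sigma> ''L'' 0"
  "2 * int D \<le> \<sigma> ''L'' 0" "2 * \<sigma> ''K'' 0 + 2 \<le> \<sigma> ''L'' 0" "int n * \<sigma> ''K'' 0 + 1 \<le> \<sigma> ''L'' 0"
proof -
  have "0 \<le> int n * \<sigma> ''K'' 0" using K_pos by simp
  thus "int D \<le> \<sigma> ''L'' 0" "int n \<le> \<sigma> ''L'' 0" "int m \<le> \<sigma> ''L'' 0"
    "2 * int D \<le> \<sigma> ''L'' 0" "2 * \<sigma> ''K'' 0 + 2 \<le> \<sigma> ''L'' 0" "int n * \<sigma> ''K'' 0 + 1 \<le> \<sigma> ''L'' 0"
    using L_ge D_le_K n_le_K m_le_D K_pos by linarith+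
qed

lemma d_le_D: "j < m \<Longrightarrow> d (Suc j) \<le> D"
  using off_mono[of "Suc j" m] by (simp add: D_def off_Suc)

lemma small_le_B: "\<bar>z\<bar> \<le> 2 * \<sigma> ''K'' 0 + 2 \<Longrightarrow> \<bar>z\<bar> \<le> \<sigma> ''B'' 0"
  using caps(5) L_le_B by linarith

lemma B_ge_1: "1 \<le> \<sigma> ''B'' 0"
  using small_le_B[of 1] K_pos by simp

text \<open>All intermediate values are minors of size at most \<open>D + 1\<close>, so no assignment is skipped.\<close>
lemma minor_le_B:
  assumes "set ps \<subseteq> pairs {..<n}" "p \<in> pairs {..<n}" "k \<le> length ps" "length ps \<le> D"
  shows "\<bar>minor_row (\<lambda>i. U (ps ! i)) c k (U p) x\<bar> \<le> \<sigma> ''B'' 0"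
proof -
  have "\<bar>minor_row (\<lambda>i. U (ps ! i)) c k (U p) x\<bar> \<le> fact (Suc k) * A ^ Suc k"
  proof (rule abs_minor_row_le)
    show "\<bar>U (ps ! i) x\<bar> \<le> A" if "i < k" for i x
      by (rule U_le) (use assms(1,3) that nth_mem in fastforce)
    show "\<bar>U p x\<bar> \<le> A" for x by (rule U_le[OF assms(2)])
  qed
  also have "\<dots> \<le> fact (Suc D) * A ^ Suc D"
    using assms(3,4) A_pos by (intro mult_mono fact_mono power_increasing) auto
  finally show ?thesis using minors_le_B by linarith
qed

lemma U_eq_entry:
  assumes "x < d (Suc j)"
  shows "U (i, j) (off j + x) = fst (quotient_of (v (Suc j) (Suc i) $ x)) * W
           div snd (quotient_of (v (Suc j) (Suc i) $ x))"
  using assms by (simp add: U_def off_Suc)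

lemma U_le_B: "p \<in> pairs {..<n} \<Longrightarrow> \<bar>U p x\<bar> \<le> \<sigma> ''B'' 0"
  using minor_le_B[of "[]" p 0 undefined x] by simp

text \<open>The row is first cleared and then filled within block \<open>j\<close>.\<close>
lemma load_row_correct:
  assumes st: "static s" and ij: "i < n" "j < m" "s ''i'' 0 = int i" "s ''j'' 0 = int j"
  shows "\<forall>x<D. sem load_row s ''v'' (int x) = U (i, j) x"
proof -
  let ?clear = "For ''x'' ''D'' (Asg ''v'' (V ''x'') (Lit 0))"
  let ?entry = "Div (Mul (Read ''input'' numerator_cell) (V ''W'')) (Read ''input'' (Add numerator_cell (Lit 1)))"
  let ?copy = "For ''x'' ''e'' (Asg ''v'' (Add (Read ''o'' (V ''j'')) (V ''x'')) ?entry)"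
  note st' = static_simps[OF st]
  define s1 where "s1 = sem ?clear s"
  have N: "D = nat (min (s ''D'' 0) (s ''L'' 0))" using caps(1) by (simp add: st')
  have clear: "frame {''x'', ''v''} s s1 \<and> (\<forall>x<D. s1 ''v'' (int x) = 0) \<and>
      (\<forall>a. a \<notin> int ` {..<D} \<longrightarrow> s1 ''v'' a = s ''v'' a)"
    unfolding s1_def by (rule sem_For_fill[where s = s and y = "''D''", OF N]) (use B_ge_1 in \<open>auto simp: st'\<close>)
  have f1: "s1 z = s z" if "z \<notin> {''x'', ''v''}" for z using clear that by (simp add: frame_def)
  define s2 where "s2 = sem (SetVar ''e'' (Read ''d'' (V ''j''))) s1"
  have "\<bar>int (d (Suc j))\<bar> \<le> \<sigma> ''B'' 0"
    using d_le_D[OF ij(2)] D_le_K by (intro small_le_B) linarith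
  hence s2: "s2 = upd s1 ''e'' 0 (int (d (Suc j)))"
    using ij by (simp add: s2_def f1 st' \<sigma>_arrays)
  have f2: "s2 z = s z" if "z \<notin> {''x'', ''v'', ''e''}" for z using f1 that by (simp add: s2)
  have load: "sem load_row s = sem ?copy s2"
    by (simp only: load_row_def s2_def s1_def sem.simps(3))
  have N2: "d (Suc j) = nat (min (s2 ''e'' 0) (s2 ''L'' 0))"
    using d_le_D[OF ij(2)] caps(1) by (simp add: s2 f1 st')
  have step: "aval t (Add (Read ''o'' (V ''j'')) (V ''x'')) = int (off j + k)
      \<and> aval t ?entry = U (i, j) (off j + k) \<and> \<bar>U (i, j) (off j + k)\<bar> \<le> s2 ''B'' 0"
    if k: "k < d (Suc j)" and f: "frame {''x'', ''v''} s2 t" and x: "t ''x'' 0 = int k" for k t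
  proof -
    have f: "t z = s z" if "z \<notin> {''x'', ''v'', ''e''}" for z
      using f that by (simp add: frame_def f2)
    have "aval t (Add (Read ''o'' (V ''j'')) (V ''x'')) = int (off j + k)" "aval t ?entry = U (i, j) (off j + k)"
      using \<sigma>_input[OF ij(1,2) k] ij x
      by (simp_all add: numerator_cell_def f st' \<sigma>_arrays U_eq_entry[OF k])
    thus ?thesis using U_le_B[of "(i, j)"] ij by (simp add: f2 st' del: aval.simps)
  qed
  have copy: "frame {''x'', ''v''} s2 (sem ?copy s2) \<and>
      (\<forall>k<d (Suc j). sem ?copy s2 ''v'' (int (off j + k)) = U (i, j) (off j + k)) \<and>
      (\<forall>a. a \<notin> (\<lambda>k. int (off j + k)) ` {..<d (Suc j)} \<longrightarrow> sem ?copy s2 ''v'' a = s2 ''v'' a)"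
    by (rule sem_For_fill[where s = s2 and y = "''e''", OF N2]) (use step in \<open>auto simp: inj_on_def simp del: aval.simps\<close>)
  show ?thesis unfolding load
  proof (intro allI impI)
    fix x assume x: "x < D"
    show "sem ?copy s2 ''v'' (int x) = U (i, j) x"
    proof (cases "off j \<le> x \<and> x < off j + d (Suc j)")
      case True
      hence "x - off j < d (Suc j)" "off j + (x - off j) = x" by auto
      thus ?thesis using copy by metis
    next
      case False
      hence "int x \<notin> (\<lambda>k. int (off j + k)) ` {..<d (Suc j)}" by auto
      hence "sem ?copy s2 ''v'' (int x) = s2 ''v'' (int x)" using copy by blast
      also have "\<dots> = 0" using clear x by (simp add: s2)
      also have "0 = U (i, j) x" using False by (auto simp: U_def off_Suc)
      finally show ?thesis .
    qed
  qed
qed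

text \<open>The memory holds the elimination state of \<open>ps\<close>: row \<open>k\<close> is reduced by the \<open>k\<close> rows before it.\<close>
definition rep :: "(nat \<times> nat) list \<Rightarrow> (nat \<Rightarrow> nat) \<Rightarrow> mem \<Rightarrow> bool" where
  "rep ps c s \<longleftrightarrow> pivoted D U ps c \<and> set ps \<subseteq> pairs {..<n} \<and> s ''r'' 0 = int (length ps) \<and>
     (\<forall>k<length ps. s ''c'' (int k) = int (c k)) \<and>
     (\<forall>k<length ps. \<forall>x<D. s ''w'' (int (k * D + x)) = minor_row (\<lambda>i. U (ps ! i)) c k (U (ps ! k)) x) \<and>
     (\<forall>k\<le>length ps. s ''p'' (int k) = lead_minor (\<lambda>i. U (ps ! i)) c k)"

lemma rep_frame:
  assumes "rep ps c s" "frame Z s t" "Z \<inter> {''r'', ''c'', ''w'', ''p''} = {}"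
  shows "rep ps c t"
proof -
  have "''r'' \<notin> Z" "''c'' \<notin> Z" "''w'' \<notin> Z" "''p'' \<notin> Z" using assms(3) by auto
  hence "t ''r'' = s ''r''" "t ''c'' = s ''c''" "t ''w'' = s ''w''" "t ''p'' = s ''p''"
    using assms(2) by (simp_all add: frame_def)
  thus ?thesis using assms(1) unfolding rep_def by simp
qed

lemma rep_length: "rep ps c s \<Longrightarrow> length ps \<le> D"
  unfolding rep_def using pivoted_length_le by blast

lemma reduce_row_correct:
  assumes st: "static s" and rep: "rep ps c s" and p: "p \<in> pairs {..<n}"
    and v: "\<forall>x<D. s ''v'' (int x) = U p x"
  shows "\<forall>x<D. sem reduce_row s ''v'' (int x) = minor_row (\<lambda>i. U (ps ! i)) c (length ps) (U p) x"
proof -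
  let ?b = "\<lambda>i. U (ps ! i)"
  let ?inner = "For ''x'' ''D'' (Asg ''v'' (V ''x'')
            (Div (Sub (Mul (Read ''p'' (Add (V ''h'') (Lit 1))) (Read ''v'' (V ''x'')))
                      (Mul (V ''q'') (Read ''w'' (Add (Mul (V ''h'') (V ''D'')) (V ''x'')))))
                 (Read ''p'' (V ''h''))))"
  let ?body = "Sq (SetVar ''q'' (Read ''v'' (Read ''c'' (V ''h'')))) ?inner"
  let ?I = "\<lambda>k t. frame {''h'', ''q'', ''x'', ''v''} s t \<and> (\<forall>x<D. t ''v'' (int x) = minor_row ?b c k (U p) x)"
  note st' = static_simps[OF st]
  have len: "length ps \<le> D" by (rule rep_length[OF rep])
  have ps: "set ps \<subseteq> pairs {..<n}" and piv: "pivoted D U ps c" using rep by (auto simp: rep_def)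
  have "?I (length ps) (sem (For ''h'' ''r'' ?body) s)"
  proof (rule sem_For_invariant[where I = ?I and s = s and y = "''r''"])
    show "length ps = nat (min (s ''r'' 0) (s ''L'' 0))"
      using rep len caps(1) by (simp add: rep_def st')
    show "?I 0 (upd s ''h'' 0 0)" using v by (auto intro: frame_updI)
    fix k t assume k: "k < length ps" and I: "?I k t" and h: "t ''h'' 0 = int k"
    have f: "t z = s z" if "z \<notin> {''h'', ''q'', ''x'', ''v''}" for z using I that by (simp add: frame_def)
    have ck: "c k < D" using piv k by (simp add: pivoted_def)
    define Q where "Q = minor_row ?b c k (U p) (c k)"
    have "t ''v'' (t ''c'' (int k)) = Q"
      using I ck rep k f[of "''c''"] by (simp add: Q_def rep_def)
    moreover have "\<bar>Q\<bar> \<le> \<sigma> ''B'' 0"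
      unfolding Q_def by (rule minor_le_B[OF ps p]) (use k len in auto)
    ultimately have t1: "sem (SetVar ''q'' (Read ''v'' (Read ''c'' (V ''h'')))) t = upd t ''q'' 0 Q"
      using h by (simp add: f st')
    define t1 where "t1 = upd t ''q'' 0 Q"
    have N: "D = nat (min (t1 ''D'' 0) (t1 ''L'' 0))" using caps(1) by (simp add: t1_def f st')
    have inner: "frame {''x'', ''v''} t1 (sem ?inner t1) \<and>
        (\<forall>x<D. sem ?inner t1 ''v'' (int x) = minor_row ?b c (Suc k) (U p) x) \<and>
        (\<forall>a. a \<notin> int ` {..<D} \<longrightarrow> sem ?inner t1 ''v'' a = t1 ''v'' a)"
    proof (rule sem_For_fill[where s = t1 and y = "''D''", OF N])
      fix x u assume x: "x < D" and fu: "frame {''x'', ''v''} t1 u" and ux: "u ''x'' 0 = int x"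
        and uv: "\<And>a. a \<notin> int ` {..<x} \<Longrightarrow> u ''v'' a = t1 ''v'' a"
      have f': "u z = t1 z" if "z \<notin> {''x'', ''v''}" for z using fu that by (simp add: frame_def)
      have "int x \<notin> int ` {..<x}" by auto
      hence vx: "u ''v'' (int x) = minor_row ?b c k (U p) x" using uv I x by (simp add: t1_def)
      have lead: "s ''p'' (int l) = lead_minor ?b c l" if "l \<le> length ps" for l
        using rep that by (simp add: rep_def)
      have pk: "u ''p'' (int k + 1) = lead_minor ?b c (Suc k)" "u ''p'' (int k) = lead_minor ?b c k"
        using k lead[of "Suc k"] lead[of k] by (simp_all add: f' t1_def f add.commute[of 1])
      have wk: "u ''w'' (int k * int D + int x) = minor_row ?b c k (U (ps ! k)) x"
        using rep k x by (simp add: f' t1_def f rep_def flip: of_nat_add of_nat_mult)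
      have scalars: "u ''q'' 0 = Q" "u ''h'' 0 = int k" "u ''D'' 0 = int D"
        using h by (simp_all add: f' t1_def f st')
      \<comment> \<open>The division is exact.\<close>
      have step: "lead_minor ?b c (Suc k) * minor_row ?b c k (U p) x - Q * minor_row ?b c k (U (ps ! k)) x
          = lead_minor ?b c k * minor_row ?b c (Suc k) (U p) x"
        unfolding Q_def by (rule minor_row_step[symmetric]) (use piv k in \<open>auto simp: pivoted_def\<close>)
      have nz: "lead_minor ?b c k \<noteq> 0" using piv k by (simp add: pivoted_def)
      have "aval u (Div (Sub (Mul (Read ''p'' (Add (V ''h'') (Lit 1))) (Read ''v'' (V ''x'')))
                      (Mul (V ''q'') (Read ''w'' (Add (Mul (V ''h'') (V ''D'')) (V ''x'')))))
                 (Read ''p'' (V ''h'')))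
          = (lead_minor ?b c (Suc k) * minor_row ?b c k (U p) x - Q * minor_row ?b c k (U (ps ! k)) x)
            div lead_minor ?b c k"
        by (simp only: aval.simps scalars ux vx pk wk)
      also have "\<dots> = minor_row ?b c (Suc k) (U p) x" unfolding step using nz by simp
      finally have entry: "aval u (Div (Sub (Mul (Read ''p'' (Add (V ''h'') (Lit 1))) (Read ''v'' (V ''x'')))
                      (Mul (V ''q'') (Read ''w'' (Add (Mul (V ''h'') (V ''D'')) (V ''x'')))))
                 (Read ''p'' (V ''h''))) = minor_row ?b c (Suc k) (U p) x" .
      have "\<bar>minor_row ?b c (Suc k) (U p) x\<bar> \<le> t1 ''B'' 0"
        using minor_le_B[OF ps p, of "Suc k"] k len by (simp add: t1_def f st')
      thus "aval u (V ''x'') = int x \<and>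
        aval u (Div (Sub (Mul (Read ''p'' (Add (V ''h'') (Lit 1))) (Read ''v'' (V ''x'')))
                      (Mul (V ''q'') (Read ''w'' (Add (Mul (V ''h'') (V ''D'')) (V ''x'')))))
                 (Read ''p'' (V ''h''))) = minor_row ?b c (Suc k) (U p) x \<and>
        \<bar>minor_row ?b c (Suc k) (U p) x\<bar> \<le> t1 ''B'' 0"
        unfolding entry using ux by simp
    qed auto
    have body: "sem ?body t = sem ?inner t1" unfolding sem.simps(3) t1 t1_def by (rule refl)
    show "?I (Suc k) (upd (sem ?body t) ''h'' 0 (int (Suc k)))"
      unfolding body
    proof
      have 1: "frame {''h'', ''q'', ''x'', ''v''} s t1" unfolding t1_def using I by (intro frame_updI) auto
      have 2: "frame {''h'', ''q'', ''x'', ''v''} t1 (sem ?inner t1)"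
        by (rule frame_mono[OF conjunct1[OF inner]]) auto
      show "frame {''h'', ''q'', ''x'', ''v''} s (upd (sem ?inner t1) ''h'' 0 (int (Suc k)))"
        by (rule frame_updI[OF frame_trans[OF 1 2]]) simp
    qed (use inner in simp)
  qed
  thus ?thesis by (simp add: reduce_row_def)
qed

lemma find_pivot_correct:
  assumes st: "static s"
  shows "sem find_pivot s ''f'' 0 = - 1 \<and> (\<forall>x<D. s ''v'' (int x) = 0) \<or>
    (\<exists>y<D. sem find_pivot s ''f'' 0 = int y \<and> s ''v'' (int y) \<noteq> 0)"
proof -
  note st' = static_simps[OF st]
  let ?body = "If (Equal (Read ''v'' (V ''x'')) (Lit 0)) Nop (SetVar ''f'' (V ''x''))"
  let ?I = "\<lambda>k t. frame {''x'', ''f''} s t \<and> (t ''f'' 0 = - 1 \<and> (\<forall>x<k. s ''v'' (int x) = 0) \<or>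
    (\<exists>y<k. t ''f'' 0 = int y \<and> s ''v'' (int y) \<noteq> 0))"
  define s1 where "s1 = upd s ''f'' 0 (- 1)"
  have s1: "sem (SetVar ''f'' (Lit (- 1))) s = s1" using B_ge_1 by (simp add: st' s1_def)
  have "?I D (sem (For ''x'' ''D'' ?body) s1)"
  proof (rule sem_For_invariant[where I = ?I and s = s1 and y = "''D''"])
    show "D = nat (min (s1 ''D'' 0) (s1 ''L'' 0))" using caps(1) by (simp add: s1_def st')
    show "?I 0 (upd s1 ''x'' 0 0)" by (auto intro!: frame_updI simp: s1_def)
    fix k t assume k: "k < D" and I: "?I k t" and x: "t ''x'' 0 = int k"
    have f: "t ''v'' = s ''v''" "t ''B'' = \<sigma> ''B''" using I by (simp_all add: frame_def st')
    have "\<bar>int k\<bar> \<le> \<sigma> ''B'' 0" using k D_le_K by (intro small_le_B) linarith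
    hence "sem ?body t = (if s ''v'' (int k) = 0 then t else upd t ''f'' 0 (int k))"
      using x by (simp add: f)
    thus "?I (Suc k) (upd (sem ?body t) ''x'' 0 (int (Suc k)))"
      using I by (auto intro!: frame_updI simp: less_Suc_eq)
  qed
  thus ?thesis unfolding find_pivot_def sem.simps(3) s1 by blast
qed

lemma push_row_correct:
  assumes st: "static s" and rep: "rep ps c s" and p: "p \<in> pairs {..<n}"
    and v: "\<forall>x<D. s ''v'' (int x) = minor_row (\<lambda>i. U (ps ! i)) c (length ps) (U p) x"
    and y: "y < D" "s ''f'' 0 = int y" "s ''v'' (int y) \<noteq> 0"
  shows "rep (ps @ [p]) (c(length ps := y)) (sem push_row s)"
proof -
  note st' = static_simps[OF st]
  let ?copy = "For ''x'' ''D'' (Asg ''w'' (Add (Mul (V ''r'') (V ''D'')) (V ''x'')) (Read ''v'' (V ''x'')))"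
  let ?b = "\<lambda>i. U (ps ! i)" and ?b' = "\<lambda>i. U ((ps @ [p]) ! i)" and ?c = "c(length ps := y)"
  have len: "length ps \<le> D" by (rule rep_length[OF rep])
  have ps: "set ps \<subseteq> pairs {..<n}" and piv: "pivoted D U ps c" and r: "s ''r'' 0 = int (length ps)"
    using rep by (auto simp: rep_def)
  have nz: "minor_row ?b c (length ps) (U p) y \<noteq> 0" using v y by simp
  have piv': "pivoted D U (ps @ [p]) ?c" by (rule pivoted_snoc[OF piv y(1) nz])
  have row: "minor_row ?b' ?c k = minor_row ?b c k" if "k \<le> length ps" for k
    by (intro ext fun_cong[OF minor_row_cong]) (use that in \<open>auto simp: nth_append\<close>)
  have lead: "lead_minor ?b' ?c k = lead_minor ?b c k" if "k \<le> length ps" for k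
    by (rule lead_minor_cong) (use that in \<open>auto simp: nth_append\<close>)
  have lead': "lead_minor ?b' ?c (Suc (length ps)) = minor_row ?b c (length ps) (U p) y"
    using minor_row_own[of ?b' ?c "length ps"] row[of "length ps"] by simp
  define s1 where "s1 = sem ?copy s"
  have N: "D = nat (min (s ''D'' 0) (s ''L'' 0))" using caps(1) by (simp add: st')
  have copy: "frame {''x'', ''w''} s s1 \<and> (\<forall>x<D. s1 ''w'' (int (length ps * D + x)) = minor_row ?b c (length ps) (U p) x) \<and>
      (\<forall>a. a \<notin> (\<lambda>x. int (length ps * D + x)) ` {..<D} \<longrightarrow> s1 ''w'' a = s ''w'' a)"
    unfolding s1_def
  proof (rule sem_For_fill[where s = s and y = "''D''", OF N])
    fix x t assume x: "x < D" and ft: "frame {''x'', ''w''} s t" and tx: "t ''x'' 0 = int x"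
    have f: "t z = s z" if "z \<notin> {''x'', ''w''}" for z using ft that by (simp add: frame_def)
    have "\<bar>minor_row ?b c (length ps) (U p) x\<bar> \<le> s ''B'' 0"
      using minor_le_B[OF ps p] len by (simp add: st')
    thus "aval t (Add (Mul (V ''r'') (V ''D'')) (V ''x'')) = int (length ps * D + x) \<and>
        aval t (Read ''v'' (V ''x'')) = minor_row ?b c (length ps) (U p) x \<and>
        \<bar>minor_row ?b c (length ps) (U p) x\<bar> \<le> s ''B'' 0"
      using tx v x r by (simp add: f st')
  qed (auto simp: inj_on_def)
  have f: "s1 z = s z" if "z \<notin> {''x'', ''w''}" for z using copy that by (simp add: frame_def)
  define s2 where "s2 = upd s1 ''c'' (int (length ps)) (int y)"
  define s3 where "s3 = upd s2 ''p'' (int (length ps) + 1) (minor_row ?b c (length ps) (U p) y)"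
  define s4 where "s4 = upd s3 ''r'' 0 (int (length ps) + 1)"
  have "\<bar>int y\<bar> \<le> \<sigma> ''B'' 0" using y D_le_K by (intro small_le_B) linarith
  hence 2: "sem (Asg ''c'' (V ''r'') (V ''f'')) s1 = s2"
    using r y by (simp add: s2_def f st')
  have "\<bar>minor_row ?b c (length ps) (U p) y\<bar> \<le> \<sigma> ''B'' 0"
    using minor_le_B[OF ps p] len by simp
  hence 3: "sem (Asg ''p'' (Add (V ''r'') (Lit 1)) (Read ''v'' (V ''f''))) s2 = s3"
    using r y v by (simp add: s2_def s3_def f st')
  have "\<bar>int (length ps) + 1\<bar> \<le> \<sigma> ''B'' 0" using len D_le_K K_pos by (intro small_le_B) linarith
  hence 4: "sem (SetVar ''r'' (Add (V ''r'') (Lit 1))) s3 = s4"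
    using r by (simp add: s2_def s3_def s4_def f st')
  have "sem push_row s = s4"
    using y(2) by (simp only: push_row_def sem.simps(3,4) bval.simps aval.simps 2 3 4 s1_def[symmetric] if_False) simp
  moreover have "rep (ps @ [p]) ?c s4"
    unfolding rep_def
  proof (intro conjI allI impI)
    show "s4 ''w'' (int (k * D + x)) = minor_row ?b' ?c k (?b' k) x" if "k < length (ps @ [p])" "x < D" for k x
    proof (cases "k = length ps")
      case True
      show ?thesis unfolding True row[OF order_refl] using copy that by (simp add: s4_def s3_def s2_def)
    next
      case False
      hence k: "k < length ps" using that by simp
      have "k * D + x < (k + 1) * D" using that by simp
      also have "\<dots> \<le> length ps * D" using k by (intro mult_le_mono1) simp
      finally have "int (k * D + x) \<notin> (\<lambda>x. int (length ps * D + x)) ` {..<D}"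
        by (auto simp del: of_nat_add of_nat_mult)
      hence "s1 ''w'' (int (k * D + x)) = s ''w'' (int (k * D + x))" using copy by blast
      thus ?thesis unfolding row[OF less_imp_le[OF k]]
        using rep k that by (simp add: s4_def s3_def s2_def nth_append rep_def)
    qed
    show "s4 ''p'' (int k) = lead_minor ?b' ?c k" if "k \<le> length (ps @ [p])" for k
    proof (cases "k = Suc (length ps)")
      case True
      thus ?thesis using lead' by (simp add: s4_def s3_def)
    next
      case False
      thus ?thesis using that rep by (simp add: s4_def s3_def s2_def f lead rep_def)
    qed
    show "s4 ''c'' (int k) = int (?c k)" if "k < length (ps @ [p])" for k
      using that rep by (auto simp: s4_def s3_def s2_def f rep_def)
  qed (use piv' ps p in \<open>auto simp: s4_def\<close>)
  ultimately show ?thesis by simp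
qed

text \<open>A vector whose reduced row vanishes is dependent on the accepted ones; otherwise a nonzero entry
  of the reduced row is a further pivot.\<close>
lemma insert_row_correct:
  assumes st: "static s" and rep: "rep ps c s" and ij: "i < n" "j < m" "s ''i'' 0 = int i" "s ''j'' 0 = int j"
  shows "\<exists>ps' c'. rep ps' c' (sem insert_row s) \<and>
    (ps' = ps \<and> dependent_on D U ps (U (i, j)) \<or> ps' = ps @ [(i, j)])"
proof -
  have p: "(i, j) \<in> pairs {..<n}" using ij by simp
  define s1 where "s1 = sem load_row s"
  define s2 where "s2 = sem reduce_row s1"
  define s3 where "s3 = sem find_pivot s2"
  have fr1: "frame {''x'', ''v'', ''e''} s s1" unfolding s1_def
    by (rule frame_mono[OF frame_sem]) (auto simp: load_row_def)
  have fr2: "frame {''x'', ''v'', ''h'', ''q''} s1 s2" unfolding s2_def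
    by (rule frame_mono[OF frame_sem]) (auto simp: reduce_row_def)
  have fr3: "frame {''x'', ''f''} s2 s3" unfolding s3_def
    by (rule frame_mono[OF frame_sem]) (auto simp: find_pivot_def)
  have st1: "static s1" by (rule static_frame[OF st fr1]) (auto simp: statics_def)
  have st2: "static s2" by (rule static_frame[OF st1 fr2]) (auto simp: statics_def)
  have st3: "static s3" by (rule static_frame[OF st2 fr3]) (auto simp: statics_def)
  have rep1: "rep ps c s1" by (rule rep_frame[OF rep fr1]) auto
  have rep2: "rep ps c s2" by (rule rep_frame[OF rep1 fr2]) auto
  have rep3: "rep ps c s3" by (rule rep_frame[OF rep2 fr3]) auto
  have v1: "\<forall>x<D. s1 ''v'' (int x) = U (i, j) x"
    unfolding s1_def by (rule load_row_correct[OF st ij])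
  have v2: "\<forall>x<D. s2 ''v'' (int x) = minor_row (\<lambda>i. U (ps ! i)) c (length ps) (U (i, j)) x"
    unfolding s2_def by (rule reduce_row_correct[OF st1 rep1 p v1])
  have v3: "s3 ''v'' = s2 ''v''" using fr3 by (simp add: frame_def)
  have sem: "sem insert_row s = sem push_row s3"
    by (simp only: insert_row_def sem.simps(3) s1_def s2_def s3_def)
  from find_pivot_correct[OF st2, folded s3_def] show ?thesis
  proof
    assume z: "s3 ''f'' 0 = - 1 \<and> (\<forall>x<D. s2 ''v'' (int x) = 0)"
    hence "sem push_row s3 = s3" by (simp add: push_row_def)
    moreover have "dependent_on D U ps (U (i, j))"
    proof (rule dependent_on_if_minor_row_0)
      show "pivoted D U ps c" using rep by (simp add: rep_def)
      fix x assume "x < D"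
      thus "minor_row (\<lambda>i. U (ps ! i)) c (length ps) (U (i, j)) x = 0"
        using v2[rule_format, of x] z by simp
    qed
    ultimately show ?thesis unfolding sem
      by (intro exI[of _ ps] exI[of _ c]) (simp add: rep3)
  next
    assume "\<exists>y<D. s3 ''f'' 0 = int y \<and> s2 ''v'' (int y) \<noteq> 0"
    then obtain y where y: "y < D" "s3 ''f'' 0 = int y" "s3 ''v'' (int y) \<noteq> 0" unfolding v3 by blast
    have "rep (ps @ [(i, j)]) (c(length ps := y)) (sem push_row s3)"
      by (rule push_row_correct[OF st3 rep3 p _ y]) (use v2 in \<open>simp add: v3\<close>)
    thus ?thesis unfolding sem by blast
  qed
qed

end

section \<open>The greedy subgradient\<close>

definition insert_element :: prog where
  "insert_element = For ''j'' ''m'' insert_row"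

text \<open>Level \<open>l\<close> deals with the indices \<open>i\<close> at height \<open>K - l\<close>. The entry of the subgradient is \<open>n\<close> times the
  number of vectors of \<open>i\<close> that are accepted, minus \<open>D\<close>: the increment of \<open>objective\<close>.\<close>
definition process_element :: prog where
  "process_element =
     If (Equal (Read ''X'' (V ''i'')) (Sub (V ''K'') (V ''l'')))
       (Sq (SetVar ''g'' (V ''r''))
       (Sq insert_element
       (Sq (Asg ''u'' (V ''i'') (Sub (Mul (V ''n'') (Sub (V ''r'') (V ''g''))) (V ''D'')))
           (SetVar ''y'' (Add (V ''y'') (Lit 1))))))
       Nop"

definition record_level :: prog where
  "record_level = For ''i'' ''n'' (If (Less (Read ''X'' (V ''i'')) (Sub (V ''K'') (V ''l'')))
     (Asg ''S'' (V ''i'') (Lit 0)) (Asg ''S'' (V ''i'') (Lit 1)))"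

text \<open>After the indices of a level the value of the level set is \<open>n * r - D * y\<close>, since \<open>r\<close> is the rank
  and \<open>y\<close> the number of indices so far.\<close>
definition process_level :: prog where
  "process_level =
     Sq (For ''i'' ''n'' process_element)
    (Sq (SetVar ''t'' (Sub (Mul (V ''n'') (V ''r'')) (Mul (V ''D'') (V ''y''))))
        (If (Less (V ''t'') (V ''A'')) (Sq (SetVar ''A'' (V ''t'')) record_level) Nop))"

definition reset_rows :: prog where
  "reset_rows = Sq (SetVar ''r'' (Lit 0)) (Sq (Asg ''p'' (Lit 0) (Lit 1)) (SetVar ''y'' (Lit 0)))"

text \<open>The thresholds are \<open>K, K - 1, ..., 0\<close>. Running over all of them replaces sorting the coordinates,
  and \<open>K\<close> is polynomial.\<close>
definition scan_levels :: prog where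
  "scan_levels = Sq reset_rows (For ''l'' ''k'' process_level)"

text \<open>The projection of \<open>X - u\<close> onto the cube.\<close>
definition update_point :: prog where
  "update_point = For ''i'' ''n''
     (Sq (SetVar ''t'' (Sub (Read ''X'' (V ''i'')) (Read ''u'' (V ''i''))))
         (If (Less (V ''t'') (Lit 0)) (Asg ''X'' (V ''i'') (Lit 0))
         (If (Less (V ''K'') (V ''t'')) (Asg ''X'' (V ''i'') (V ''K'')) (Asg ''X'' (V ''i'') (V ''t'')))))"

definition descent :: prog where
  "descent = For ''s'' ''T'' (Sq scan_levels update_point)"

lemma writes_insert_row:
  "writes insert_row = {''x'', ''v'', ''e'', ''h'', ''q'', ''f'', ''w'', ''c'', ''p'', ''r''}"
  by (auto simp: insert_row_def load_row_def reduce_row_def find_pivot_def push_row_def)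

lemma writes_insert_element:
  "writes insert_element = {''j'', ''x'', ''v'', ''e'', ''h'', ''q'', ''f'', ''w'', ''c'', ''p'', ''r''}"
  by (auto simp: insert_element_def writes_insert_row)

lemma writes_process_element:
  "writes process_element =
     {''g'', ''u'', ''y'', ''j'', ''x'', ''v'', ''e'', ''h'', ''q'', ''f'', ''w'', ''c'', ''p'', ''r''}"
  by (auto simp: process_element_def writes_insert_element)

lemma writes_record_level: "writes record_level = {''i'', ''S''}"
  by (auto simp: record_level_def)

lemma writes_scan_levels:
  "writes scan_levels = {''l'', ''i'', ''t'', ''A'', ''S'', ''g'', ''u'', ''y'', ''j'', ''x'', ''v'',
     ''e'', ''h'', ''q'', ''f'', ''w'', ''c'', ''p'', ''r''}"
  by (auto simp: scan_levels_def reset_rows_def process_level_def writes_process_element writes_record_level)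

lemma writes_update_point: "writes update_point = {''i'', ''t'', ''X''}"
  by (auto simp: update_point_def)

context machine
begin

text \<open>A vector that was rejected stays dependent when the list grows.\<close>
lemma insert_element_correct:
  assumes st: "static s" and rep: "rep ps c s" and i: "i < n" "s ''i'' 0 = int i"
  shows "\<exists>qs c'. rep (ps @ qs) c' (sem insert_element s) \<and> set qs \<subseteq> {i} \<times> {..<m} \<and>
    (\<forall>j<m. dependent_on D U (ps @ qs) (U (i, j)))"
proof -
  note st' = static_simps[OF st]
  let ?I = "\<lambda>k t. frame (writes (For ''j'' ''m'' insert_row)) s t \<and> (\<exists>qs c'. rep (ps @ qs) c' t \<and> set qs \<subseteq> {i} \<times> {..<k} \<and>
    (\<forall>j<k. dependent_on D U (ps @ qs) (U (i, j))))"
  have "?I m (sem insert_element s)"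
    unfolding insert_element_def
  proof (rule sem_For_invariant[where I = ?I and s = s and y = "''m''"])
    show "m = nat (min (s ''m'' 0) (s ''L'' 0))" using caps(3) by (simp add: st')
    have "rep (ps @ []) c (upd s ''j'' 0 0)"
      using rep_frame[OF rep frame_updI[OF frame_refl], of "''j''" "{''j''}" 0 0] by simp
    thus "frame (writes (For ''j'' ''m'' insert_row)) s (upd s ''j'' 0 0) \<and>
      (\<exists>qs c'. rep (ps @ qs) c' (upd s ''j'' 0 0) \<and> set qs \<subseteq> {i} \<times> {..<0} \<and>
        (\<forall>j<0. dependent_on D U (ps @ qs) (U (i, j))))"
      by (auto intro!: frame_updI exI[of _ "[]"])
    fix k t assume k: "k < m" and j: "t ''j'' 0 = int k"
      and I: "frame (writes (For ''j'' ''m'' insert_row)) s t \<and>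
        (\<exists>qs c'. rep (ps @ qs) c' t \<and> set qs \<subseteq> {i} \<times> {..<k} \<and>
          (\<forall>j<k. dependent_on D U (ps @ qs) (U (i, j))))"
    from I obtain qs c1 where qs: "rep (ps @ qs) c1 t" "set qs \<subseteq> {i} \<times> {..<k}"
      "\<And>j. j < k \<Longrightarrow> dependent_on D U (ps @ qs) (U (i, j))" by blast
    have fr: "frame (writes insert_element) s t" using I by (simp add: insert_element_def)
    have stt: "static t" by (rule static_frame[OF st fr]) (auto simp: writes_insert_element statics_def)
    have ti: "t ''i'' 0 = int i" using i frameD[OF fr, of "''i''"] by (simp add: writes_insert_element)
    define t' where "t' = upd (sem insert_row t) ''j'' 0 (int (Suc k))"
    obtain ps' c' where ps': "rep ps' c' (sem insert_row t)"
      "ps' = ps @ qs \<and> dependent_on D U (ps @ qs) (U (i, k)) \<or> ps' = (ps @ qs) @ [(i, k)]"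
      using insert_row_correct[OF stt qs(1) i(1) k ti j] by blast
    have "rep ps' c' t'" unfolding t'_def by (rule rep_frame[OF ps'(1) frame_updI[OF frame_refl], of _ "{''j''}"]) auto
    moreover obtain qs' where "ps' = ps @ qs'" "set qs' \<subseteq> {i} \<times> {..<Suc k}"
      "\<And>j. j < Suc k \<Longrightarrow> dependent_on D U (ps @ qs') (U (i, j))"
    proof (cases "ps' = ps @ qs \<and> dependent_on D U (ps @ qs) (U (i, k))")
      case True
      show ?thesis by (rule that[of qs]) (use True qs in \<open>auto simp: less_Suc_eq\<close>)
    next
      case False
      hence ps'': "ps' = ps @ (qs @ [(i, k)])" using ps'(2) by auto
      have "dependent_on D U (ps @ (qs @ [(i, k)])) (U (i, j))" if "j < Suc k" for j
      proof (cases "j = k")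
        case True
        thus ?thesis by (intro dependent_on_member) simp
      next
        case False
        thus ?thesis using dependent_on_append[OF qs(3), of j "[(i, k)]"] that by simp
      qed
      thus ?thesis using ps'' qs(2) by (intro that[of "qs @ [(i, k)]"]) auto
    qed
    moreover have "frame (writes (For ''j'' ''m'' insert_row)) s t'"
      unfolding t'_def
      by (rule frame_updI[OF frame_trans[OF conjunct1[OF I] frame_mono[OF frame_sem]]]) auto
    ultimately show "frame (writes (For ''j'' ''m'' insert_row)) s (upd (sem insert_row t) ''j'' 0 (int (Suc k))) \<and>
        (\<exists>qs c'. rep (ps @ qs) c' (upd (sem insert_row t) ''j'' 0 (int (Suc k))) \<and> set qs \<subseteq> {i} \<times> {..<Suc k} \<and>
          (\<forall>j<Suc k. dependent_on D U (ps @ qs) (U (i, j))))"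
      unfolding t'_def[symmetric] by blast
  qed
  thus ?thesis by blast
qed

definition gain :: "(nat \<times> nat) list \<Rightarrow> nat \<Rightarrow> int" where
  "gain ps i = int n * int (card {p \<in> set ps. fst p = i}) - int D"

text \<open>\<open>Q\<close> is the set of indices dealt with. The accepted vectors come from \<open>Q\<close> and generate all vectors of
  \<open>Q\<close>, so their number is the rank of \<open>Q\<close>.\<close>
definition processed :: "nat set \<Rightarrow> mem \<Rightarrow> bool" where
  "processed Q s \<longleftrightarrow> (\<exists>ps c. rep ps c s \<and> set ps \<subseteq> pairs Q \<and>
     (\<forall>p\<in>pairs Q. dependent_on D U ps (U p)) \<and>
     (\<forall>i\<in>Q. s ''u'' (int i) = gain ps i) \<and> s ''y'' 0 = int (card Q))"

lemma sum_gain: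
  assumes "finite I"
  shows "(\<Sum>i\<in>I. gain ps i) = int n * int (card {p \<in> set ps. fst p \<in> I}) - int D * int (card I)"
proof -
  have "{p \<in> set ps. fst p \<in> I} = (\<Union>i\<in>I. {p \<in> set ps. fst p = i})" by auto
  also have "card \<dots> = (\<Sum>i\<in>I. card {p \<in> set ps. fst p = i})"
    by (rule card_UN_disjoint) (use assms in auto)
  finally show ?thesis by (simp add: gain_def sum_subtractf sum_distrib_left)
qed

lemma rep_distinct: "rep ps c s \<Longrightarrow> distinct ps"
  unfolding rep_def using pivoted_distinct by blast

text \<open>The increments add up to the value of the set.\<close>
lemma objective_eq:
  assumes "rep ps c s" "Q \<subseteq> {..<n}" "set ps \<subseteq> pairs Q" "\<forall>p\<in>pairs Q. dependent_on D U ps (U p)"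
  shows "objective Q = int n * int (length ps) - int D * int (card Q)"
    "(\<Sum>i\<in>Q. gain ps i) = objective Q"
proof -
  show 1: "objective Q = int n * int (length ps) - int D * int (card Q)"
    unfolding objective_def using dim_spans[of ps c Q] assms by (auto simp: rep_def)
  have "{p \<in> set ps. fst p \<in> Q} = set ps" using assms(3) by auto
  thus "(\<Sum>i\<in>Q. gain ps i) = objective Q"
    using sum_gain[OF finite_subset[OF assms(2)], of ps] distinct_card[OF rep_distinct[OF assms(1)]]
    by (simp add: 1)
qed

lemma abs_gain_le:
  assumes "set ps \<subseteq> pairs {..<n}"
  shows "\<bar>gain ps i\<bar> \<le> int n * int D"
proof -
  have "{p \<in> set ps. fst p = i} \<subseteq> Pair i ` {..<m}" using assms by auto
  hence "card {p \<in> set ps. fst p = i} \<le> card (Pair i ` {..<m})" by (intro card_mono) auto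
  also have "\<dots> \<le> D" using m_le_D card_image_le[of "{..<m}" "Pair i"] by simp
  finally have c: "int (card {p \<in> set ps. fst p = i}) \<le> int D" by simp
  have "int n * int (card {p \<in> set ps. fst p = i}) \<le> int n * int D"
    by (rule mult_left_mono[OF c]) simp
  moreover have "1 * int D \<le> int n * int D" using n_pos by (intro mult_right_mono) auto
  moreover have "0 \<le> int n * int (card {p \<in> set ps. fst p = i})" by simp
  ultimately show ?thesis unfolding gain_def by linarith
qed

lemma processed_frame:
  assumes "processed Q s" "frame Z s t" "Z \<inter> {''r'', ''c'', ''w'', ''p'', ''u'', ''y''} = {}"
  shows "processed Q t"
proof -
  have "''u'' \<notin> Z" "''y'' \<notin> Z" using assms(3) by auto
  hence "t ''u'' = s ''u''" "t ''y'' = s ''y''" using assms(2) by (simp_all add: frame_def)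
  moreover have "rep ps c t" if "rep ps c s" for ps c by (rule rep_frame[OF that assms(2)]) (use assms(3) in auto)
  ultimately show ?thesis using assms(1) unfolding processed_def by metis
qed

lemma process_element_correct:
  assumes st: "static s" and Q: "Q \<subseteq> {..<n}" and pr: "processed Q s"
    and i: "i < n" "i \<notin> Q" "s ''i'' 0 = int i" and eq: "s ''X'' (int i) = s ''K'' 0 - s ''l'' 0"
  shows "processed (insert i Q) (sem process_element s) \<and>
    (\<forall>i'\<in>Q. sem process_element s ''u'' (int i') = s ''u'' (int i'))"
proof -
  note st' = static_simps[OF st]
  obtain ps c where ps: "rep ps c s" "set ps \<subseteq> pairs Q" "\<forall>p\<in>pairs Q. dependent_on D U ps (U p)"
    "\<forall>i\<in>Q. s ''u'' (int i) = gain ps i" "s ''y'' 0 = int (card Q)"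
    using pr by (auto simp: processed_def)
  have finQ: "finite Q" using Q by (rule finite_subset) simp
  have len: "length ps \<le> D" by (rule rep_length[OF ps(1)])
  have r: "s ''r'' 0 = int (length ps)" using ps(1) by (simp add: rep_def)
  define s1 where "s1 = upd s ''g'' 0 (int (length ps))"
  have "\<bar>int (length ps)\<bar> \<le> \<sigma> ''B'' 0" using len D_le_K by (intro small_le_B) linarith
  hence s1: "sem (SetVar ''g'' (V ''r'')) s = s1" using r by (simp add: s1_def st')
  have fr1: "frame {''g''} s s1" unfolding s1_def by (intro frame_updI frame_refl) simp
  have st1: "static s1" by (rule static_frame[OF st fr1]) (auto simp: statics_def)
  have rep1: "rep ps c s1" by (rule rep_frame[OF ps(1) fr1]) auto
  have i1: "s1 ''i'' 0 = int i" using i by (simp add: s1_def)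
  define s2 where "s2 = sem insert_element s1"
  obtain qs c' where qs: "rep (ps @ qs) c' s2" "set qs \<subseteq> {i} \<times> {..<m}"
    "\<forall>j<m. dependent_on D U (ps @ qs) (U (i, j))"
    using insert_element_correct[OF st1 rep1 i(1) i1] unfolding s2_def by blast
  have fr2: "frame (writes insert_element) s1 s2" unfolding s2_def by (rule frame_sem)
  have f2: "s2 z = s1 z" if "z \<notin> writes insert_element" for z by (rule frameD[OF fr2 that])
  have len2: "length (ps @ qs) \<le> D" by (rule rep_length[OF qs(1)])
  have dist: "distinct (ps @ qs)" by (rule rep_distinct[OF qs(1)])
  have i_ps: "{p \<in> set ps. fst p = i} = {}" using ps(2) i(2) by auto
  have "{p \<in> set (ps @ qs). fst p = i} = set qs" using i_ps qs(2) by auto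
  hence gi: "gain (ps @ qs) i = int n * int (length qs) - int D"
    using distinct_card[of qs] dist by (simp add: gain_def)
  have gQ: "gain (ps @ qs) i' = gain ps i'" if "i' \<in> Q" for i'
  proof -
    have "{p \<in> set (ps @ qs). fst p = i'} = {p \<in> set ps. fst p = i'}" using qs(2) that i(2) by auto
    thus ?thesis by (simp add: gain_def)
  qed
  define s3 where "s3 = upd s2 ''u'' (int i) (gain (ps @ qs) i)"
  have "\<bar>gain (ps @ qs) i\<bar> \<le> \<sigma> ''B'' 0"
  proof (rule small_le_B)
    have "set (ps @ qs) \<subseteq> pairs {..<n}" using ps(2) qs(2) Q i(1) by auto
    from abs_gain_le[OF this, of i] show "\<bar>gain (ps @ qs) i\<bar> \<le> 2 * \<sigma> ''K'' 0 + 2"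
      using nD_le_K K_pos by linarith
  qed
  hence s3: "sem (Asg ''u'' (V ''i'') (Sub (Mul (V ''n'') (Sub (V ''r'') (V ''g''))) (V ''D''))) s2 = s3"
    using qs(1) i by (simp add: f2 writes_insert_element s1_def st' s3_def gi rep_def)
  define s4 where "s4 = upd s3 ''y'' 0 (int (card Q) + 1)"
  have "card Q \<le> n" using card_mono[OF _ Q] by simp
  hence "\<bar>int (card Q) + 1\<bar> \<le> \<sigma> ''B'' 0" using n_le_K K_pos by (intro small_le_B) linarith
  hence s4: "sem (SetVar ''y'' (Add (V ''y'') (Lit 1))) s3 = s4"
    using ps(5) by (simp add: s4_def s3_def f2 writes_insert_element s1_def st')
  have sem: "sem process_element s = s4"
    using eq i by (simp only: process_element_def sem.simps(3,4) bval.simps aval.simps s1 s2_def[symmetric] s3 s4 if_True simp_thms)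
  have "rep (ps @ qs) c' s4"
    by (rule rep_frame[OF qs(1), of "{''u'', ''y''}"]) (auto simp: s4_def s3_def intro!: frame_updI)
  moreover have "set (ps @ qs) \<subseteq> pairs (insert i Q)" using ps(2) qs(2) by auto
  moreover have "\<forall>p\<in>pairs (insert i Q). dependent_on D U (ps @ qs) (U p)"
  proof
    fix p assume "p \<in> pairs (insert i Q)"
    then consider "p \<in> pairs Q" | j where "j < m" "p = (i, j)" by auto
    thus "dependent_on D U (ps @ qs) (U p)"
    proof cases
      case 1
      show ?thesis by (rule dependent_on_append) (use ps(3) 1 in blast)
    qed (use qs(3) in simp)
  qed
  moreover have u: "s4 ''u'' (int i') = gain (ps @ qs) i'" if "i' \<in> insert i Q" for i'
    using that i(2) ps(4) gQ by (auto simp: s4_def s3_def f2 writes_insert_element s1_def)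
  moreover have "s4 ''y'' 0 = int (card (insert i Q))" using i(2) finQ by (simp add: s4_def)
  ultimately have "processed (insert i Q) s4" unfolding processed_def by blast
  moreover have "\<forall>i'\<in>Q. s4 ''u'' (int i') = s ''u'' (int i')" using u gQ ps(4) by simp
  ultimately show ?thesis unfolding sem by blast
qed

text \<open>The empty set, of value 0, is the first candidate, whence the bound by 0.\<close>
definition best_so_far :: "mem \<Rightarrow> bool" where
  "best_so_far s \<longleftrightarrow> (\<exists>S\<subseteq>{..<n}. (\<forall>i<n. s ''S'' (int i) = (if i \<in> S then 1 else 0)) \<and>
     s ''A'' 0 = objective S \<and> objective S \<le> 0)"

lemma best_so_far_frame:
  assumes "best_so_far s" "frame Z s t" "''S'' \<notin> Z" "''A'' \<notin> Z"
  shows "best_so_far t"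
proof -
  have "t ''S'' = s ''S''" "t ''A'' = s ''A''" using assms by (simp_all add: frame_def)
  thus ?thesis using assms(1) unfolding best_so_far_def by simp
qed

lemma best_so_far_start:
  assumes "\<And>i. s ''S'' i = 0" "s ''A'' 0 = 0"
  shows "best_so_far s"
proof -
  have "objective {} = 0" using dim_spans[of "[]" undefined "{}"] by (simp add: objective_def)
  thus ?thesis unfolding best_so_far_def using assms by (intro exI[of _ "{}"]) simp
qed

lemma abs_objective_le:
  assumes "rep ps c s" "Q \<subseteq> {..<n}" "set ps \<subseteq> pairs Q" "\<forall>p\<in>pairs Q. dependent_on D U ps (U p)"
  shows "\<bar>objective Q\<bar> \<le> int n * int D"
proof -
  have "card Q \<le> n" using card_mono[OF _ assms(2)] by simp
  hence "int D * int (card Q) \<le> int D * int n" by (intro mult_left_mono) auto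
  moreover have "int n * int (length ps) \<le> int n * int D"
    using rep_length[OF assms(1)] by (intro mult_left_mono) auto
  moreover have "0 \<le> int D * int (card Q)" "0 \<le> int n * int (length ps)" by simp_all
  ultimately show ?thesis unfolding objective_eq(1)[OF assms]
    using mult.commute[of "int D" "int n"] by linarith
qed

lemma record_level_correct:
  assumes st: "static s" and x: "\<And>i. i < n \<Longrightarrow> s ''X'' (int i) = x i"
  shows "\<forall>i<n. sem record_level s ''S'' (int i) = (if x i < s ''K'' 0 - s ''l'' 0 then 0 else 1)"
proof -
  note st' = static_simps[OF st]
  let ?v = "\<lambda>i. if x i < s ''K'' 0 - s ''l'' 0 then 0 else 1 :: int"
  let ?I = "\<lambda>k t. frame {''i'', ''S''} s t \<and> (\<forall>i<k. t ''S'' (int i) = ?v i)"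
  have "?I n (sem record_level s)"
    unfolding record_level_def
  proof (rule sem_For_invariant[where I = ?I and s = s and y = "''n''"])
    show "n = nat (min (s ''n'' 0) (s ''L'' 0))" using caps(2) by (simp add: st')
    show "?I 0 (upd s ''i'' 0 0)" by (auto intro: frame_updI)
    fix k t assume k: "k < n" and I: "?I k t" and i: "t ''i'' 0 = int k"
    have f: "t z = s z" if "z \<notin> {''i'', ''S''}" for z using I that by (simp add: frame_def)
    have "sem (If (Less (Read ''X'' (V ''i'')) (Sub (V ''K'') (V ''l'')))
        (Asg ''S'' (V ''i'') (Lit 0)) (Asg ''S'' (V ''i'') (Lit 1))) t = upd t ''S'' (int k) (?v k)" (is "?s = _")
      using x[OF k] i B_ge_1 by (simp add: f st')
    thus "?I (Suc k) (upd ?s ''i'' 0 (int (Suc k)))"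
      using I by (auto intro!: frame_updI simp: less_Suc_eq)
  qed
  thus ?thesis by blast
qed

text \<open>The levels above the current one have been processed, and their entries of the subgradient are
  not changed any more.\<close>
lemma process_level_correct:
  assumes st: "static s" and x: "\<And>i. i < n \<Longrightarrow> s ''X'' (int i) = x i"
    and pr: "processed {i. i < n \<and> x i > s ''K'' 0 - int l} s"
    and l: "s ''l'' 0 = int l" and best: "best_so_far s"
  defines "s' \<equiv> sem process_level s" and "Q \<equiv> {i. i < n \<and> x i \<ge> s ''K'' 0 - int l}"
  shows "processed Q s'" "best_so_far s'" "s' ''A'' 0 \<le> s ''A'' 0"
    "s' ''A'' 0 \<le> (\<Sum>i\<in>Q. s' ''u'' (int i))"
    "\<And>i. i < n \<Longrightarrow> x i > s ''K'' 0 - int l \<Longrightarrow> s' ''u'' (int i) = s ''u'' (int i)"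
proof -
  note st' = static_simps[OF st]
  \<comment> \<open>The set of processed indices after the first \<open>k\<close> indices of this level.\<close>
  let ?Q = "\<lambda>k. {i. i < n \<and> x i > s ''K'' 0 - int l} \<union> {i. i < k \<and> x i = s ''K'' 0 - int l}"
  let ?W = "insert ''i'' (writes process_element)"
  let ?I = "\<lambda>k t. frame ?W s t \<and> processed (?Q k) t \<and>
    (\<forall>i. i < n \<longrightarrow> x i > s ''K'' 0 - int l \<longrightarrow> t ''u'' (int i) = s ''u'' (int i))"
  define s1 where "s1 = sem (For ''i'' ''n'' process_element) s"
  have 1: "?I n s1"
    unfolding s1_def
  proof (rule sem_For_invariant[where I = ?I and s = s and y = "''n''"])
    show "n = nat (min (s ''n'' 0) (s ''L'' 0))" using caps(2) by (simp add: st')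
    have "processed {i. i < n \<and> x i > s ''K'' 0 - int l} (upd s ''i'' 0 0)"
      by (rule processed_frame[OF pr frame_updI[OF frame_refl], of "''i''" "{''i''}"]) auto
    thus "?I 0 (upd s ''i'' 0 0)" by (auto intro!: frame_updI)
    fix k t assume k: "k < n" and I: "?I k t" and i: "t ''i'' 0 = int k"
    have fr: "frame ?W s t" and prt: "processed (?Q k) t" using I by blast+
    have f: "t z = s z" if "z \<notin> ?W" for z by (rule frameD[OF fr that])
    have stt: "static t" by (rule static_frame[OF st fr]) (auto simp: writes_process_element statics_def)
    have tx: "t ''X'' (int k) = x k" "t ''K'' 0 = s ''K'' 0" "t ''l'' 0 = int l"
      using x[OF k] l by (simp_all add: f writes_process_element)
    let ?t = "sem process_element t"
    have frame': "frame ?W s (upd ?t ''i'' 0 (int (Suc k)))"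
      by (rule frame_updI[OF frame_trans[OF fr frame_mono[OF frame_sem]]]) auto
    have "processed (?Q (Suc k)) ?t \<and>
        (\<forall>i. i < n \<longrightarrow> x i > s ''K'' 0 - int l \<longrightarrow> ?t ''u'' (int i) = s ''u'' (int i))"
    proof (cases "x k = s ''K'' 0 - int l")
      case True
      have "?Q k \<subseteq> {..<n}" "k \<notin> ?Q k" using k True by auto
      moreover have "t ''X'' (int k) = t ''K'' 0 - t ''l'' 0" using tx True by simp
      ultimately have "processed (insert k (?Q k)) ?t \<and> (\<forall>i'\<in>?Q k. ?t ''u'' (int i') = t ''u'' (int i'))"
        using process_element_correct[OF stt _ prt k _ i] by blast
      moreover have "insert k (?Q k) = ?Q (Suc k)" using True by (auto simp: less_Suc_eq)
      ultimately show ?thesis using I by auto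
    next
      case False
      hence "?t = t" using i tx by (simp add: process_element_def)
      moreover have "?Q (Suc k) = ?Q k" using False by (auto simp: less_Suc_eq)
      ultimately show ?thesis using I by simp
    qed
    moreover have "processed (?Q (Suc k)) (upd ?t ''i'' 0 (int (Suc k)))" if "processed (?Q (Suc k)) ?t"
      by (rule processed_frame[OF that frame_updI[OF frame_refl], of "''i''" "{''i''}"]) auto
    ultimately show "?I (Suc k) (upd ?t ''i'' 0 (int (Suc k)))" using frame' by (simp del: of_nat_Suc)
  qed
  have Qn: "?Q n = Q" unfolding Q_def by auto
  have Qsub: "Q \<subseteq> {..<n}" unfolding Q_def by auto
  have fr1: "frame ?W s s1" and pr1: "processed Q s1" using 1 unfolding Qn by blast+
  have f1: "s1 z = s z" if "z \<notin> ?W" for z by (rule frameD[OF fr1 that])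
  obtain ps c where ps: "rep ps c s1" "set ps \<subseteq> pairs Q" "\<forall>p\<in>pairs Q. dependent_on D U ps (U p)"
    "\<forall>i\<in>Q. s1 ''u'' (int i) = gain ps i" "s1 ''y'' 0 = int (card Q)"
    using pr1 by (auto simp: processed_def)
  note obj = objective_eq[OF ps(1) Qsub ps(2,3)]
  define s2 where "s2 = upd s1 ''t'' 0 (objective Q)"
  have "\<bar>objective Q\<bar> \<le> \<sigma> ''B'' 0"
    using abs_objective_le[OF ps(1) Qsub ps(2,3)] nD_le_K K_pos by (intro small_le_B) linarith
  hence s2: "sem (SetVar ''t'' (Sub (Mul (V ''n'') (V ''r'')) (Mul (V ''D'') (V ''y'')))) s1 = s2"
    using ps(1,5) by (simp add: s2_def f1 writes_process_element st' rep_def obj(1))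
  have A1: "s2 ''A'' 0 = s ''A'' 0" by (simp add: s2_def f1 writes_process_element)
  have s': "s' = (if objective Q < s ''A'' 0 then sem record_level (upd s2 ''A'' 0 (objective Q)) else s2)"
    using A1 \<open>\<bar>objective Q\<bar> \<le> \<sigma> ''B'' 0\<close>
    unfolding s'_def process_level_def sem.simps(3) s1_def[symmetric] s2
    by (simp add: s2_def f1 writes_process_element st')
  have fr': "frame {''t'', ''A'', ''i'', ''S''} s1 s'"
  proof (cases "objective Q < s ''A'' 0")
    case True
    have 2: "frame {''t'', ''A'', ''i'', ''S''} s1 (upd s2 ''A'' 0 (objective Q))"
      unfolding s2_def by (auto intro!: frame_updI)
    have 3: "frame {''t'', ''A'', ''i'', ''S''} (upd s2 ''A'' 0 (objective Q)) (sem record_level (upd s2 ''A'' 0 (objective Q)))"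
      by (rule frame_mono[OF frame_sem]) (auto simp: writes_record_level)
    show ?thesis unfolding s' if_P[OF True] by (rule frame_trans[OF 2 3])
  next
    case False
    thus ?thesis unfolding s' s2_def by (auto intro!: frame_updI)
  qed
  show "processed Q s'" by (rule processed_frame[OF pr1 fr']) auto
  have u': "s' ''u'' = s1 ''u''" using frameD[OF fr', of "''u''"] by simp
  show "\<And>i. i < n \<Longrightarrow> x i > s ''K'' 0 - int l \<Longrightarrow> s' ''u'' (int i) = s ''u'' (int i)"
    using 1 unfolding u' by blast
  have sum: "(\<Sum>i\<in>Q. s' ''u'' (int i)) = objective Q" using ps(4) obj(2) unfolding u' by simp
  have "s' ''A'' 0 \<le> s ''A'' 0 \<and> s' ''A'' 0 \<le> objective Q \<and> best_so_far s'"
  proof (cases "objective Q < s ''A'' 0")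
    case True
    let ?s = "upd s2 ''A'' 0 (objective Q)"
    have fs: "frame (insert ''A'' (insert ''t'' ?W)) s ?s"
      unfolding s2_def by (intro frame_updI frame_mono[OF fr1]) blast+
    have sts: "static ?s" by (rule static_frame[OF st fs]) (simp add: writes_process_element statics_def)
    have "?s ''X'' (int i) = x i" if "i < n" for i using x[OF that] frameD[OF fs, of "''X''"] by (simp add: writes_process_element)
    from record_level_correct[OF sts this]
    have S: "sem record_level ?s ''S'' (int i) = (if x i < ?s ''K'' 0 - ?s ''l'' 0 then 0 else 1)" if "i < n" for i
      using that by blast
    have Kl: "?s ''K'' 0 = s ''K'' 0" "?s ''l'' 0 = int l"
      using frameD[OF fs, of "''K''"] frameD[OF fs, of "''l''"] l by (simp_all add: writes_process_element)
    have "s' ''S'' (int i) = (if i \<in> Q then 1 else 0)" if "i < n" for i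
      unfolding s' using True that S[OF that, unfolded Kl] by (simp add: Q_def)
    moreover have A': "s' ''A'' 0 = objective Q"
      unfolding s' using True frameD[OF frame_sem, of "''A''" record_level ?s] by (simp add: writes_record_level)
    moreover have "s ''A'' 0 \<le> 0" using best by (auto simp: best_so_far_def)
    ultimately have "best_so_far s'" unfolding best_so_far_def using True Qsub by (intro exI[of _ Q]) auto
    thus ?thesis using A' True by simp
  next
    case False
    hence "s' = s2" unfolding s' by simp
    moreover have "best_so_far s2"
      by (rule best_so_far_frame[OF best, of "insert ''t'' ?W"])
        (simp_all add: s2_def frame_updI frame_mono[OF fr1] writes_process_element)
    ultimately show ?thesis using A1 False by simp
  qed
  thus "best_so_far s'" "s' ''A'' 0 \<le> s ''A'' 0" "s' ''A'' 0 \<le> (\<Sum>i\<in>Q. s' ''u'' (int i))"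
    unfolding sum by simp_all
qed

end

section \<open>Minimisation by subgradient descent\<close>

context machine
begin

text \<open>The inliers, numbered from 0.\<close>
definition members :: "(nat \<Rightarrow> real vec set) \<Rightarrow> nat set" where
  "members T = {i. i < n \<and> Suc i \<in> inliers n m X T}"

lemma card_members: "card (members T) = card (inliers n m X T)"
proof -
  have "inliers n m X T = Suc ` members T"
  proof (intro equalityI subsetI)
    fix i assume i: "i \<in> inliers n m X T"
    hence "1 \<le> i" "i \<le> n" by (auto simp: inliers_def)
    thus "i \<in> Suc ` members T" using i by (intro image_eqI[of _ _ "i - 1"]) (auto simp: members_def)
  qed (auto simp: members_def)
  thus ?thesis by (simp add: card_image)
qed

text \<open>The subgradient inequality: the modular function given by the increments lies below the defect
  of every tuple of subspaces.\<close>
lemma sum_gain_members_le: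
  assumes "rep ps c s" "set ps \<subseteq> pairs {..<n}" "subspaces T"
  shows "(\<Sum>i\<in>members T. gain ps i) \<le> defect T"
proof -
  have "finite (members T)" by (simp add: members_def)
  moreover have "int n * int (card {p \<in> set ps. fst p \<in> members T})
      \<le> int n * (\<Sum>j = 1..m. int (subspace_dim (d j) (T j)))"
    using chosen_le_dim[of ps c T] assms unfolding members_def rep_def
    by (intro mult_left_mono) (auto simp flip: of_nat_sum)
  ultimately show ?thesis by (simp add: sum_gain defect_def card_members)
qed

lemma reset_rows_correct:
  assumes st: "static s"
  shows "processed {} (sem reset_rows s)" "frame {''r'', ''p'', ''y''} s (sem reset_rows s)"
    "rep [] c (sem reset_rows s)"
proof -
  note st' = static_simps[OF st]
  have sem: "sem reset_rows s = upd (upd (upd s ''r'' 0 0) ''p'' 0 1) ''y'' 0 0"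
    using B_ge_1 by (simp add: reset_rows_def st')
  show rep: "rep [] c (sem reset_rows s)" for c unfolding sem by (simp add: rep_def)
  show "processed {} (sem reset_rows s)"
    unfolding processed_def using rep[of undefined] by (intro exI[of _ "[]"] exI[of _ undefined]) (simp add: sem)
  show "frame {''r'', ''p'', ''y''} s (sem reset_rows s)" unfolding sem by (intro frame_updI frame_refl) auto
qed

text \<open>The properties of the subgradient \<open>w\<close> and of the best value that \<open>potential_step\<close> requires. The
  level sets for all thresholds have been candidates, and
  the entries of \<open>w\<close> do not change after their level.\<close>
lemma scan_levels_correct:
  assumes st: "static s" and x_all: "\<forall>i<n. s ''X'' (int i) = x i \<and> 0 \<le> x i \<and> x i \<le> \<sigma> ''K'' 0"
    and best: "best_so_far s"
  defines "s' \<equiv> sem scan_levels s" and "w \<equiv> \<lambda>i. sem scan_levels s ''u'' (int i)"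
  shows "best_so_far s'" "s' ''A'' 0 \<le> s ''A'' 0"
    "\<And>i. i < n \<Longrightarrow> \<bar>w i\<bar> \<le> int n * int D"
    "\<And>\<theta>. 1 \<le> \<theta> \<Longrightarrow> \<theta> \<le> \<sigma> ''K'' 0 \<Longrightarrow> s' ''A'' 0 \<le> (\<Sum>i | i < n \<and> x i \<ge> \<theta>. w i)"
    "\<And>T. subspaces T \<Longrightarrow> (\<Sum>i\<in>members T. w i) \<le> defect T"
proof -
  note st' = static_simps[OF st] and x = x_all[rule_format]
  define K where "K = \<sigma> ''K'' 0"
  define s0 where "s0 = sem reset_rows s"
  note reset = reset_rows_correct[OF st, folded s0_def]
  have f0: "s0 z = s z" if "z \<notin> {''r'', ''p'', ''y''}" for z by (rule frameD[OF reset(2) that])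
  let ?W = "writes scan_levels"
  let ?I = "\<lambda>k t. frame ?W s t \<and> processed {i. i < n \<and> x i > K - int k} t \<and> best_so_far t \<and>
    t ''A'' 0 \<le> s ''A'' 0 \<and> (\<forall>l<k. t ''A'' 0 \<le> (\<Sum>i | i < n \<and> x i \<ge> K - int l. t ''u'' (int i)))"
  have "?I (nat K + 1) (sem (For ''l'' ''k'' process_level) s0)"
  proof (rule sem_For_invariant[where I = ?I and s = s0 and y = "''k''"])
    show "nat K + 1 = nat (min (s0 ''k'' 0) (s0 ''L'' 0))"
      using caps(5) K_pos by (simp add: f0 st' K_def)
    have e: "{i. i < n \<and> x i > K - int 0} = {}"
    proof -
      have "\<forall>i<n. x i \<le> K" using x by (simp add: K_def)
      thus ?thesis by (auto simp: not_less)
    qed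
    have b: "best_so_far (upd s0 ''l'' 0 0)"
      by (rule best_so_far_frame[OF best, of "{''r'', ''p'', ''y'', ''l''}"])
        (auto intro!: frame_updI frame_mono[OF reset(2)])
    have "processed {} (upd s0 ''l'' 0 0)"
      by (rule processed_frame[OF reset(1) frame_updI[OF frame_refl], of "''l''" "{''l''}"]) auto
    moreover have "frame ?W s (upd s0 ''l'' 0 0)"
      by (intro frame_updI frame_mono[OF reset(2)]) (auto simp: writes_scan_levels)
    ultimately show "?I 0 (upd s0 ''l'' 0 0)" unfolding e using b by (simp add: f0)
    fix l t assume l: "l < nat K + 1" and I: "?I l t" and tl: "t ''l'' 0 = int l"
    have fr: "frame ?W s t" and pr: "processed {i. i < n \<and> x i > K - int l} t" and bt: "best_so_far t"
      and A: "t ''A'' 0 \<le> s ''A'' 0" and Al: "\<And>l'. l' < l \<Longrightarrow> t ''A'' 0 \<le> (\<Sum>i | i < n \<and> x i \<ge> K - int l'. t ''u'' (int i))"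
      using I by blast+
    have stt: "static t" by (rule static_frame[OF st fr]) (simp add: writes_scan_levels statics_def)
    have tx: "t ''X'' (int i) = x i" if "i < n" for i
      using x[OF that] frameD[OF fr, of "''X''"] by (simp add: writes_scan_levels)
    have tK: "t ''K'' 0 = K" using static_simps[OF stt] by (simp add: K_def)
    let ?t = "sem process_level t"
    note level = process_level_correct[OF stt tx, unfolded tK, OF _ pr tl bt, simplified]
    \<comment> \<open>Processed at the end of level \<open>l\<close> means above level \<open>Suc l\<close>.\<close>
    have eq: "{i. i < n \<and> x i > K - int (Suc l)} = {i. i < n \<and> x i \<ge> K - int l}" by auto
    let ?u = "upd ?t ''l'' 0 (int (Suc l))"
    have fu: "frame {''l''} ?t ?u" by (intro frame_updI frame_refl) simp
    have 1: "processed {i. i < n \<and> x i > K - int (Suc l)} ?u"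
      unfolding eq by (rule processed_frame[OF level(1) fu]) auto
    have 2: "best_so_far ?u" by (rule best_so_far_frame[OF level(2) fu]) auto
    have 3: "?u ''A'' 0 = ?t ''A'' 0" "?u ''u'' = ?t ''u''" by simp_all
    have 4: "?t ''A'' 0 \<le> (\<Sum>i | i < n \<and> x i \<ge> K - int l'. ?t ''u'' (int i))" if "l' < Suc l" for l'
    proof (cases "l' = l")
      case True
      thus ?thesis using level(4) by simp
    next
      case False
      hence l': "l' < l" using that by simp
      have "(\<Sum>i | i < n \<and> x i \<ge> K - int l'. ?t ''u'' (int i)) = (\<Sum>i | i < n \<and> x i \<ge> K - int l'. t ''u'' (int i))"
        by (rule sum.cong) (use level(5) l' in auto)
      thus ?thesis using Al[OF l'] level(3) by simp
    qed
    have 5: "frame ?W s ?u"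
      by (rule frame_updI[OF frame_trans[OF fr frame_mono[OF frame_sem]]]) (auto simp: scan_levels_def)
    show "?I (Suc l) ?u" using 1 2 4 5 A level(3) unfolding 3 by (simp del: of_nat_Suc)
  qed
  hence I: "?I (nat K + 1) s'"
    unfolding s'_def scan_levels_def sem.simps(3) s0_def .
  have all: "{i. i < n \<and> x i > K - int (nat K + 1)} = {..<n}" using x K_pos by (auto simp: K_def less_le_trans[of "-1" 0])
  have "processed {..<n} s'" using I unfolding all by blast
  then obtain ps c where ps: "rep ps c s'" "set ps \<subseteq> pairs {..<n}" "\<forall>i\<in>{..<n}. s' ''u'' (int i) = gain ps i"
    by (auto simp: processed_def)
  have w: "w i = gain ps i" if "i < n" for i using ps(3) that by (simp add: w_def s'_def)
  show "best_so_far s'" "s' ''A'' 0 \<le> s ''A'' 0" using I by blast+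
  show "\<bar>w i\<bar> \<le> int n * int D" if "i < n" for i using abs_gain_le[OF ps(2)] w[OF that] by simp
  show "s' ''A'' 0 \<le> (\<Sum>i | i < n \<and> x i \<ge> \<theta>. w i)" if "1 \<le> \<theta>" "\<theta> \<le> \<sigma> ''K'' 0" for \<theta>
  proof -
    \<comment> \<open>The threshold \<open>\<theta>\<close> belongs to level \<open>K - \<theta>\<close>.\<close>
    have \<theta>: "nat (K - \<theta>) < nat K + 1" "K - int (nat (K - \<theta>)) = \<theta>" using that by (auto simp: K_def)
    have "\<forall>l<nat K + 1. s' ''A'' 0 \<le> (\<Sum>i | i < n \<and> x i \<ge> K - int l. s' ''u'' (int i))" using I by blast
    from this[rule_format, OF \<theta>(1)] show ?thesis unfolding \<theta>(2) by (simp add: w_def s'_def)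
  qed
  show "(\<Sum>i\<in>members T. w i) \<le> defect T" if "subspaces T" for T
  proof -
    have "(\<Sum>i\<in>members T. w i) = (\<Sum>i\<in>members T. gain ps i)"
      by (rule sum.cong) (use w in \<open>auto simp: members_def\<close>)
    thus ?thesis using sum_gain_members_le[OF ps(1,2) that] by simp
  qed
qed

lemma update_point_correct:
  assumes st: "static s" and x_all: "\<forall>i<n. s ''X'' (int i) = x i \<and> 0 \<le> x i \<and> x i \<le> \<sigma> ''K'' 0"
    and w_all: "\<forall>i<n. s ''u'' (int i) = w i \<and> \<bar>w i\<bar> \<le> int n * int D"
  shows "\<forall>i<n. sem update_point s ''X'' (int i) = max 0 (min (\<sigma> ''K'' 0) (x i - w i))"
proof -
  note st' = static_simps[OF st] and x = x_all[rule_format] and w = w_all[rule_format]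
  let ?body = "Sq (SetVar ''t'' (Sub (Read ''X'' (V ''i'')) (Read ''u'' (V ''i''))))
         (If (Less (V ''t'') (Lit 0)) (Asg ''X'' (V ''i'') (Lit 0))
         (If (Less (V ''K'') (V ''t'')) (Asg ''X'' (V ''i'') (V ''K'')) (Asg ''X'' (V ''i'') (V ''t''))))"
  let ?v = "\<lambda>i. max 0 (min (\<sigma> ''K'' 0) (x i - w i))"
  let ?I = "\<lambda>k t. frame {''i'', ''t'', ''X''} s t \<and> (\<forall>i<n. t ''X'' (int i) = (if i < k then ?v i else x i))"
  have "?I n (sem update_point s)"
    unfolding update_point_def
  proof (rule sem_For_invariant[where I = ?I and s = s and y = "''n''"])
    show "n = nat (min (s ''n'' 0) (s ''L'' 0))" using caps(2) by (simp add: st')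
    show "?I 0 (upd s ''i'' 0 0)" using x by (auto intro: frame_updI)
    fix k t assume k: "k < n" and I: "?I k t" and i: "t ''i'' 0 = int k"
    have f: "t z = s z" if "z \<notin> {''i'', ''t'', ''X''}" for z using I that by (simp add: frame_def)
    have tX: "t ''X'' (int k) = x k" using I k by simp
    have "\<bar>x k - w k\<bar> \<le> 2 * \<sigma> ''K'' 0 + 2" using x[OF k] w[OF k] nD_le_K K_pos by linarith
    hence "\<bar>x k - w k\<bar> \<le> \<sigma> ''B'' 0" by (rule small_le_B)
    moreover have "\<bar>\<sigma> ''K'' 0\<bar> \<le> \<sigma> ''B'' 0" by (rule small_le_B) (use K_pos in simp)
    ultimately have "sem ?body t = upd (upd t ''t'' 0 (x k - w k)) ''X'' (int k) (?v k)"
      using i tX w[OF k] B_ge_1 K_pos by (auto simp add: f st')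
    thus "?I (Suc k) (upd (sem ?body t) ''i'' 0 (int (Suc k)))"
      using I k by (auto intro!: frame_updI simp: less_Suc_eq)
  qed
  thus ?thesis by simp
qed

text \<open>For each \<open>T\<close> separately, either the best value is already at most its defect or every step so far
  has reduced the potential of \<open>T\<close> by \<open>K\<close>. The program does not know \<open>T\<close>, but the potential occurs
  only in the invariant.\<close>
lemma descent_correct:
  assumes st: "static s" and start: "\<And>i. s ''X'' i = 0" "\<And>i. s ''S'' i = 0" "s ''A'' 0 = 0"
  shows "best_so_far (sem descent s)" "\<And>T. subspaces T \<Longrightarrow> sem descent s ''A'' 0 \<le> defect T"
proof -
  note st' = static_simps[OF st]
  define K where "K = \<sigma> ''K'' 0"
  \<comment> \<open>\<open>n * D\<close> bounds the entries of the subgradient.\<close>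
  have K: "K = int n * (int n * int D)\<^sup>2"
    unfolding K_def \<sigma>_scalars by (simp add: power2_eq_square power3_eq_cube ac_simps)
  let ?W = "writes descent"
  let ?I = "\<lambda>k t. frame ?W s t \<and> best_so_far t \<and> (\<exists>x. (\<forall>i<n. t ''X'' (int i) = x i \<and> 0 \<le> x i \<and> x i \<le> K) \<and>
    (\<forall>T. subspaces T \<longrightarrow> t ''A'' 0 \<le> defect T \<or> potential n K (members T) x + int k * K \<le> int n * K\<^sup>2))"
  let ?N = "nat (int n * K + 1)"
  have "?I ?N (sem (For ''s'' ''T'' (Sq scan_levels update_point)) s)"
  proof (rule sem_For_invariant[where I = ?I and s = s and y = "''T''"])
    show "?N = nat (min (s ''T'' 0) (s ''L'' 0))" using caps(6) by (simp add: st' K_def)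
    have b: "best_so_far (upd s ''s'' 0 0)" by (rule best_so_far_start) (use start in auto)
    have "potential n K (members T) (\<lambda>_. 0) + int 0 * K \<le> int n * K\<^sup>2" for T
      using potential_start[of K n "members T"] K_pos by (simp add: K_def)
    hence "\<exists>x. (\<forall>i<n. upd s ''s'' 0 0 ''X'' (int i) = x i \<and> 0 \<le> x i \<and> x i \<le> K) \<and>
        (\<forall>T. subspaces T \<longrightarrow> upd s ''s'' 0 0 ''A'' 0 \<le> defect T
          \<or> potential n K (members T) x + int 0 * K \<le> int n * K\<^sup>2)"
      using start K_pos by (intro exI[of _ "\<lambda>_. 0"]) (auto simp: K_def)
    moreover have "frame ?W s (upd s ''s'' 0 0)" by (intro frame_updI frame_refl) (simp add: descent_def)
    ultimately show "?I 0 (upd s ''s'' 0 0)" using b by blast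
    fix k t assume k: "k < ?N" and I: "?I k t"
    then obtain x where fr: "frame ?W s t" and bt: "best_so_far t"
      and x: "\<And>i. i < n \<Longrightarrow> t ''X'' (int i) = x i \<and> 0 \<le> x i \<and> x i \<le> K"
      and pot: "\<And>T. subspaces T \<Longrightarrow> t ''A'' 0 \<le> defect T \<or> potential n K (members T) x + int k * K \<le> int n * K\<^sup>2"
      by blast
    have stt: "static t"
      by (rule static_frame[OF st fr]) (simp add: descent_def writes_scan_levels writes_update_point statics_def)
    define u where "u = sem scan_levels t"
    define w where "w i = u ''u'' (int i)" for i
    have "\<forall>i<n. t ''X'' (int i) = x i \<and> 0 \<le> x i \<and> x i \<le> \<sigma> ''K'' 0" using x by (simp add: K_def)
    note scan = scan_levels_correct[OF stt this bt, folded u_def w_def K_def]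
    have fu: "frame (writes scan_levels) t u" unfolding u_def by (rule frame_sem)
    have stu: "static u" by (rule static_frame[OF stt fu]) (simp add: writes_scan_levels statics_def)
    have ux: "u ''X'' (int i) = x i \<and> 0 \<le> x i \<and> x i \<le> \<sigma> ''K'' 0" if "i < n" for i
      using x[OF that] frameD[OF fu, of "''X''"] by (simp add: writes_scan_levels K_def)
    have uw: "u ''u'' (int i) = w i \<and> \<bar>w i\<bar> \<le> int n * int D" if "i < n" for i
      using scan(3)[OF that] by (simp add: w_def)
    let ?x = "\<lambda>i. max 0 (min K (x i - w i))"
    let ?t = "sem (Sq scan_levels update_point) t"
    have t': "?t = sem update_point u" by (simp add: u_def)
    have fu': "frame {''i'', ''t'', ''X'', ''s''} u (upd ?t ''s'' 0 (int (Suc k)))"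
      unfolding t' by (rule frame_updI[OF frame_mono[OF frame_sem]]) (auto simp: writes_update_point)
    have X': "upd ?t ''s'' 0 (int (Suc k)) ''X'' (int i) = ?x i \<and> 0 \<le> ?x i \<and> ?x i \<le> K" if "i < n" for i
      unfolding t' using update_point_correct[OF stu, of x w] ux uw that K_pos by (simp add: K_def)
    have A': "upd ?t ''s'' 0 (int (Suc k)) ''A'' 0 = u ''A'' 0" using frameD[OF fu', of "''A''"] by simp
    have P': "u ''A'' 0 \<le> defect T \<or> potential n K (members T) ?x + int (Suc k) * K \<le> int n * K\<^sup>2"
      if T: "subspaces T" for T
    (* The best value never increases, so the first alternative is preserved. *)
    proof (cases "u ''A'' 0 \<le> defect T")
      case False
      hence "\<not> t ''A'' 0 \<le> defect T" using scan(2) by simp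
      hence "potential n K (members T) x + int k * K \<le> int n * K\<^sup>2" using pot[OF T] by blast
      moreover have "potential n K (members T) ?x + K \<le> potential n K (members T) x"
      proof (rule potential_step[OF K, of x w "u ''A'' 0" _ "defect T"])
        show "members T \<subseteq> {..<n}" by (auto simp: members_def)
        show "sum w (members T) \<le> defect T" using scan(5)[OF T] by (simp add: w_def)
      qed (use x uw scan(4) False in auto)
      ultimately show ?thesis by (simp add: algebra_simps)
    qed simp
    have "best_so_far (upd ?t ''s'' 0 (int (Suc k)))" by (rule best_so_far_frame[OF scan(1) fu']) auto
    moreover have "frame ?W s (upd ?t ''s'' 0 (int (Suc k)))"
      by (rule frame_updI[OF frame_trans[OF fr frame_mono[OF frame_sem]]]) (auto simp: descent_def)
    ultimately show "?I (Suc k) (upd ?t ''s'' 0 (int (Suc k)))"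
      unfolding A' using X' P' by (intro conjI exI[of _ ?x] allI impI) blast+
  qed
  hence I: "?I ?N (sem descent s)" unfolding descent_def .
  show "best_so_far (sem descent s)" using I by blast
  show "sem descent s ''A'' 0 \<le> defect T" if T: "subspaces T" for T
  proof (rule ccontr)
    assume "\<not> sem descent s ''A'' 0 \<le> defect T"
    then obtain x where "potential n K (members T) x + int ?N * K \<le> int n * K\<^sup>2" using I T by blast
    moreover have "int ?N = int n * K + 1" using K_pos by (simp add: K_def)
    (* The number of steps exceeds \<open>n * K\<close>, which would make the potential negative. *)
    moreover have "(int n * K + 1) * K = int n * K\<^sup>2 + K" by (simp add: algebra_simps power2_eq_square)
    moreover have "potential n K (members T) x \<ge> 0" by (rule potential_nonneg)
    ultimately show False using K_pos by (simp add: K_def)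
  qed
qed

end

section \<open>Writing the answer\<close>

text \<open>The cell 0 of the output holds its length.\<close>
definition append_out :: "aexp \<Rightarrow> prog" where
  "append_out e = Sq (SetVar ''output'' (Add (V ''output'') (Lit 1))) (Asg ''output'' (V ''output'') e)"

text \<open>For the fixed block \<open>j\<close>, mark in \<open>''F''\<close> the indices of the best set whose vectors are accepted. Their
  number has to be written before the vectors, so the marks are set in a first pass.\<close>
definition select_basis :: prog where
  "select_basis = For ''i'' ''n'' (Sq (Asg ''F'' (V ''i'') (Lit 0))
     (If (Equal (Read ''S'' (V ''i'')) (Lit 1))
        (Sq (SetVar ''g'' (V ''r''))
        (Sq insert_row
            (If (Less (V ''g'') (V ''r'')) (Sq (Asg ''F'' (V ''i'') (Lit 1)) (SetVar ''y'' (Add (V ''y'') (Lit 1)))) Nop)))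
        Nop))"

text \<open>A basis consists of data points, which are copied from the input cell by cell.\<close>
definition emit_vector :: prog where
  "emit_vector = For ''x'' ''E'' (append_out (Read ''input'' (Add (Read ''b'' (V ''j''))
     (Add (Mul (Lit 2) (Mul (V ''i'') (Read ''d'' (V ''j'')))) (Add (V ''x'') (Lit 1))))))"

definition emit_vectors :: prog where
  "emit_vectors = For ''i'' ''n'' (If (Equal (Read ''F'' (V ''i'')) (Lit 1)) emit_vector Nop)"

definition emit_block :: prog where
  "emit_block =
     Sq (SetVar ''y'' (Lit 0))
    (Sq select_basis
    (Sq (append_out (V ''y''))
    (Sq (SetVar ''E'' (Mul (Lit 2) (Read ''d'' (V ''j'')))) emit_vectors)))"

text \<open>The elimination state is kept from block to block. This is harmless, because the vectors of
  different blocks are independent of each other.\<close>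
definition emit_answer :: prog where
  "emit_answer = If (Less (V ''A'') (Lit 0))
     (Sq (append_out (Lit 1)) (Sq reset_rows (For ''j'' ''m'' emit_block)))
     (append_out (Lit 0))"

lemma writes_append_out [simp]: "writes (append_out e) = {''output''}"
  by (simp add: append_out_def)

lemma writes_select_basis: "writes select_basis =
    {''i'', ''F'', ''g'', ''y''} \<union> writes insert_row"
  by (auto simp: select_basis_def)

lemma writes_emit_vectors: "writes emit_vectors = {''i'', ''x'', ''output''}"
  by (auto simp: emit_vectors_def emit_vector_def)

lemma writes_emit_block: "writes emit_block = {''i'', ''F'', ''g'', ''y'', ''E'', ''output''} \<union> writes insert_row"
  by (auto simp: emit_block_def writes_select_basis writes_emit_vectors writes_insert_row)

lemma output_of_frame: "frame Z s t \<Longrightarrow> ''output'' \<notin> Z \<Longrightarrow> output_of t = output_of s"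
  by (simp add: frame_def output_of_def)

lemma length_encode_vec: "length (encode_vec u) = 2 * dim_vec u"
proof -
  have "length (concat (map encode_rat us)) = 2 * length us" for us
    by (induction us) (simp_all add: encode_rat_def)
  thus ?thesis by (simp add: encode_vec_def)
qed

lemma nth_encode_vec:
  assumes "x < dim_vec u"
  shows "encode_vec u ! (2 * x) = fst (quotient_of (u $ x))"
    "encode_vec u ! (2 * x + 1) = snd (quotient_of (u $ x))"
proof -
  have "x < length us \<Longrightarrow> concat (map encode_rat us) ! (2 * x) = fst (quotient_of (us ! x)) \<and>
      concat (map encode_rat us) ! (2 * x + 1) = snd (quotient_of (us ! x))" for us
  proof (induction us arbitrary: x)
    case (Cons u us)
    thus ?case by (cases x) (simp_all add: encode_rat_def)
  qed simp
  from this[of "list_of_vec u"] show "encode_vec u ! (2 * x) = fst (quotient_of (u $ x))"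
    "encode_vec u ! (2 * x + 1) = snd (quotient_of (u $ x))"
    using assms by (simp_all add: encode_vec_def list_of_vec_index)
qed

context machine
begin

text \<open>The length of the output is stored in a cell and must not exceed the cap.\<close>
lemma out_len_le_B: "1 + int m + 2 * int n * int D \<le> \<sigma> ''B'' 0"
proof -
  have "1 * \<sigma> ''K'' 0 \<le> int n * \<sigma> ''K'' 0" using n_pos K_pos by (intro mult_right_mono) auto
  thus ?thesis using L_ge L_le_B nD_le_K D_le_K m_le_D by simp
qed

lemma append_out_correct:
  assumes st: "static s" and out: "s ''output'' 0 = int (length ys)" "output_of s = ys"
    and len: "int (length ys) + 1 \<le> \<sigma> ''B'' 0"
    and z: "aval (upd s ''output'' 0 (int (length ys) + 1)) e = z" "\<bar>z\<bar> \<le> \<sigma> ''B'' 0"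
  shows "sem (append_out e) s ''output'' 0 = int (length (ys @ [z]))" "output_of (sem (append_out e) s) = ys @ [z]"
proof -
  note st' = static_simps[OF st]
  have sem: "sem (append_out e) s = upd (upd s ''output'' 0 (int (length ys) + 1)) ''output'' (int (length ys) + 1) z"
    using out len z by (simp add: append_out_def st')
  show 0: "sem (append_out e) s ''output'' 0 = int (length (ys @ [z]))" unfolding sem by simp
  have "output_of (sem (append_out e) s)
      = map (\<lambda>i. sem (append_out e) s ''output'' (int i)) ([1..<Suc (length ys)] @ [Suc (length ys)])"
    unfolding output_of_def 0 nat_int by simp
  also have "\<dots> = map (\<lambda>i. s ''output'' (int i)) [1..<Suc (length ys)] @ [z]"
    unfolding sem by auto
  also have "map (\<lambda>i. s ''output'' (int i)) [1..<Suc (length ys)] = ys"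
    using out unfolding output_of_def by simp
  finally show "output_of (sem (append_out e) s) = ys @ [z]" .
qed

definition holds_output :: "int list \<Rightarrow> mem \<Rightarrow> bool" where
  "holds_output ys s \<longleftrightarrow> s ''output'' 0 = int (length ys) \<and> output_of s = ys"

lemma holds_output_frame: "holds_output ys s \<Longrightarrow> frame Z s t \<Longrightarrow> ''output'' \<notin> Z \<Longrightarrow> holds_output ys t"
  using output_of_frame[of Z s t] by (simp add: holds_output_def frame_def)

lemma emit_vector_correct:
  assumes st: "static s" and out: "holds_output ys s" and ij: "i < n" "j < m" "s ''i'' 0 = int i" "s ''j'' 0 = int j"
    and E: "s ''E'' 0 = 2 * int (d (Suc j))" and len: "int (length ys) + 2 * int (d (Suc j)) \<le> \<sigma> ''B'' 0"
  shows "holds_output (ys @ encode_vec (v (Suc j) (Suc i))) (sem emit_vector s)"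
proof -
  note st' = static_simps[OF st]
  let ?u = "encode_vec (v (Suc j) (Suc i))"
  let ?e = "Read ''input'' (Add (Read ''b'' (V ''j''))
     (Add (Mul (Lit 2) (Mul (V ''i'') (Read ''d'' (V ''j'')))) (Add (V ''x'') (Lit 1))))"
  have dim: "dim_vec (v (Suc j) (Suc i)) = d (Suc j)" using v_carrier[OF ij(1,2)] by simp
  have len_u: "length ?u = 2 * d (Suc j)" by (simp add: length_encode_vec dim)
  let ?I = "\<lambda>k t. frame {''x'', ''output''} s t \<and> holds_output (ys @ take k ?u) t"
  have "?I (2 * d (Suc j)) (sem emit_vector s)"
    unfolding emit_vector_def
  proof (rule sem_For_invariant[where I = ?I and s = s and y = "''E''"])
    have "2 * int (d (Suc j)) \<le> \<sigma> ''L'' 0" using d_le_D[OF ij(2)] caps(4) by linarith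
    thus "2 * d (Suc j) = nat (min (s ''E'' 0) (s ''L'' 0))" using E by (simp add: st')
    have "holds_output ys (upd s ''x'' 0 0)" by (rule holds_output_frame[OF out frame_updI[OF frame_refl], of _ "{''x''}"]) auto
    thus "?I 0 (upd s ''x'' 0 0)" by (auto intro!: frame_updI)
    fix k t assume k: "k < 2 * d (Suc j)" and I: "?I k t" and x: "t ''x'' 0 = int k"
    have fr: "frame {''x'', ''output''} s t" and hold: "holds_output (ys @ take k ?u) t" using I by blast+
    have f: "t z = s z" if "z \<notin> {''x'', ''output''}" for z by (rule frameD[OF fr that])
    have stt: "static t" by (rule static_frame[OF st fr]) (simp add: statics_def)
    have cell: "\<sigma> ''input'' (\<sigma> ''b'' (int j) + (2 * (int i * int (d (Suc j))) + (int k + 1))) = ?u ! k"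
    proof -
      define y where "y = k div 2"
      have y: "y < d (Suc j)" using k by (simp add: y_def)
      consider "k = 2 * y" | "k = 2 * y + 1" unfolding y_def by linarith
      thus ?thesis
      proof cases
        case 1
        thus ?thesis using \<sigma>_input[OF ij(1,2) y] nth_encode_vec(1)[of y "v (Suc j) (Suc i)"] y
          by (simp add: dim algebra_simps)
      next
        case 2
        thus ?thesis using \<sigma>_input[OF ij(1,2) y] nth_encode_vec(2)[of y "v (Suc j) (Suc i)"] y
          by (simp add: dim algebra_simps)
      qed
    qed
    have "aval (upd t ''output'' 0 (int (length (ys @ take k ?u)) + 1)) ?e = ?u ! k"
      using ij x cell by (simp add: f st' \<sigma>_arrays)
    moreover have "\<bar>?u ! k\<bar> \<le> \<sigma> ''B'' 0" using input_le_B unfolding cell[symmetric] by blast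
    moreover have "int (length (ys @ take k ?u)) + 1 \<le> \<sigma> ''B'' 0" using len k len_u by simp
    ultimately have app: "holds_output ((ys @ take k ?u) @ [?u ! k]) (sem (append_out ?e) t)"
      using append_out_correct[OF stt, of "ys @ take k ?u" ?e "?u ! k"] hold unfolding holds_output_def by blast
    have tk: "(ys @ take k ?u) @ [?u ! k] = ys @ take (Suc k) ?u"
      using k len_u by (simp add: take_Suc_conv_app_nth)
    have fu: "frame {''x''} (sem (append_out ?e) t) (upd (sem (append_out ?e) t) ''x'' 0 (int (Suc k)))"
      by (intro frame_updI frame_refl) simp
    have "holds_output (ys @ take (Suc k) ?u) (upd (sem (append_out ?e) t) ''x'' 0 (int (Suc k)))"
      by (rule holds_output_frame[OF app[unfolded tk] fu]) simp
    moreover have "frame {''x'', ''output''} s (upd (sem (append_out ?e) t) ''x'' 0 (int (Suc k)))"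
      by (rule frame_updI[OF frame_trans[OF fr frame_mono[OF frame_sem]]]) auto
    ultimately show "?I (Suc k) (upd (sem (append_out ?e) t) ''x'' 0 (int (Suc k)))" by blast
  qed
  thus ?thesis using len_u by simp
qed

lemma emit_vectors_correct:
  assumes st: "static s" and out: "holds_output ys s" and j: "j < m" "s ''j'' 0 = int j"
    and E: "s ''E'' 0 = 2 * int (d (Suc j))"
    and len: "int (length ys) + 2 * int n * int (d (Suc j)) \<le> \<sigma> ''B'' 0"
    and F: "\<And>i. i < n \<Longrightarrow> s ''F'' (int i) = (if P i then 1 else 0)"
  defines "blk \<equiv> \<lambda>k. concat (map (\<lambda>i. encode_vec (v (Suc j) (Suc i))) (filter P [0..<k]))"
  shows "holds_output (ys @ blk n) (sem emit_vectors s)" "length (blk n) \<le> 2 * n * d (Suc j)"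
proof -
  note st' = static_simps[OF st]
  have dim: "dim_vec (v (Suc j) (Suc i)) = d (Suc j)" if "i < n" for i using v_carrier[OF that j(1)] by simp
  have blk_Suc: "blk (Suc k) = blk k @ (if P k then encode_vec (v (Suc j) (Suc k)) else [])" for k
    by (simp add: blk_def)
  have len_blk: "k \<le> n \<Longrightarrow> length (blk k) \<le> 2 * k * d (Suc j)" for k
  proof (induction k)
    case (Suc k)
    thus ?case by (simp add: blk_Suc length_encode_vec dim)
  qed (simp add: blk_def)
  show "length (blk n) \<le> 2 * n * d (Suc j)" by (rule len_blk) simp
  let ?I = "\<lambda>k t. frame {''i'', ''x'', ''output''} s t \<and> holds_output (ys @ blk k) t"
  have "?I n (sem emit_vectors s)"
    unfolding emit_vectors_def
  proof (rule sem_For_invariant[where I = ?I and s = s and y = "''n''"])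
    show "n = nat (min (s ''n'' 0) (s ''L'' 0))" using caps(2) by (simp add: st')
    have "holds_output ys (upd s ''i'' 0 0)" by (rule holds_output_frame[OF out frame_updI[OF frame_refl], of _ "{''i''}"]) auto
    thus "?I 0 (upd s ''i'' 0 0)" by (auto intro!: frame_updI simp: blk_def)
    fix k t assume k: "k < n" and I: "?I k t" and i: "t ''i'' 0 = int k"
    have fr: "frame {''i'', ''x'', ''output''} s t" and hold: "holds_output (ys @ blk k) t" using I by blast+
    have f: "t z = s z" if "z \<notin> {''i'', ''x'', ''output''}" for z by (rule frameD[OF fr that])
    have stt: "static t" by (rule static_frame[OF st fr]) (simp add: statics_def)
    let ?t = "sem (If (Equal (Read ''F'' (V ''i'')) (Lit 1)) emit_vector Nop) t"
    have "length (blk k) + 2 * d (Suc j) \<le> 2 * n * d (Suc j)"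
    proof -
      have "length (blk k) + 2 * d (Suc j) \<le> 2 * (k + 1) * d (Suc j)" using len_blk[of k] k by simp
      also have "\<dots> \<le> 2 * n * d (Suc j)" using k by (intro mult_le_mono) auto
      finally show ?thesis .
    qed
    hence "int (length (blk k) + 2 * d (Suc j)) \<le> int (2 * n * d (Suc j))" by (simp only: of_nat_le_iff)
    hence "int (length (ys @ blk k)) + 2 * int (d (Suc j)) \<le> \<sigma> ''B'' 0"
      using len by simp
    hence "holds_output (ys @ blk (Suc k)) ?t"
      using emit_vector_correct[OF stt hold k j(1) i] hold F[OF k] i j(2) E by (simp add: f blk_Suc)
    moreover have "frame {''i''} ?t (upd ?t ''i'' 0 (int (Suc k)))" by (intro frame_updI frame_refl) simp
    ultimately have "holds_output (ys @ blk (Suc k)) (upd ?t ''i'' 0 (int (Suc k)))"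
      by (rule holds_output_frame) simp
    moreover have "frame {''i'', ''x'', ''output''} s (upd ?t ''i'' 0 (int (Suc k)))"
      by (rule frame_updI[OF frame_trans[OF fr frame_mono[OF frame_sem]]]) (auto simp: emit_vector_def)
    ultimately show "?I (Suc k) (upd ?t ''i'' 0 (int (Suc k)))" by blast
  qed
  thus "holds_output (ys @ blk n) (sem emit_vectors s)" by blast
qed

text \<open>The list \<open>qs\<close> of newly accepted vectors generates all vectors of \<open>S\<close> in block \<open>j\<close> together with
  \<open>ps\<close>, which holds vectors of the earlier blocks.\<close>
lemma select_basis_correct:
  assumes st: "static s" and rep: "rep ps c s" and j: "j < m" "s ''j'' 0 = int j" and y: "s ''y'' 0 = 0"
    and S: "\<And>i. i < n \<Longrightarrow> s ''S'' (int i) = (if i \<in> S then 1 else 0)"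
  shows "\<exists>qs c'. rep (ps @ qs) c' (sem select_basis s) \<and> set qs \<subseteq> (S \<inter> {..<n}) \<times> {j} \<and>
    (\<forall>i<n. i \<in> S \<longrightarrow> dependent_on D U (ps @ qs) (U (i, j))) \<and>
    (\<forall>i<n. sem select_basis s ''F'' (int i) = (if (i, j) \<in> set qs then 1 else 0)) \<and>
    sem select_basis s ''y'' 0 = int (length qs)"
proof -
  note st' = static_simps[OF st]
  let ?body = "Sq (Asg ''F'' (V ''i'') (Lit 0))
     (If (Equal (Read ''S'' (V ''i'')) (Lit 1))
        (Sq (SetVar ''g'' (V ''r''))
        (Sq insert_row
            (If (Less (V ''g'') (V ''r'')) (Sq (Asg ''F'' (V ''i'') (Lit 1)) (SetVar ''y'' (Add (V ''y'') (Lit 1)))) Nop)))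
        Nop)"
  let ?W = "writes select_basis"
  let ?I = "\<lambda>k t. frame ?W s t \<and> (\<exists>qs c'. rep (ps @ qs) c' t \<and> set qs \<subseteq> (S \<inter> {..<k}) \<times> {j} \<and>
    (\<forall>i<k. i \<in> S \<longrightarrow> dependent_on D U (ps @ qs) (U (i, j))) \<and>
    (\<forall>i<k. t ''F'' (int i) = (if (i, j) \<in> set qs then 1 else 0)) \<and> t ''y'' 0 = int (length qs))"
  have "?I n (sem (For ''i'' ''n'' ?body) s)"
  proof (rule sem_For_invariant[where I = ?I and s = s and y = "''n''"])
    show "n = nat (min (s ''n'' 0) (s ''L'' 0))" using caps(2) by (simp add: st')
    have "rep (ps @ []) c (upd s ''i'' 0 0)"
      using rep_frame[OF rep frame_updI[OF frame_refl], of "''i''" "{''i''}" 0 0] by simp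
    moreover have "frame ?W s (upd s ''i'' 0 0)" by (intro frame_updI frame_refl) (simp add: writes_select_basis)
    ultimately show "?I 0 (upd s ''i'' 0 0)" using y by (intro conjI exI[of _ "[]"] exI[of _ c]) auto
    fix k t assume k: "k < n" and I: "?I k t" and i: "t ''i'' 0 = int k"
    then obtain qs c' where fr: "frame ?W s t" and qs: "rep (ps @ qs) c' t" "set qs \<subseteq> (S \<inter> {..<k}) \<times> {j}"
      "\<forall>i<k. i \<in> S \<longrightarrow> dependent_on D U (ps @ qs) (U (i, j))"
      "\<forall>i<k. t ''F'' (int i) = (if (i, j) \<in> set qs then 1 else 0)" "t ''y'' 0 = int (length qs)" by blast
    have f: "t z = s z" if "z \<notin> ?W" for z by (rule frameD[OF fr that])
    have stt: "static t" by (rule static_frame[OF st fr]) (simp add: writes_select_basis writes_insert_row statics_def)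
    have tj: "t ''j'' 0 = int j" using j by (simp add: f writes_select_basis writes_insert_row)
    have tS: "t ''S'' (int k) = (if k \<in> S then 1 else 0)" using S[OF k] by (simp add: f writes_select_basis writes_insert_row)
    have kqs: "(k, j) \<notin> set qs" using qs(2) by auto
    define t1 where "t1 = upd t ''F'' (int k) 0"
    have t1: "sem (Asg ''F'' (V ''i'') (Lit 0)) t = t1" using i B_ge_1 by (simp add: t1_def static_simps[OF stt])
    have fr1: "frame {''F''} t t1" unfolding t1_def by (intro frame_updI frame_refl) simp
    have st1: "static t1" by (rule static_frame[OF stt fr1]) (simp add: statics_def)
    have rep1: "rep (ps @ qs) c' t1" by (rule rep_frame[OF qs(1) fr1]) simp
    have frame': "frame ?W s (upd (sem ?body t) ''i'' 0 (int (Suc k)))"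
      by (rule frame_updI[OF frame_trans[OF fr frame_mono[OF frame_sem]]]) (auto simp: select_basis_def)
    have upd_i: "rep ps'' c'' (upd u ''i'' 0 z)" if "rep ps'' c'' u" for ps'' c'' u z
      by (rule rep_frame[OF that frame_updI[OF frame_refl], of _ "{''i''}"]) auto
    have "\<exists>qs c'. rep (ps @ qs) c' (sem ?body t) \<and> set qs \<subseteq> (S \<inter> {..<Suc k}) \<times> {j} \<and>
      (\<forall>i<Suc k. i \<in> S \<longrightarrow> dependent_on D U (ps @ qs) (U (i, j))) \<and>
      (\<forall>i<Suc k. sem ?body t ''F'' (int i) = (if (i, j) \<in> set qs then 1 else 0)) \<and>
      sem ?body t ''y'' 0 = int (length qs)"
    proof (cases "k \<in> S")
      case False
      have "sem ?body t = t1"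
        using tS False by (simp only: sem.simps(1,3,4) t1 bval.simps aval.simps) (simp add: t1_def i)
      thus ?thesis using rep1 qs(2-5) False kqs
        by (intro exI[of _ qs] exI[of _ c']) (auto simp: t1_def less_Suc_eq)
    next
      case True
      define t2 where "t2 = upd t1 ''g'' 0 (int (length (ps @ qs)))"
      have len: "length (ps @ qs) \<le> D" by (rule rep_length[OF rep1])
      have "\<bar>int (length (ps @ qs))\<bar> \<le> \<sigma> ''B'' 0" using len D_le_K by (intro small_le_B) linarith
      hence t2: "sem (SetVar ''g'' (V ''r'')) t1 = t2"
        using rep1 by (simp add: t2_def static_simps[OF st1] rep_def)
      have fr2: "frame {''g''} t1 t2" unfolding t2_def by (intro frame_updI frame_refl) simp
      have st2: "static t2" by (rule static_frame[OF st1 fr2]) (simp add: statics_def)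
      have rep2: "rep (ps @ qs) c' t2" by (rule rep_frame[OF rep1 fr2]) simp
      have ij2: "t2 ''i'' 0 = int k" "t2 ''j'' 0 = int j" using i tj by (simp_all add: t2_def t1_def)
      define t3 where "t3 = sem insert_row t2"
      obtain ps' c'' where ps': "rep ps' c'' t3"
        "ps' = ps @ qs \<and> dependent_on D U (ps @ qs) (U (k, j)) \<or> ps' = (ps @ qs) @ [(k, j)]"
        using insert_row_correct[OF st2 rep2 k j(1) ij2] unfolding t3_def by blast
      have fr3: "frame (writes insert_row) t2 t3" unfolding t3_def by (rule frame_sem)
      have f3: "t3 z = t2 z" if "z \<notin> writes insert_row" for z by (rule frameD[OF fr3 that])
      have st3: "static t3" by (rule static_frame[OF st2 fr3]) (simp add: writes_insert_row statics_def)
      let ?flag = "If (Less (V ''g'') (V ''r'')) (Sq (Asg ''F'' (V ''i'') (Lit 1)) (SetVar ''y'' (Add (V ''y'') (Lit 1)))) Nop"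
      have "t1 ''S'' (int k) = 1" "t1 ''i'' 0 = int k" using tS True i by (simp_all add: t1_def)
      hence body: "sem ?body t = sem ?flag t3"
        by (simp only: sem.simps(3,4) t1 t2 t3_def bval.simps aval.simps if_True simp_thms)
      have g3: "t3 ''g'' 0 = int (length (ps @ qs))" "t3 ''r'' 0 = int (length ps')" "t3 ''i'' 0 = int k"
        "t3 ''y'' 0 = int (length qs)"
        using ps'(1) i qs(5) by (simp_all add: f3 writes_insert_row t2_def t1_def rep_def)
      have F3: "t3 ''F'' = t1 ''F''" by (simp add: f3 writes_insert_row t2_def)
      show ?thesis
      proof (cases "ps' = ps @ qs \<and> dependent_on D U (ps @ qs) (U (k, j))")
        case True
        hence "sem ?flag t3 = t3" using g3 by simp
        thus ?thesis unfolding body using ps'(1) True qs(2-4) g3 F3 kqs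
          by (intro exI[of _ qs] exI[of _ c'']) (auto simp: t1_def less_Suc_eq)
      next
        case False
        hence app: "ps' = ps @ (qs @ [(k, j)])" using ps'(2) by auto
        define t4 where "t4 = upd (upd t3 ''F'' (int k) 1) ''y'' 0 (int (length qs) + 1)"
        have "length qs \<le> D" using len by simp
        hence "\<bar>int (length qs) + 1\<bar> \<le> \<sigma> ''B'' 0" using D_le_K K_pos by (intro small_le_B) linarith
        hence t4: "sem ?flag t3 = t4"
          using g3 app B_ge_1 by (simp add: static_simps[OF st3] t4_def)
        have "frame {''F'', ''y''} t3 t4" unfolding t4_def by (intro frame_updI frame_refl) auto
        hence "rep (ps @ (qs @ [(k, j)])) c'' t4" by (rule rep_frame[OF ps'(1)[unfolded app]]) simp
        moreover have "dependent_on D U (ps @ (qs @ [(k, j)])) (U (i, j))" if "i < Suc k" "i \<in> S" for i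
        proof (cases "i = k")
          case True
          thus ?thesis by (intro dependent_on_member) simp
        next
          case False
          hence "dependent_on D U (ps @ qs) (U (i, j))" using qs(3) that by simp
          from dependent_on_append[OF this, of "[(k, j)]"] show ?thesis by simp
        qed
        moreover have "set (qs @ [(k, j)]) \<subseteq> (S \<inter> {..<Suc k}) \<times> {j}" using qs(2) \<open>k \<in> S\<close> by auto
        moreover have "t4 ''F'' (int i) = (if (i, j) \<in> set (qs @ [(k, j)]) then 1 else 0)" if "i < Suc k" for i
          using qs(4) that by (auto simp: t4_def F3 t1_def less_Suc_eq)
        moreover have "t4 ''y'' 0 = int (length (qs @ [(k, j)]))" by (simp add: t4_def)
        ultimately show ?thesis unfolding body t4 by blast
      qed
    qed
    then obtain qs c' where "rep (ps @ qs) c' (sem ?body t)" "set qs \<subseteq> (S \<inter> {..<Suc k}) \<times> {j}"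
      "\<forall>i<Suc k. i \<in> S \<longrightarrow> dependent_on D U (ps @ qs) (U (i, j))"
      "\<forall>i<Suc k. sem ?body t ''F'' (int i) = (if (i, j) \<in> set qs then 1 else 0)"
      "sem ?body t ''y'' 0 = int (length qs)" by blast
    thus "?I (Suc k) (upd (sem ?body t) ''i'' 0 (int (Suc k)))"
      using frame' by (intro conjI exI[of _ qs] exI[of _ c'] upd_i) (simp_all del: sem.simps of_nat_Suc)
  qed
  hence "?I n (sem select_basis s)" unfolding select_basis_def .
  thus ?thesis by blast
qed

text \<open>The indices in increasing order, as they are written to the output.\<close>
definition selected :: "(nat \<times> nat) list \<Rightarrow> nat \<Rightarrow> nat list" where
  "selected ps j = filter (\<lambda>i. (i, j) \<in> set ps) [0..<n]"

definition block :: "(nat \<times> nat) list \<Rightarrow> nat \<Rightarrow> int list" where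
  "block ps j = int (length (selected ps j)) #
     concat (map (\<lambda>i. encode_vec (v (Suc j) (Suc i))) (selected ps j))"

lemma emit_block_correct:
  assumes st: "static s" and rep: "rep ps c s" and out: "holds_output ys s" and j: "j < m" "s ''j'' 0 = int j"
    and fresh: "\<And>i. (i, j) \<notin> set ps"
    and S: "\<And>i. i < n \<Longrightarrow> s ''S'' (int i) = (if i \<in> S then 1 else 0)"
    and len: "int (length ys) + 1 + 2 * int n * int (d (Suc j)) \<le> \<sigma> ''B'' 0"
  shows "\<exists>qs c'. rep (ps @ qs) c' (sem emit_block s) \<and> set qs \<subseteq> (S \<inter> {..<n}) \<times> {j} \<and>
    (\<forall>i<n. i \<in> S \<longrightarrow> dependent_on D U (ps @ qs) (U (i, j))) \<and>
    holds_output (ys @ block (ps @ qs) j) (sem emit_block s) \<and>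
    length (block (ps @ qs) j) \<le> 1 + 2 * n * d (Suc j)"
proof -
  note st' = static_simps[OF st]
  define s1 where "s1 = upd s ''y'' 0 0"
  have s1: "sem (SetVar ''y'' (Lit 0)) s = s1" using B_ge_1 by (simp add: s1_def st')
  have fr1: "frame {''y''} s s1" unfolding s1_def by (intro frame_updI frame_refl) simp
  have st1: "static s1" by (rule static_frame[OF st fr1]) (simp add: statics_def)
  have rep1: "rep ps c s1" by (rule rep_frame[OF rep fr1]) simp
  have j1: "s1 ''j'' 0 = int j" "s1 ''y'' 0 = 0" using j by (simp_all add: s1_def)
  have S1: "s1 ''S'' (int i) = (if i \<in> S then 1 else 0)" if "i < n" for i using S[OF that] by (simp add: s1_def)
  define s2 where "s2 = sem select_basis s1"
  obtain qs c' where qs: "rep (ps @ qs) c' s2" "set qs \<subseteq> (S \<inter> {..<n}) \<times> {j}"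
    "\<forall>i<n. i \<in> S \<longrightarrow> dependent_on D U (ps @ qs) (U (i, j))"
    "\<forall>i<n. s2 ''F'' (int i) = (if (i, j) \<in> set qs then 1 else 0)" "s2 ''y'' 0 = int (length qs)"
    using select_basis_correct[OF st1 rep1 j(1) j1 S1] unfolding s2_def by blast
  have fr2: "frame (writes select_basis) s1 s2" unfolding s2_def by (rule frame_sem)
  have f2: "s2 z = s1 z" if "z \<notin> writes select_basis" for z by (rule frameD[OF fr2 that])
  have st2: "static s2" by (rule static_frame[OF st1 fr2]) (simp add: writes_select_basis writes_insert_row statics_def)
  have out2: "holds_output ys s2"
    by (rule holds_output_frame[OF holds_output_frame[OF out fr1] fr2]) (simp_all add: writes_select_basis writes_insert_row)
  have dist: "distinct (ps @ qs)" by (rule rep_distinct[OF qs(1)])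
  have sel: "selected (ps @ qs) j = filter (\<lambda>i. (i, j) \<in> set qs) [0..<n]"
    unfolding selected_def using fresh by (intro filter_cong) auto
  have "length (selected (ps @ qs) j) = card {i. i < n \<and> (i, j) \<in> set qs}"
    unfolding sel by (simp add: length_filter_conv_card cong: conj_cong)
  also have "{i. i < n \<and> (i, j) \<in> set qs} = fst ` set qs" using qs(2) by force
  also have "card (fst ` set qs) = card (set qs)"
    by (rule card_image) (use qs(2) in \<open>auto intro!: inj_onI\<close>)
  also have "\<dots> = length qs" using dist by (simp add: distinct_card)
  finally have len_sel: "length (selected (ps @ qs) j) = length qs" .
  have "length qs \<le> n" using len_sel length_filter_le[of "\<lambda>i. (i, j) \<in> set (ps @ qs)" "[0..<n]"] by (simp add: selected_def)
  hence q_le: "\<bar>int (length qs)\<bar> \<le> \<sigma> ''B'' 0" using n_le_K K_pos by (intro small_le_B) linarith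
  define s3 where "s3 = sem (append_out (V ''y'')) s2"
  have "int (length ys) + 1 \<le> \<sigma> ''B'' 0" using len by (meson add_increasing2 le_add_same_cancel1 mult_nonneg_nonneg of_nat_0_le_iff order_trans zero_le_numeral)
  hence out3: "holds_output (ys @ [int (length qs)]) s3"
    using append_out_correct[OF st2, of ys "V ''y''" "int (length qs)"] out2 qs(5) q_le
    unfolding s3_def holds_output_def by simp
  have fr3: "frame {''output''} s2 s3" unfolding s3_def by (rule frame_mono[OF frame_sem]) simp
  have st3: "static s3" by (rule static_frame[OF st2 fr3]) (simp add: statics_def)
  have j3: "s3 ''j'' 0 = int j" using j1 frameD[OF fr3, of "''j''"] by (simp add: f2 writes_select_basis writes_insert_row)
  define s4 where "s4 = upd s3 ''E'' 0 (2 * int (d (Suc j)))"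
  have "\<bar>2 * int (d (Suc j))\<bar> \<le> \<sigma> ''B'' 0" using d_le_D[OF j(1)] D_le_K by (intro small_le_B) linarith
  hence s4: "sem (SetVar ''E'' (Mul (Lit 2) (Read ''d'' (V ''j'')))) s3 = s4"
    using j3 j(1) by (simp add: s4_def static_simps[OF st3] \<sigma>_arrays)
  have fr4: "frame {''E''} s3 s4" unfolding s4_def by (intro frame_updI frame_refl) simp
  have st4: "static s4" by (rule static_frame[OF st3 fr4]) (simp add: statics_def)
  have out4: "holds_output (ys @ [int (length qs)]) s4" by (rule holds_output_frame[OF out3 fr4]) simp
  have j4: "s4 ''j'' 0 = int j" "s4 ''E'' 0 = 2 * int (d (Suc j))" using j3 by (simp_all add: s4_def)
  have F4: "s4 ''F'' (int i) = (if (i, j) \<in> set qs then 1 else 0)" if "i < n" for i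
    using qs(4) that frameD[OF fr3, of "''F''"] by (simp add: s4_def)
  have len4: "int (length (ys @ [int (length qs)])) + 2 * int n * int (d (Suc j)) \<le> \<sigma> ''B'' 0" using len by simp
  have sem: "sem emit_block s = sem emit_vectors s4"
    by (simp only: emit_block_def sem.simps(3) s1 s2_def s3_def[symmetric] s4[symmetric]) (simp add: s3_def s2_def)
  have blk: "(ys @ [int (length qs)]) @ concat (map (\<lambda>i. encode_vec (v (Suc j) (Suc i))) (filter (\<lambda>i. (i, j) \<in> set qs) [0..<n]))
      = ys @ block (ps @ qs) j"
    using len_sel by (simp add: block_def sel)
  have "frame {''output'', ''E'', ''i'', ''x''} s2 (sem emit_vectors s4)"
    by (rule frame_trans[OF frame_mono[OF fr3] frame_trans[OF frame_mono[OF fr4] frame_mono[OF frame_sem]]])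
      (auto simp: writes_emit_vectors)
  hence "rep (ps @ qs) c' (sem emit_vectors s4)" by (rule rep_frame[OF qs(1)]) simp
  moreover have "holds_output (ys @ block (ps @ qs) j) (sem emit_vectors s4)"
    unfolding blk[symmetric] using emit_vectors_correct(1)[OF st4 out4 j(1) j4 len4 F4] by simp
  moreover have "length (block (ps @ qs) j) \<le> 1 + 2 * n * d (Suc j)"
    unfolding block_def sel using emit_vectors_correct(2)[OF st4 out4 j(1) j4 len4 F4] by simp
  ultimately show ?thesis unfolding sem using qs(2,3) by blast
qed

lemma block_append:
  assumes "\<And>i. (i, j) \<notin> set qs"
  shows "block (ps @ qs) j = block ps j"
  using assms by (simp add: block_def selected_def)

lemma emit_answer_none:
  assumes st: "static s" and "output_of s = []" "s ''output'' 0 = 0" "0 \<le> s ''A'' 0"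
  shows "output_of (sem emit_answer s) = [0]"
  using append_out_correct(2)[OF st, of "[]" "Lit 0" 0] assms B_ge_1
  by (simp add: emit_answer_def)

lemma emit_answer_some:
  assumes st: "static s" and out: "output_of s = []" "s ''output'' 0 = 0" and A: "s ''A'' 0 < 0"
    and S: "\<And>i. i < n \<Longrightarrow> s ''S'' (int i) = (if i \<in> S then 1 else 0)" and Sn: "S \<subseteq> {..<n}"
  shows "\<exists>ps c. pivoted D U ps c \<and> set ps \<subseteq> pairs S \<and> (\<forall>p\<in>pairs S. dependent_on D U ps (U p)) \<and>
    output_of (sem emit_answer s) = 1 # concat (map (block ps) [0..<m])"
proof -
  note st' = static_simps[OF st]
  define s1 where "s1 = sem (append_out (Lit 1)) s"
  have out1: "holds_output [1] s1"
    using append_out_correct[OF st, of "[]" "Lit 1" 1] out B_ge_1 unfolding holds_output_def s1_def by simp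
  have fr1: "frame {''output''} s s1" unfolding s1_def by (rule frame_mono[OF frame_sem]) simp
  have st1: "static s1" by (rule static_frame[OF st fr1]) (simp add: statics_def)
  define s2 where "s2 = sem reset_rows s1"
  note reset = reset_rows_correct[OF st1, folded s2_def]
  have st2: "static s2" by (rule static_frame[OF st1 reset(2)]) (simp add: statics_def)
  note st2' = static_simps[OF st2]
  have out2: "holds_output [1] s2" by (rule holds_output_frame[OF out1 reset(2)]) simp
  have S2: "s2 ''S'' (int i) = (if i \<in> S then 1 else 0)" if "i < n" for i
    using S[OF that] frameD[OF fr1, of "''S''"] frameD[OF reset(2), of "''S''"] by simp
  let ?W = "insert ''j'' (writes emit_block)"
  let ?I = "\<lambda>k t. frame ?W s2 t \<and> (\<exists>ps c. rep ps c t \<and> set ps \<subseteq> S \<times> {..<k} \<and>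
     (\<forall>i\<in>S. \<forall>j<k. dependent_on D U ps (U (i, j))) \<and>
     holds_output (1 # concat (map (block ps) [0..<k])) t \<and>
     length (concat (map (block ps) [0..<k])) \<le> k + 2 * n * off k)"
  have "?I m (sem (For ''j'' ''m'' emit_block) s2)"
  proof (rule sem_For_invariant[where I = ?I and s = s2 and y = "''m''"])
    show "m = nat (min (s2 ''m'' 0) (s2 ''L'' 0))" using caps(3) by (simp add: st2')
    have fr: "frame {''j''} s2 (upd s2 ''j'' 0 0)" by (intro frame_updI frame_refl) simp
    have "rep [] (\<lambda>_. 0) (upd s2 ''j'' 0 0)" by (rule rep_frame[OF reset(3) fr]) simp
    moreover have "holds_output [1] (upd s2 ''j'' 0 0)" by (rule holds_output_frame[OF out2 fr]) simp
    ultimately show "?I 0 (upd s2 ''j'' 0 0)"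
      by (intro conjI exI[of _ "[]"] exI[of _ "\<lambda>_. 0"] frame_updI) auto
    fix k t assume k: "k < m" and I: "?I k t" and j: "t ''j'' 0 = int k"
    then obtain ps c where fr: "frame ?W s2 t" and ps: "rep ps c t" "set ps \<subseteq> S \<times> {..<k}"
      "\<forall>i\<in>S. \<forall>j<k. dependent_on D U ps (U (i, j))"
      "holds_output (1 # concat (map (block ps) [0..<k])) t"
      "length (concat (map (block ps) [0..<k])) \<le> k + 2 * n * off k" by blast
    have stt: "static t" by (rule static_frame[OF st2 fr]) (simp add: writes_emit_block writes_insert_row statics_def)
    have tS: "t ''S'' (int i) = (if i \<in> S then 1 else 0)" if "i < n" for i
      using S2[OF that] frameD[OF fr, of "''S''"] by (simp add: writes_emit_block writes_insert_row)
    have fresh: "(i, k) \<notin> set ps" for i using ps(2) by auto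
    have len_Suc: "k + 2 * n * off k + 1 + 2 * n * d (Suc k) = Suc k + 2 * n * off (Suc k)"
      by (simp add: off_Suc algebra_simps)
    have "Suc k + 2 * n * off (Suc k) \<le> m + 2 * n * D"
      using k off_mono[of "Suc k" m] unfolding D_def by (intro add_mono mult_le_mono2) auto
    hence "length (1 # concat (map (block ps) [0..<k])) + 1 + 2 * n * d (Suc k) \<le> 1 + m + 2 * n * D"
      using ps(5) len_Suc by simp
    hence "int (length (1 # concat (map (block ps) [0..<k])) + 1 + 2 * n * d (Suc k)) \<le> int (1 + m + 2 * n * D)"
      by (simp only: of_nat_le_iff)
    hence len: "int (length (1 # concat (map (block ps) [0..<k]))) + 1 + 2 * int n * int (d (Suc k)) \<le> \<sigma> ''B'' 0"
      using out_len_le_B by simp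
    obtain qs c' where qs: "rep (ps @ qs) c' (sem emit_block t)" "set qs \<subseteq> (S \<inter> {..<n}) \<times> {k}"
      "\<forall>i<n. i \<in> S \<longrightarrow> dependent_on D U (ps @ qs) (U (i, k))"
      "holds_output ((1 # concat (map (block ps) [0..<k])) @ block (ps @ qs) k) (sem emit_block t)"
      "length (block (ps @ qs) k) \<le> 1 + 2 * n * d (Suc k)"
      using emit_block_correct[OF stt ps(1,4) k j fresh tS len] by blast
    have "block (ps @ qs) j = block ps j" if "j < k" for j
      by (rule block_append) (use qs(2) that in auto)
    hence blocks: "map (block (ps @ qs)) [0..<k] = map (block ps) [0..<k]" by simp
    have fu: "frame {''j''} (sem emit_block t) (upd (sem emit_block t) ''j'' 0 (int (Suc k)))"
      by (intro frame_updI frame_refl) simp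
    have "rep (ps @ qs) c' (upd (sem emit_block t) ''j'' 0 (int (Suc k)))"
      by (rule rep_frame[OF qs(1) fu]) simp
    moreover have "set (ps @ qs) \<subseteq> S \<times> {..<Suc k}" using ps(2) qs(2) by fastforce
    moreover have "\<forall>i\<in>S. \<forall>j<Suc k. dependent_on D U (ps @ qs) (U (i, j))"
    proof (intro ballI allI impI)
      fix i j assume ij: "i \<in> S" "j < Suc k"
      show "dependent_on D U (ps @ qs) (U (i, j))"
      proof (cases "j = k")
        case True
        thus ?thesis using qs(3) ij Sn by auto
      next
        case False
        hence "dependent_on D U ps (U (i, j))" using ps(3) ij by simp
        thus ?thesis by (rule dependent_on_append)
      qed
    qed
    moreover have "holds_output (1 # concat (map (block (ps @ qs)) [0..<Suc k])) (upd (sem emit_block t) ''j'' 0 (int (Suc k)))"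
      using holds_output_frame[OF qs(4) fu] by (simp add: blocks del: of_nat_Suc)
    moreover have "length (concat (map (block (ps @ qs)) [0..<Suc k])) \<le> Suc k + 2 * n * off (Suc k)"
    proof -
      have "length (concat (map (block (ps @ qs)) [0..<Suc k]))
          = length (concat (map (block ps) [0..<k])) + length (block (ps @ qs) k)"
        by (simp add: blocks)
      thus ?thesis using ps(5) qs(5) len_Suc by linarith
    qed
    moreover have "frame ?W s2 (upd (sem emit_block t) ''j'' 0 (int (Suc k)))"
      by (rule frame_updI[OF frame_trans[OF fr frame_mono[OF frame_sem]]]) auto
    ultimately show "?I (Suc k) (upd (sem emit_block t) ''j'' 0 (int (Suc k)))" by blast
  qed
  moreover have "sem emit_answer s = sem (For ''j'' ''m'' emit_block) s2"
    using A by (simp only: emit_answer_def sem.simps(3,4) bval.simps aval.simps s2_def s1_def if_True)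
  ultimately obtain ps c where "rep ps c (sem emit_answer s)" "set ps \<subseteq> pairs S"
      "\<forall>i\<in>S. \<forall>j<m. dependent_on D U ps (U (i, j))"
      "output_of (sem emit_answer s) = 1 # concat (map (block ps) [0..<m])"
    unfolding holds_output_def by metis
  thus ?thesis unfolding rep_def by (intro exI[of _ ps] exI[of _ c]) auto
qed

end

section \<open>Correctness of the search program\<close>

lemma encode_rat_inject: "encode_rat p = encode_rat q \<Longrightarrow> p = q"
  using quotient_of_inject[of p q] by (simp add: encode_rat_def prod_eq_iff)

lemma encode_vec_inject:
  assumes "encode_vec u = encode_vec w"
  shows "u = w"
proof -
  have "concat (map encode_rat us) = concat (map encode_rat ws) \<Longrightarrow> us = ws" for us ws
  proof (induction us arbitrary: ws)
    case Nil
    thus ?case by (cases ws) (simp_all add: encode_rat_def)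
  next
    case (Cons u us)
    then obtain w ws' where ws: "ws = w # ws'" by (cases ws) (simp_all add: encode_rat_def)
    have "length (encode_rat u) = length (encode_rat w)" by (simp add: encode_rat_def)
    hence "encode_rat u = encode_rat w" "concat (map encode_rat us) = concat (map encode_rat ws')"
      using Cons.prems unfolding ws by simp_all
    thus ?case using Cons.IH ws encode_rat_inject by blast
  qed
  hence "list_of_vec u = list_of_vec w" using assms by (simp add: encode_vec_def)
  thus ?thesis by (metis vec_list)
qed

lemma concat_encode_vec_inject:
  assumes "length us = length ws" "\<forall>u\<in>set us. dim_vec u = k" "\<forall>w\<in>set ws. dim_vec w = k"
    and "concat (map encode_vec us) = concat (map encode_vec ws)"
  shows "us = ws"
  using assms
proof (induction us ws rule: list_induct2)
  case (Cons u us w ws)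
  have "length (encode_vec u) = length (encode_vec w)" using Cons.prems by (simp add: length_encode_vec)
  hence "encode_vec u = encode_vec w" "concat (map encode_vec us) = concat (map encode_vec ws)"
    using Cons.prems(3) by simp_all
  thus ?case using Cons encode_vec_inject by simp
qed simp

lemma length_concat_encode_vec:
  "\<forall>u\<in>set us. dim_vec u = k \<Longrightarrow> length (concat (map encode_vec us)) = 2 * k * length us"
  by (induction us) (simp_all add: length_encode_vec)

text \<open>Each length tells where the next basis begins, so the code can be read from left to right.\<close>
lemma encode_bases_inject:
  fixes B B' :: "nat \<Rightarrow> rat vec list"
  assumes "\<And>j. j \<in> set js \<Longrightarrow> (\<forall>u\<in>set (B j). dim_vec u = d j) \<and> (\<forall>u\<in>set (B' j). dim_vec u = d j)"
    and "concat (map (\<lambda>j. int (length (B j)) # concat (map encode_vec (B j))) js)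
       = concat (map (\<lambda>j. int (length (B' j)) # concat (map encode_vec (B' j))) js)"
    and "j \<in> set js"
  shows "B j = B' j"
  using assms
proof (induction js arbitrary: j)
  case (Cons i js)
  have dims: "\<forall>u\<in>set (B i). dim_vec u = d i" "\<forall>u\<in>set (B' i). dim_vec u = d i" using Cons.prems(1) by auto
  have len: "length (B i) = length (B' i)" using Cons.prems(2) by simp
  have "length (concat (map encode_vec (B i))) = length (concat (map encode_vec (B' i)))"
    using length_concat_encode_vec[OF dims(1)] length_concat_encode_vec[OF dims(2)] len by simp
  hence eq: "concat (map encode_vec (B i)) = concat (map encode_vec (B' i))"
    "concat (map (\<lambda>j. int (length (B j)) # concat (map encode_vec (B j))) js)
       = concat (map (\<lambda>j. int (length (B' j)) # concat (map encode_vec (B' j))) js)"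
    using Cons.prems(2) by simp_all
  have "B i = B' i" by (rule concat_encode_vec_inject[OF len dims eq(1)])
  moreover have "B j = B' j" if "j \<in> set js" by (rule Cons.IH[OF _ eq(2) that]) (use Cons.prems(1) in auto)
  ultimately show ?case using Cons.prems(3) by auto
qed simp

lemma is_basis_span:
  assumes W: "is_subspace k W" and B: "is_basis k W A"
  shows "W = module.span class_ring (module_vec TYPE(real) k) A" "A \<subseteq> carrier_vec k"
proof -
  interpret vs: vec_space "TYPE(real)" k .
  interpret W: vectorspace class_ring "vs.vs W" by (rule vs.subspace_is_vs[OF W])
  have sub: "submodule class_ring W vs.V" using W unfolding VectorSpace.subspace_def by simp
  have A: "A \<subseteq> W" "W.span A = W" using B by (simp_all add: W.basis_def)
  show "W = vs.span A" using vs.span_li_not_depend(1)[OF A(1) sub] A(2) by simp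
  have "W \<subseteq> carrier vs.V" using sub unfolding submodule_def by simp
  thus "A \<subseteq> carrier_vec k" using A(1) by auto
qed

text \<open>The output determines the bases, and a basis determines its span.\<close>
lemma answers_unique:
  assumes "answers m d ys T" "answers m d ys T'" "j \<in> {1..m}"
  shows "T j = T' j"
proof -
  obtain B where B: "\<And>j. j \<in> {1..m} \<Longrightarrow> is_subspace (d j) (T j)"
      "\<And>j. j \<in> {1..m} \<Longrightarrow> is_basis (d j) (T j) (real_vec ` set (B j))"
      "ys = 1 # concat (map (\<lambda>j. int (length (B j)) # concat (map encode_vec (B j))) [1..<Suc m])"
    using assms(1) unfolding answers_def by blast
  obtain B' where B': "\<And>j. j \<in> {1..m} \<Longrightarrow> is_subspace (d j) (T' j)"
      "\<And>j. j \<in> {1..m} \<Longrightarrow> is_basis (d j) (T' j) (real_vec ` set (B' j))"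
      "ys = 1 # concat (map (\<lambda>j. int (length (B' j)) # concat (map encode_vec (B' j))) [1..<Suc m])"
    using assms(2) unfolding answers_def by blast
  have "B j = B' j"
  proof (rule encode_bases_inject[of "[1..<Suc m]" B d B'])
    fix j assume "j \<in> set [1..<Suc m]"
    hence j: "j \<in> {1..m}" by auto
    have "real_vec ` set (B j) \<subseteq> carrier_vec (d j)" "real_vec ` set (B' j) \<subseteq> carrier_vec (d j)"
      using is_basis_span(2)[OF B(1,2)] is_basis_span(2)[OF B'(1,2)] j by blast+
    thus "(\<forall>u\<in>set (B j). dim_vec u = d j) \<and> (\<forall>u\<in>set (B' j). dim_vec u = d j)" by fastforce
  next
    show "concat (map (\<lambda>j. int (length (B j)) # concat (map encode_vec (B j))) [1..<Suc m])
       = concat (map (\<lambda>j. int (length (B' j)) # concat (map encode_vec (B' j))) [1..<Suc m])"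
      using B(3) B'(3) by simp
    show "j \<in> set [1..<Suc m]" using assms(3) by auto
  qed
  thus ?thesis using is_basis_span(1)[OF B(1,2)] is_basis_span(1)[OF B'(1,2)] assms(3) by metis
qed

lemma optimal_srsr_solution_cong:
  assumes "optimal_srsr_solution n m d X T" "\<And>j. j \<in> {1..m} \<Longrightarrow> T j = T' j"
  shows "optimal_srsr_solution n m d X T'"
proof -
  have "inliers n m X T = inliers n m X T'" using assms(2) by (auto simp: inliers_def)
  moreover have "threshold n m d T = threshold n m d T'"
    unfolding threshold_def using assms(2) by simp
  ultimately show ?thesis using assms unfolding optimal_srsr_solution_def srsr_solution_def by simp
qed

context machine
begin

text \<open>If the minimum is negative, the spans of the best set form a solution whose defect is at most the
  minimum, hence optimal. Otherwise there is no solution.\<close>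
lemma main_correct:
  assumes st: "static s" and start: "\<And>i. s ''X'' i = 0" "\<And>i. s ''S'' i = 0" "s ''A'' 0 = 0" "s ''output'' 0 = 0"
  shows "correct_output (output_of (sem (Sq descent emit_answer) s))"
proof -
  define s1 where "s1 = sem descent s"
  note desc = descent_correct[OF st start(1-3), folded s1_def]
  have fr: "frame (writes descent) s s1" unfolding s1_def by (rule frame_sem)
  have st1: "static s1"
    by (rule static_frame[OF st fr]) (simp add: descent_def writes_scan_levels writes_update_point statics_def)
  have out0: "s1 ''output'' 0 = 0"
    using start(4) frameD[OF fr, of "''output''"] by (simp add: descent_def writes_scan_levels writes_update_point)
  hence out: "output_of s1 = []" by (simp add: output_of_def)
  have sem: "sem (Sq descent emit_answer) s = sem emit_answer s1" by (simp add: s1_def)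
  obtain S where S: "S \<subseteq> {..<n}" "\<forall>i<n. s1 ''S'' (int i) = (if i \<in> S then 1 else 0)"
    "s1 ''A'' 0 = objective S" using desc(1) unfolding best_so_far_def by blast
  show ?thesis
  proof (cases "s1 ''A'' 0 < 0")
    case False
    hence no: "\<not> (\<exists>T. srsr_solution n m d X T)" using desc(2) by (force simp: srsr_solution_iff)
    have "output_of (sem emit_answer s1) = [0]" by (rule emit_answer_none[OF st1 out out0]) (use False in simp)
    thus ?thesis using no unfolding sem correct_output_def decides_and_computes_srsr_def no_solution_answer_def by auto
  next
    case True
    let ?ys = "output_of (sem emit_answer s1)"
    obtain ps c where ps: "pivoted D U ps c" "set ps \<subseteq> pairs S" "\<And>p. p \<in> pairs S \<Longrightarrow> dependent_on D U ps (U p)"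
      "?ys = 1 # concat (map (block ps) [0..<m])"
      using emit_answer_some[OF st1 out out0 True _ S(1)] S(2) by blast
    have defect: "defect (spans S) \<le> s1 ''A'' 0" unfolding S(3) by (rule defect_spans_le[OF S(1)])
    have sub: "subspaces (spans S)" by (rule subspaces_spans[OF S(1)])
    have sol: "srsr_solution n m d X (spans S)" using sub defect True by (simp add: srsr_solution_iff)
    have opt: "optimal_srsr_solution n m d X (spans S)"
      by (rule optimal_srsr_solutionI[OF sol]) (use desc(2) defect in force)
    \<comment> \<open>The bases as lists of rational vectors, numbered from 1 as in the output format.\<close>
    define B where "B j = map (\<lambda>i. v j (Suc i)) (selected ps (j - 1))" for j
    have "block ps j = int (length (B (Suc j))) # concat (map encode_vec (B (Suc j)))" for j
      by (simp add: B_def block_def comp_def)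
    hence "map (block ps) [0..<m] = map (\<lambda>j. int (length (B j)) # concat (map encode_vec (B j))) (map Suc [0..<m])"
      by (simp add: comp_def)
    hence ys: "?ys = 1 # concat (map (\<lambda>j. int (length (B j)) # concat (map encode_vec (B j))) [1..<Suc m])"
      unfolding ps(4) map_Suc_upt by simp
    have basis: "is_subspace (d j) (spans S j) \<and> distinct (B j) \<and> is_basis (d j) (spans S j) (real_vec ` set (B j))"
      if "j \<in> {1..m}" for j
    proof -
      define j' where "j' = j - 1"
      have j': "j = Suc j'" "j' < m" using that by (auto simp: j'_def)
      have ps': "set ps \<subseteq> pairs {..<n}" using ps(2) S(1) by auto
      have sel: "set (selected ps j') = chosen ps j'" using ps' by (auto simp: selected_def chosen_def)
      have set: "real_vec ` set (B j) = dp j' ` chosen ps j'" by (auto simp: B_def j' X_def sel[symmetric])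
      have "inj_on (dp j') (chosen ps j')" by (rule chosen_independent(1)[OF ps(1) ps' j'(2)])
      hence "inj_on (\<lambda>i. v j (Suc i)) (chosen ps j')" unfolding X_def j'(1) inj_on_def by metis
      hence "distinct (B j)" by (simp add: B_def j' distinct_map sel) (simp add: selected_def)
      moreover have "is_subspace (d j) (spans S j)"
        unfolding j'(1) by (rule spans_basis(1)[OF ps(1) S(1) ps(2) ps(3) j'(2)])
      moreover have "is_basis (d j) (spans S j) (real_vec ` set (B j))"
        unfolding set unfolding j'(1) by (rule spans_basis(2)[OF ps(1) S(1) ps(2) ps(3) j'(2)])
      ultimately show ?thesis by blast
    qed
    have ans: "answers m d ?ys (spans S)" unfolding answers_def using basis ys by blast
    show ?thesis unfolding correct_output_def sem
    proof (intro conjI impI allI)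
      show "decides_and_computes_srsr n m d X ?ys"
        unfolding decides_and_computes_srsr_def using ans sol by auto
      fix T assume "answers m d ?ys T"
      thus "optimal_srsr_solution n m d X T"
        using optimal_srsr_solution_cong[OF opt] answers_unique[OF ans] by blast
    qed
  qed
qed

end

section \<open>Reading the instance\<close>

text \<open>Random access into a concatenation of blocks of different lengths.\<close>
lemma nth_concat_blocks:
  "j < k \<Longrightarrow> t < length (f j) \<Longrightarrow>
   concat (map f [0..<k]) ! ((\<Sum>j'<j. length (f j')) + t) = f j ! t \<and>
   (\<Sum>j'<j. length (f j')) + t < length (concat (map f [0..<k]))"
proof (induction k)
  case (Suc k)
  have len: "length (concat (map f [0..<k])) = (\<Sum>j'<k. length (f j'))"
    by (simp add: length_concat comp_def interv_sum_list_conv_sum_set_nat lessThan_atLeast0)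
  show ?case
  proof (cases "j = k")
    case True
    thus ?thesis using Suc.prems len by (simp add: nth_append)
  next
    case False
    thus ?thesis using Suc by (simp add: nth_append)
  qed
qed simp

context srsr_data
begin

abbreviation code :: "int list" where "code \<equiv> encode_instance n m d v"

lemma code_eq:
  "code = [int n, int m] @ map (\<lambda>j. int (d (Suc j))) [0..<m] @
     concat (map (\<lambda>j. concat (map (\<lambda>i. encode_vec (v (Suc j) (Suc i))) [0..<n])) [0..<m])"
proof -
  have shift: "map f [1..<Suc k] = map (\<lambda>i. f (Suc i)) [0..<k]" for k and f :: "nat \<Rightarrow> 'z"
    using map_map[of f Suc "[0..<k]"] by (simp only: map_Suc_upt comp_def One_nat_def)
  show ?thesis unfolding encode_instance_def shift ..
qed

lemma block_length:
  "j < m \<Longrightarrow> length (concat (map (\<lambda>i. encode_vec (v (Suc j) (Suc i))) [0..<k])) = 2 * k * d (Suc j)" if "k \<le> n" for k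
  using that
proof (induction k)
  case (Suc k)
  thus ?case using v_carrier[of k j] by (simp add: length_encode_vec)
qed simp

lemma blocks_length: "j \<le> m \<Longrightarrow>
  (\<Sum>j'<j. length (concat (map (\<lambda>i. encode_vec (v (Suc j') (Suc i))) [0..<n]))) = 2 * n * off j"
  by (induction j) (simp_all add: off_def block_length[OF order_refl] add_mult_distrib2)

lemma code_length: "length code = 2 + m + 2 * n * D"
proof -
  have "length (concat (map (\<lambda>j. concat (map (\<lambda>i. encode_vec (v (Suc j) (Suc i))) [0..<n])) [0..<m])) = 2 * n * off m"
    unfolding blocks_length[OF order_refl, symmetric]
    by (simp add: length_concat comp_def interv_sum_list_conv_sum_set_nat lessThan_atLeast0)
  thus ?thesis unfolding code_eq by (simp add: D_def)
qed

lemma code_header: "code ! 0 = int n" "code ! 1 = int m" "j < m \<Longrightarrow> code ! (2 + j) = int (d (Suc j))"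
  unfolding code_eq by (simp_all add: nth_append)

lemma code_entry:
  assumes "i < n" "j < m" "t < 2 * d (Suc j)"
  shows "code ! (2 + m + 2 * n * off j + (2 * i * d (Suc j) + t)) = encode_vec (v (Suc j) (Suc i)) ! t"
    "2 + m + 2 * n * off j + (2 * i * d (Suc j) + t) < length code"
proof -
  let ?g = "\<lambda>j. concat (map (\<lambda>i. encode_vec (v (Suc j) (Suc i))) [0..<n])"
  have dim: "length (encode_vec (v (Suc j) (Suc i'))) = 2 * d (Suc j)" if "i' < n" for i'
    using v_carrier[OF that assms(2)] by (simp add: length_encode_vec)
  have "(\<Sum>i'<i. length (encode_vec (v (Suc j) (Suc i')))) = (\<Sum>i'<i. 2 * d (Suc j))"
    by (rule sum.cong) (use assms(1) dim in auto)
  hence s: "(\<Sum>i'<i. length (encode_vec (v (Suc j) (Suc i')))) = 2 * i * d (Suc j)" by simp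
  have 1: "?g j ! (2 * i * d (Suc j) + t) = encode_vec (v (Suc j) (Suc i)) ! t"
    "2 * i * d (Suc j) + t < length (?g j)"
    using nth_concat_blocks[OF assms(1), of t "\<lambda>i. encode_vec (v (Suc j) (Suc i))"] assms(3) dim[OF assms(1)]
    unfolding s by auto
  have 2: "concat (map ?g [0..<m]) ! (2 * n * off j + (2 * i * d (Suc j) + t)) = ?g j ! (2 * i * d (Suc j) + t)"
    "2 * n * off j + (2 * i * d (Suc j) + t) < length (concat (map ?g [0..<m]))"
    using nth_concat_blocks[OF assms(2), of "2 * i * d (Suc j) + t" ?g] 1(2) unfolding blocks_length[OF less_imp_le[OF assms(2)]] by auto
  define P where "P = [int n, int m] @ map (\<lambda>j. int (d (Suc j))) [0..<m]"
  have split: "code = P @ concat (map ?g [0..<m])"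
    unfolding code_eq P_def by simp
  have len: "length P = 2 + m" by (simp add: P_def)
  have assoc: "2 + m + 2 * n * off j + (2 * i * d (Suc j) + t) = length P + (2 * n * off j + (2 * i * d (Suc j) + t))"
    unfolding len by simp
  have "code ! (length P + (2 * n * off j + (2 * i * d (Suc j) + t)))
      = concat (map ?g [0..<m]) ! (2 * n * off j + (2 * i * d (Suc j) + t))"
    unfolding split by (rule nth_append_length_plus)
  thus "code ! (2 + m + 2 * n * off j + (2 * i * d (Suc j) + t)) = encode_vec (v (Suc j) (Suc i)) ! t"
    unfolding assoc 2(1) 1(1) .
  show "2 + m + 2 * n * off j + (2 * i * d (Suc j) + t) < length code"
    unfolding assoc split length_append using 2(2) by simp
qed

end

text \<open>\<open>''D''\<close> and \<open>''a''\<close> are running totals: before block \<open>j\<close> they are its offset among the coordinates and its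
  position in the input.\<close>
definition setup_block :: prog where
  "setup_block =
     Sq (Asg ''d'' (V ''j'') (Read ''input'' (Add (Add (V ''z'') (Lit 3)) (V ''j''))))
    (Sq (Asg ''o'' (V ''j'') (V ''D''))
    (Sq (Asg ''b'' (V ''j'') (V ''a''))
    (Sq (SetVar ''a'' (Add (V ''a'') (Mul (Mul (Lit 2) (V ''n'')) (Read ''d'' (V ''j'')))))
        (SetVar ''D'' (Add (V ''D'') (Read ''d'' (V ''j'')))))))"

text \<open>The cell \<open>''z''\<close> is the number of cells that precede the instance in the input.\<close>
definition setup_prog :: prog where
  "setup_prog =
     Sq (SetVar ''n'' (Read ''input'' (Add (V ''z'') (Lit 1))))
    (Sq (SetVar ''m'' (Read ''input'' (Add (V ''z'') (Lit 2))))
    (Sq (SetVar ''D'' (Lit 0))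
    (Sq (SetVar ''a'' (Add (Add (V ''z'') (Lit 2)) (V ''m'')))
    (Sq (For ''j'' ''m'' setup_block)
    (Sq (SetVar ''K'' (Mul (Mul (Mul (V ''n'') (V ''n'')) (V ''n'')) (Mul (V ''D'') (V ''D''))))
    (Sq (SetVar ''k'' (Add (V ''K'') (Lit 1)))
        (SetVar ''T'' (Add (Mul (V ''n'') (V ''K'')) (Lit 1)))))))))"

lemma writes_setup_prog: "writes setup_prog = {''n'', ''m'', ''D'', ''a'', ''j'', ''d'', ''o'', ''b'', ''K'', ''k'', ''T''}"
  by (auto simp: setup_prog_def setup_block_def)

text \<open>Every number stored here is an input cell or at most the content of \<open>''L''\<close>, so no assignment is
  skipped.\<close>
lemma (in srsr_data) setup_prog_correct:
  fixes s :: mem and z :: nat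
  assumes z: "s ''z'' 0 = int z"
    and input_all: "\<forall>a<length code. s ''input'' (int (z + 1 + a)) = code ! a"
    and input_le: "\<And>a. \<bar>s ''input'' a\<bar> \<le> s ''B'' 0"
    and len: "int (z + length code) \<le> s ''L'' 0" and L_B: "s ''L'' 0 \<le> s ''B'' 0"
    and K_le: "int n * int (n ^ 3 * D ^ 2) + 2 * int (n ^ 3 * D ^ 2) + 2 \<le> s ''L'' 0"
  defines "\<sigma> \<equiv> sem setup_prog s"
  shows "\<sigma> ''n'' 0 = int n" "\<sigma> ''m'' 0 = int m" "\<sigma> ''D'' 0 = int D"
    "\<sigma> ''K'' 0 = int (n ^ 3 * D ^ 2)" "\<sigma> ''k'' 0 = \<sigma> ''K'' 0 + 1" "\<sigma> ''T'' 0 = int n * \<sigma> ''K'' 0 + 1"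
    "\<And>j. j < m \<Longrightarrow> \<sigma> ''d'' (int j) = int (d (Suc j))"
    "\<And>j. j < m \<Longrightarrow> \<sigma> ''o'' (int j) = int (off j)"
    "\<And>j. j < m \<Longrightarrow> \<sigma> ''b'' (int j) = int (z + 2 + m + 2 * n * off j)"
proof -
  note input = input_all[rule_format]
  have small: "\<bar>int a\<bar> \<le> s ''B'' 0" if "a \<le> z + length code" for a
    using that len L_B by linarith
  have header: "s ''input'' (int z + 1) = int n" "s ''input'' (int z + 2) = int m"
    "j < m \<Longrightarrow> s ''input'' (int z + 3 + int j) = int (d (Suc j))" for j
    using input[of 0] input[of 1] input[of "2 + j"] code_header
    by (simp_all add: code_length ac_simps)
  have "n * 1 \<le> n * D" using D_pos by (intro mult_le_mono2) simp
  hence "n \<le> z + length code" unfolding code_length mult.assoc by linarith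
  hence nB: "\<bar>int n\<bar> \<le> s ''B'' 0" by (rule small)
  have mB: "\<bar>int m\<bar> \<le> s ''B'' 0" "\<bar>int (z + 2 + m)\<bar> \<le> s ''B'' 0" by (intro small; simp add: code_length)+
  have B0: "0 \<le> s ''B'' 0" using mB(1) by linarith
  define s1 where "s1 = upd (upd (upd (upd s ''n'' 0 (int n)) ''m'' 0 (int m)) ''D'' 0 0) ''a'' 0 (int (z + 2 + m))"
  let ?W = "{''D'', ''a'', ''j'', ''d'', ''o'', ''b''}"
  let ?I = "\<lambda>k t. frame ?W s1 t \<and> t ''D'' 0 = int (off k) \<and> t ''a'' 0 = int (z + 2 + m + 2 * n * off k) \<and>
    (\<forall>j<k. t ''d'' (int j) = int (d (Suc j)) \<and> t ''o'' (int j) = int (off j) \<and>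
       t ''b'' (int j) = int (z + 2 + m + 2 * n * off j))"
  have "?I m (sem (For ''j'' ''m'' setup_block) s1)"
  proof (rule sem_For_invariant[where I = ?I and s = s1 and y = "''m''"])
    have "m \<le> z + length code" by (simp add: code_length)
    hence "int m \<le> s ''L'' 0" using len by linarith
    thus "m = nat (min (s1 ''m'' 0) (s1 ''L'' 0))" by (simp add: s1_def)
    show "?I 0 (upd s1 ''j'' 0 0)" by (auto intro!: frame_updI simp: off_def) (simp_all add: s1_def)
    fix k t assume k: "k < m" and I: "?I k t" and j: "t ''j'' 0 = int k"
    have fr: "frame ?W s1 t" using I by blast
    have f: "t x = s1 x" if "x \<notin> ?W" for x by (rule frameD[OF fr that])
    have t: "t ''z'' 0 = int z" "t ''n'' 0 = int n" "t ''B'' = s ''B''" "t ''input'' = s ''input''"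
      "t ''D'' 0 = int (off k)" "t ''a'' 0 = int (z + 2 + m + 2 * n * off k)"
      using z I by (simp_all add: f) (simp_all add: s1_def)
    have offk: "off (Suc k) \<le> D" using k off_mono[of "Suc k" m] by (simp add: D_def)
    have "1 * off (Suc k) \<le> (2 * n) * D" using offk n_pos by (intro mult_le_mono) auto
    hence b1: "\<bar>int (off (Suc k))\<bar> \<le> s ''B'' 0" by (intro small) (simp add: code_length)
    have b2: "\<bar>int (z + 2 + m + 2 * n * off (Suc k))\<bar> \<le> s ''B'' 0"
      by (rule small) (use offk in \<open>simp add: code_length\<close>)
    have b3: "\<bar>int (d (Suc k))\<bar> \<le> s ''B'' 0" "\<bar>int (off k)\<bar> \<le> s ''B'' 0"
      using b1 by (auto simp: off_Suc)
    have "off k \<le> off (Suc k)" by (simp add: off_Suc)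
    hence b4: "\<bar>int (z + 2 + m + 2 * n * off k)\<bar> \<le> s ''B'' 0"
      by (intro small) (use offk in \<open>simp add: code_length order_trans[of "off k" "off (Suc k)" D]\<close>)
    define t1 where "t1 = upd (upd (upd t ''d'' (int k) (int (d (Suc k)))) ''o'' (int k) (int (off k))) ''b'' (int k) (int (z + 2 + m + 2 * n * off k))"
    have 1: "sem (Asg ''d'' (V ''j'') (Read ''input'' (Add (Add (V ''z'') (Lit 3)) (V ''j'')))) t = upd t ''d'' (int k) (int (d (Suc k)))"
      using header(3)[OF k] b3 by (simp add: t j)
    have 2: "sem (Asg ''o'' (V ''j'') (V ''D'')) (upd t ''d'' (int k) (int (d (Suc k)))) = upd (upd t ''d'' (int k) (int (d (Suc k)))) ''o'' (int k) (int (off k))"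
      using b3 by (simp add: t j)
    have 3: "sem (Asg ''b'' (V ''j'') (V ''a'')) (upd (upd t ''d'' (int k) (int (d (Suc k)))) ''o'' (int k) (int (off k))) = t1"
      using b4 by (simp add: t j t1_def)
    define t2 where "t2 = upd t1 ''a'' 0 (int (z + 2 + m + 2 * n * off (Suc k)))"
    have 4: "sem (SetVar ''a'' (Add (V ''a'') (Mul (Mul (Lit 2) (V ''n'')) (Read ''d'' (V ''j''))))) t1 = t2"
    proof -
      have "aval t1 (Add (V ''a'') (Mul (Mul (Lit 2) (V ''n'')) (Read ''d'' (V ''j'')))) = int (z + 2 + m + 2 * n * off (Suc k))"
        by (simp add: t1_def t j off_Suc algebra_simps)
      thus ?thesis using b2 by (simp add: t2_def t1_def t del: aval.simps) (simp add: t1_def t)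
    qed
    have 5: "sem (SetVar ''D'' (Add (V ''D'') (Read ''d'' (V ''j'')))) t2 = upd t2 ''D'' 0 (int (off (Suc k)))"
      using b1 by (simp add: t2_def t1_def t j off_Suc)
    have body: "sem setup_block t = upd t2 ''D'' 0 (int (off (Suc k)))"
      by (simp only: setup_block_def sem.simps(3) 1 2 3 4 5)
    have "frame ?W s1 (upd (upd t2 ''D'' 0 (int (off (Suc k)))) ''j'' 0 (int (Suc k)))"
      unfolding t2_def t1_def by (intro frame_updI fr) auto
    thus "?I (Suc k) (upd (sem setup_block t) ''j'' 0 (int (Suc k)))"
      unfolding body using I by (auto simp: t2_def t1_def less_Suc_eq)
  qed
  note I = this
  define s2 where "s2 = sem (For ''j'' ''m'' setup_block) s1"
  have fr2: "frame ?W s1 s2" using I unfolding s2_def by blast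
  have s2: "s2 ''n'' 0 = int n" "s2 ''m'' 0 = int m" "s2 ''B'' = s ''B''" "s2 ''D'' 0 = int D"
    using I frameD[OF fr2] unfolding s2_def[symmetric] D_def by (simp_all add: s1_def)
  have s1': "sem (SetVar ''a'' (Add (Add (V ''z'') (Lit 2)) (V ''m''))) (sem (SetVar ''D'' (Lit 0))
      (sem (SetVar ''m'' (Read ''input'' (Add (V ''z'') (Lit 2)))) (sem (SetVar ''n'' (Read ''input'' (Add (V ''z'') (Lit 1)))) s))) = s1"
    using z header nB mB B0 by (simp add: s1_def algebra_simps)
  let ?K = "int (n ^ 3 * D ^ 2)"
  have nK: "0 \<le> int n * ?K" "0 \<le> ?K" by simp_all
  have "\<bar>?K\<bar> \<le> s ''B'' 0" "\<bar>?K + 1\<bar> \<le> s ''B'' 0" "\<bar>int n * ?K + 1\<bar> \<le> s ''B'' 0"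
    using nK K_le L_B by linarith+
  moreover have "int n * int n * int n * (int D * int D) = ?K" by (simp add: power3_eq_cube power2_eq_square)
  ultimately have "sem (SetVar ''T'' (Add (Mul (V ''n'') (V ''K'')) (Lit 1))) (sem (SetVar ''k'' (Add (V ''K'') (Lit 1)))
      (sem (SetVar ''K'' (Mul (Mul (Mul (V ''n'') (V ''n'')) (V ''n'')) (Mul (V ''D'') (V ''D'')))) s2))
    = upd (upd (upd s2 ''K'' 0 ?K) ''k'' 0 (?K + 1)) ''T'' 0 (int n * ?K + 1)"
    by (simp add: s2)
  hence \<sigma>: "\<sigma> = upd (upd (upd s2 ''K'' 0 ?K) ''k'' 0 (?K + 1)) ''T'' 0 (int n * ?K + 1)"
    unfolding \<sigma>_def setup_prog_def sem.simps(3) s1' s2_def .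
  show "\<sigma> ''n'' 0 = int n" "\<sigma> ''m'' 0 = int m" "\<sigma> ''D'' 0 = int D"
    "\<sigma> ''K'' 0 = int (n ^ 3 * D ^ 2)" "\<sigma> ''k'' 0 = \<sigma> ''K'' 0 + 1" "\<sigma> ''T'' 0 = int n * \<sigma> ''K'' 0 + 1"
    using s2 unfolding \<sigma> by simp_all
  show "\<sigma> ''d'' (int j) = int (d (Suc j))" "\<sigma> ''o'' (int j) = int (off j)"
    "\<sigma> ''b'' (int j) = int (z + 2 + m + 2 * n * off j)" if "j < m" for j
    using I that unfolding \<sigma> s2_def[symmetric] by simp_all
qed

section \<open>Computing the bounds\<close>

definition store_cost :: "nat \<Rightarrow> string \<Rightarrow> aexp \<Rightarrow> aexp \<Rightarrow> bool" where
  "store_cost C x a e \<longleftrightarrow> (\<forall>s \<beta>. mem_bounded \<beta> s \<longrightarrow>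
     (\<exists>t. exec (Store x a e) s t (upd s x (aval s a) (aval s e)) \<and> t \<le> C * (\<beta> + 1)))"

lemma store_cost_mono: "store_cost C x a e \<Longrightarrow> C \<le> C' \<Longrightarrow> store_cost C' x a e"
  unfolding store_cost_def by (meson mult_le_mono1 order_trans)

lemma common_store_cost: "\<exists>C. \<forall>x a e. (x, a, e) \<in> set ps \<longrightarrow> store_cost C x a e"
proof (induction ps)
  case (Cons p ps)
  obtain x a e where p: "p = (x, a, e)" by (cases p)
  obtain C where C: "\<And>x a e. (x, a, e) \<in> set ps \<Longrightarrow> store_cost C x a e" using Cons by blast
  obtain C' where C': "store_cost C' x a e" using exec_Store_bound unfolding store_cost_def by blast
  have "store_cost (C + C') x' a' e'" if "(x', a', e') \<in> set (p # ps)" for x' a' e'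
  proof (cases "(x', a', e') = p")
    case True
    thus ?thesis using store_cost_mono[OF C'] p by simp
  next
    case False
    hence "(x', a', e') \<in> set ps" using that by simp
    from store_cost_mono[OF C[OF this]] show ?thesis by simp
  qed
  thus ?case by blast
qed simp

text \<open>A positive multiple of \<open>z\<close> that is at least \<open>\<bar>z\<bar>\<close> and needs no absolute value. It is at least 2, so
  that the product over all cells exceeds their number.\<close>
definition factor :: "int \<Rightarrow> int" where
  "factor z = (if z = 0 then 2 else 2 * (z * z))"

definition factors :: "(int \<Rightarrow> int) \<Rightarrow> nat \<Rightarrow> int" where
  "factors g k = (\<Prod>a<k. factor (g (1 + int a)))"

definition cell_factor_step :: com where
  "cell_factor_step =
     Seq (Store ''i'' (Lit 0) (Add (Read ''i'' (Lit 0)) (Lit 1)))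
       (Cond (Equal (Read ''input'' (Read ''i'' (Lit 0))) (Lit 0))
         (Store ''W'' (Lit 0) (Mul (Read ''W'' (Lit 0)) (Lit 2)))
         (Store ''W'' (Lit 0) (Mul (Read ''W'' (Lit 0))
            (Mul (Lit 2) (Mul (Read ''input'' (Read ''i'' (Lit 0))) (Read ''input'' (Read ''i'' (Lit 0))))))))"

definition power_step :: com where
  "power_step =
     Seq (Store ''i'' (Lit 0) (Add (Read ''i'' (Lit 0)) (Lit 1)))
         (Store ''B'' (Lit 0) (Mul (Read ''B'' (Lit 0)) (Read ''W'' (Lit 0))))"

definition input_length :: aexp where
  "input_length = Read ''input'' (Lit 0)"

text \<open>These commands compute \<open>W\<close>, \<open>W ^ (4 * l + 1)\<close> and \<open>l ^ 5\<close>, where \<open>l\<close> is the length of the input and \<open>W\<close>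
  the product of the factors of its cells. They come before the caps exist and therefore are not
  part of the clamped language.\<close>
definition prelude :: com where
  "prelude =
     Seq (Store ''W'' (Lit 0) (Lit 1))
    (Seq (Store ''i'' (Lit 0) (Lit 0))
    (Seq (Loop (Less (Read ''i'' (Lit 0)) input_length) cell_factor_step)
    (Seq (Store ''B'' (Lit 0) (Read ''W'' (Lit 0)))
    (Seq (Store ''i'' (Lit 0) (Lit 0))
    (Seq (Loop (Less (Read ''i'' (Lit 0)) (Mul (Lit 4) input_length)) power_step)
         (Store ''L'' (Lit 0) (Mul (Mul (Mul (Mul input_length input_length) input_length) input_length) input_length)))))))"

lemma factor_pos: "2 \<le> factor z"
proof -
  have "1 \<le> z * z" if "z \<noteq> 0" using that by (simp add: int_one_le_iff_zero_less zero_less_mult_iff) linarith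
  thus ?thesis by (simp add: factor_def)
qed

lemma factor_nonneg: "0 \<le> factor z"
  using factor_pos[of z] by linarith

lemma abs_le_factor: "\<bar>z\<bar> \<le> factor z"
proof -
  have "\<bar>z\<bar> * 1 \<le> \<bar>z\<bar> * \<bar>z\<bar>" if "z \<noteq> 0" using that by (intro mult_left_mono) auto
  hence "\<bar>z\<bar> \<le> z * z" if "z \<noteq> 0" using that by (simp flip: abs_mult)
  thus ?thesis by (auto simp: factor_def)
qed

lemma dvd_factor: "z \<noteq> 0 \<Longrightarrow> z dvd factor z"
  by (simp add: factor_def)

lemma factor_le: "factor z \<le> 2 ^ (2 * bit_size z)"
proof -
  obtain p where p: "bit_size z = Suc p" using bit_size_pos[of z] by (metis One_nat_def Suc_le_D)
  have z: "\<bar>z\<bar> \<le> 2 ^ p" using abs_less_bit_size[of z] p by simp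
  have "\<bar>z\<bar> * \<bar>z\<bar> \<le> 2 ^ p * 2 ^ p" by (rule mult_mono[OF z z]) auto
  hence "2 * (z * z) \<le> 2 * (2 ^ p * 2 ^ p)" by (simp flip: abs_mult)
  also have "\<dots> = 2 ^ (p + p + 1)" by (simp add: power_add)
  also have "\<dots> \<le> (2 :: int) ^ (2 * Suc p)" by (rule power_increasing) auto
  finally have "2 * (z * z) \<le> 2 ^ (2 * bit_size z)" unfolding p .
  moreover have "(2 :: int) ^ 1 \<le> 2 ^ (2 * bit_size z)" using bit_size_pos[of z] by (intro power_increasing) auto
  ultimately show ?thesis by (cases "z = 0") (simp_all add: factor_def)
qed

lemma factors_mono: "j \<le> k \<Longrightarrow> factors g j \<le> factors g k" and factors_ge_1: "1 \<le> factors g k"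
proof -
  show 1: "1 \<le> factors g k" for k
    unfolding factors_def by (rule prod_ge_1) (use factor_pos in \<open>auto intro: order_trans[of 1 2]\<close>)
  show "j \<le> k \<Longrightarrow> factors g j \<le> factors g k"
  proof (induction k)
    case (Suc k)
    have "factors g k * 1 \<le> factors g k * factor (g (1 + int k))"
      using 1[of k] factor_pos[of "g (1 + int k)"] by (intro mult_left_mono) auto
    hence "factors g k \<le> factors g (Suc k)" by (simp add: factors_def)
    thus ?case using Suc by (cases "j = Suc k") auto
  qed simp
qed

lemma two_power_le_factors: "2 ^ k \<le> factors g k"
proof -
  have "(\<Prod>a<k. (2::int)) \<le> factors g k"
    unfolding factors_def by (rule prod_mono) (use factor_pos in auto)
  thus ?thesis by simp
qed

lemma factor_dvd_factors: "a < k \<Longrightarrow> factor (g (1 + int a)) dvd factors g k"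
  unfolding factors_def by (rule dvd_prodI) auto

lemma factors_input_le: "k \<le> length zs \<Longrightarrow> factors (list_array zs) k \<le> 2 ^ (2 * input_size zs)"
proof -
  assume k: "k \<le> length zs"
  have "factors (list_array zs) k \<le> factors (list_array zs) (length zs)" by (rule factors_mono[OF k])
  also have "\<dots> = (\<Prod>a<length zs. factor (zs ! a))"
    unfolding factors_def by (rule prod.cong) (auto simp: list_array_def nat_add_distrib)
  also have "\<dots> \<le> (\<Prod>a<length zs. 2 ^ (2 * bit_size (zs ! a)))"
    by (rule prod_mono) (simp add: factor_le factor_nonneg)
  also have "\<dots> = 2 ^ (\<Sum>a<length zs. 2 * bit_size (zs ! a))" by (rule power_sum[symmetric])
  also have "(\<Sum>a<length zs. 2 * bit_size (zs ! a)) = 2 * input_size zs"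
    by (simp add: input_size_def sum_list_sum_nth lessThan_atLeast0 sum_distrib_left)
  finally show ?thesis .
qed

lemma length_le_input_size: "length zs \<le> input_size zs"
proof (induction zs)
  case (Cons z zs)
  thus ?case using bit_size_pos[of z] by (simp add: input_size_def)
qed (simp add: input_size_def)

lemma of_nat_less_two_power: "int k < 2 ^ k"
  using of_nat_less_two_power[of k, where 'a = int] by simp

text \<open>The number \<open>\<beta>\<close> of bits is polynomial: \<open>W\<close> has at most twice as many bits as the input, and \<open>''B''\<close> is a
  power of \<open>W\<close> with exponent linear in the length.\<close>
lemma prelude_exec:
  "\<exists>C. \<forall>s zs. s ''input'' = list_array zs \<longrightarrow> zs \<noteq> [] \<longrightarrow>
     (let l = length zs; W = factors (list_array zs) l; \<beta> = 2 * input_size zs * (4 * l + 1) + 1 in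
      mem_bounded \<beta> s \<longrightarrow>
      (\<exists>t s'. exec prelude s t s' \<and> t \<le> C * (l + 1) * (\<beta> + 1) \<and> mem_bounded \<beta> s' \<and>
         frame {''W'', ''B'', ''L'', ''i''} s s' \<and>
         s' ''W'' 0 = W \<and> s' ''B'' 0 = W ^ (4 * l + 1) \<and> s' ''L'' 0 = int l ^ 5))"
proof -
  let ?inc = "(''i'', Lit 0, Add (Read ''i'' (Lit 0)) (Lit 1))"
  let ?w2 = "(''W'', Lit 0, Mul (Read ''W'' (Lit 0)) (Lit 2))"
  let ?wx = "(''W'', Lit 0, Mul (Read ''W'' (Lit 0))
            (Mul (Lit 2) (Mul (Read ''input'' (Read ''i'' (Lit 0))) (Read ''input'' (Read ''i'' (Lit 0))))))"
  let ?bw = "(''B'', Lit 0, Mul (Read ''B'' (Lit 0)) (Read ''W'' (Lit 0)))"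
  let ?l5 = "(''L'', Lit 0, Mul (Mul (Mul (Mul input_length input_length) input_length) input_length) input_length)"
  let ?stores = "[?inc, ?w2, ?wx, ?bw, ?l5, (''W'', Lit 0, Lit 1), (''i'', Lit 0, Lit 0), (''B'', Lit 0, Read ''W'' (Lit 0))]"
  let ?b1 = "Less (Read ''i'' (Lit 0)) input_length" and ?b2 = "Less (Read ''i'' (Lit 0)) (Mul (Lit 4) input_length)"
  let ?bc = "Equal (Read ''input'' (Read ''i'' (Lit 0))) (Lit 0)"
  obtain C0 where C0: "\<And>x a e. (x, a, e) \<in> set ?stores \<Longrightarrow> store_cost C0 x a e"
    using common_store_cost[of ?stores] by blast
  obtain D1 where D1: "\<And>s \<beta>. mem_bounded \<beta> s \<Longrightarrow> bcost s ?b1 \<le> D1 * (\<beta> + 1)" using bcost_bound by metis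
  obtain D2 where D2: "\<And>s \<beta>. mem_bounded \<beta> s \<Longrightarrow> bcost s ?b2 \<le> D2 * (\<beta> + 1)" using bcost_bound by metis
  obtain D3 where D3: "\<And>s \<beta>. mem_bounded \<beta> s \<Longrightarrow> bcost s ?bc \<le> D3 * (\<beta> + 1)" using bcost_bound by metis
  \<comment> \<open>One constant for all assignments and tests. With it a round of either loop costs at most
    \<open>4 * c * (\<beta> + 1)\<close>, and the loops have \<open>l\<close> and \<open>4 * l\<close> rounds, whence the factor 50 below.\<close>
  define c where "c = 2 * C0 + D1 + D2 + D3 + 1"
  show ?thesis
  proof (rule exI[of _ "50 * c"], intro allI impI, unfold Let_def, intro impI)
    fix s :: mem and zs
    let ?l = "length zs" and ?W = "factors (list_array zs) (length zs)"
    let ?\<beta> = "2 * input_size zs * (4 * length zs + 1) + 1"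
    assume inp: "s ''input'' = list_array zs" and ne: "zs \<noteq> []" and bs: "mem_bounded ?\<beta> s"
    define \<beta> where "\<beta> = ?\<beta>"
    define cc where "cc = c * (\<beta> + 1)"
    have l: "1 \<le> ?l" "?l \<le> input_size zs" using ne length_le_input_size[of zs] by (simp_all add: Suc_le_eq)
    have W1: "1 \<le> ?W" by (rule factors_ge_1)
    have Wle: "?W \<le> 2 ^ (2 * input_size zs)" by (rule factors_input_le) simp
    have \<beta>_less: "?W ^ k < 2 ^ \<beta>" if "k \<le> 4 * ?l + 1" for k
    proof -
      have "?W ^ k \<le> (2 ^ (2 * input_size zs)) ^ k" using W1 Wle by (intro power_mono) auto
      also have "\<dots> = 2 ^ (2 * input_size zs * k)" by (simp add: power_mult)
      also have "\<dots> \<le> 2 ^ (2 * input_size zs * (4 * ?l + 1))"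
        using that by (intro power_increasing mult_le_mono2) auto
      also have "\<dots> < 2 ^ \<beta>" unfolding \<beta>_def by (intro power_strict_increasing) auto
      finally show ?thesis .
    qed
    have small: "int k < 2 ^ \<beta>" if "k \<le> 4 * ?l + 1" for k
    proof -
      have "int k < 2 ^ k" by (rule of_nat_less_two_power)
      also have "\<dots> \<le> 2 ^ \<beta>"
      proof (rule power_increasing)
        have "1 * (4 * ?l + 1) \<le> 2 * input_size zs * (4 * ?l + 1)" using l by (intro mult_le_mono1) simp
        hence "k \<le> 2 * input_size zs * (4 * ?l + 1)" using that unfolding mult_1 by (rule le_trans[rotated])
        thus "k \<le> \<beta>" unfolding \<beta>_def by (rule trans_le_add1)
      qed simp
      finally show ?thesis .
    qed
    have l5: "int ?l ^ 5 < 2 ^ \<beta>"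
    proof -
      have "int ?l \<le> ?W" using of_nat_less_two_power[of ?l] two_power_le_factors[of ?l "list_array zs"] by linarith
      hence "int ?l ^ 5 \<le> ?W ^ 5" by (intro power_mono) auto
      also have "\<dots> < 2 ^ \<beta>" using l(1) by (intro \<beta>_less) simp
      finally show ?thesis .
    qed
    have store: "\<exists>t. exec (Store x a e) u t (upd u x (aval u a) (aval u e)) \<and> t \<le> cc"
      if st: "(x, a, e) \<in> set ?stores" and bd: "mem_bounded \<beta> u" for x a e u
    proof -
      obtain t where "exec (Store x a e) u t (upd u x (aval u a) (aval u e))" "t \<le> C0 * (\<beta> + 1)"
        using C0[OF st] bd unfolding store_cost_def by blast
      moreover have "C0 * (\<beta> + 1) \<le> cc" unfolding cc_def c_def by (intro mult_le_mono1) simp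
      ultimately show ?thesis by (meson order_trans)
    qed
    have cells: "list_array zs 0 = int ?l" by (simp add: list_array_def)
    let ?F = "\<lambda>u. frame {''W'', ''B'', ''L'', ''i''} s u \<and> mem_bounded \<beta> u"
    have Fi: "u ''input'' = list_array zs" if "?F u" for u using that inp by (simp add: frame_def)
    have step: "?F (upd u x 0 z)" if "?F u" "x \<in> {''W'', ''B'', ''L'', ''i''}" "\<bar>z\<bar> < 2 ^ \<beta>" for u x z
      using that by (auto intro: frame_updI bounded_upd)
    define s1 where "s1 = upd s ''W'' 0 1"
    define s2 where "s2 = upd s1 ''i'' 0 0"
    have one: "(1::int) < 2 ^ \<beta>" using small[of 1] by simp
    have F0: "?F s" using bs by (simp add: \<beta>_def)
    have F1: "?F s1" unfolding s1_def by (rule step[OF F0]) (use one in auto)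
    have F2: "?F s2" unfolding s2_def by (rule step[OF F1]) auto
    obtain t1 where t1: "exec (Store ''W'' (Lit 0) (Lit 1)) s t1 s1" "t1 \<le> cc"
      using store[of "''W''" "Lit 0" "Lit 1" s] F0 by (auto simp: s1_def)
    obtain t2 where t2: "exec (Store ''i'' (Lit 0) (Lit 0)) s1 t2 s2" "t2 \<le> cc"
      using store[of "''i''" "Lit 0" "Lit 0" s1] F1 by (auto simp: s2_def)
    define c3 where "c3 = 3 * cc + 1"
    let ?I1 = "\<lambda>k u. ?F u \<and> u ''i'' 0 = int k \<and> u ''W'' 0 = factors (list_array zs) k \<and> k \<le> ?l"
    have b1: "bcost u ?b1 \<le> c3" "bcost u ?b2 \<le> c3" "bcost u ?bc \<le> cc" if "?F u" for u
    proof -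
      have "D1 * (\<beta> + 1) \<le> cc" "D2 * (\<beta> + 1) \<le> cc" "D3 * (\<beta> + 1) \<le> cc"
        unfolding cc_def c_def by (intro mult_le_mono1; simp)+
      thus "bcost u ?b1 \<le> c3" "bcost u ?b2 \<le> c3" "bcost u ?bc \<le> cc"
        using D1[of \<beta> u] D2[of \<beta> u] D3[of \<beta> u] that unfolding c3_def by linarith+
    qed
    have body1: "\<exists>t u'. exec cell_factor_step u t u' \<and> t \<le> c3 \<and> ?I1 (Suc k) u'" if k: "k < ?l" and I: "?I1 k u" for k u
    proof -
      define u1 where "u1 = upd u ''i'' 0 (int k + 1)"
      have F: "?F u" using I by blast
      have F1: "?F u1" unfolding u1_def by (rule step[OF F]) (use small[of "Suc k"] k in auto)
      obtain t where t: "exec (Store ''i'' (Lit 0) (Add (Read ''i'' (Lit 0)) (Lit 1))) u t u1" "t \<le> cc"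
        using store[of "''i''" "Lit 0" "Add (Read ''i'' (Lit 0)) (Lit 1)" u] F I by (auto simp: u1_def)
      define u2 where "u2 = upd u1 ''W'' 0 (factors (list_array zs) (Suc k))"
      have "factors (list_array zs) (Suc k) \<le> ?W" by (rule factors_mono) (use k in simp)
      hence "\<bar>factors (list_array zs) (Suc k)\<bar> < 2 ^ \<beta>"
        using \<beta>_less[of 1] factors_ge_1[of "list_array zs" "Suc k"] by simp
      hence F2: "?F u2" unfolding u2_def by (intro step[OF F1]) auto
      have r: "u1 ''input'' (u1 ''i'' 0) = list_array zs (1 + int k)" "u1 ''W'' 0 = factors (list_array zs) k"
        using Fi[OF F1] I by (simp_all add: u1_def add.commute)
      have fs: "factors (list_array zs) (Suc k) = factors (list_array zs) k * factor (list_array zs (1 + int k))"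
        by (simp add: factors_def)
      obtain t' where t': "exec (Cond ?bc (Store ''W'' (Lit 0) (Mul (Read ''W'' (Lit 0)) (Lit 2)))
         (Store ''W'' (Lit 0) (Mul (Read ''W'' (Lit 0))
            (Mul (Lit 2) (Mul (Read ''input'' (Read ''i'' (Lit 0))) (Read ''input'' (Read ''i'' (Lit 0)))))))) u1 t' u2" "t' \<le> 1 + cc + cc"
      proof (cases "list_array zs (1 + int k) = 0")
        case True
        obtain t' where t': "exec (Store ''W'' (Lit 0) (Mul (Read ''W'' (Lit 0)) (Lit 2))) u1 t' u2" "t' \<le> cc"
          using store[of "''W''" "Lit 0" "Mul (Read ''W'' (Lit 0)) (Lit 2)" u1] F1 r True
          by (auto simp: u2_def fs factor_def)
        have "bval u1 ?bc" using r True by simp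
        from exec.CondTrue[OF this t'(1)] show ?thesis using t'(2) b1(3)[OF F1] by (intro that) auto
      next
        case False
        obtain t' where t': "exec (Store ''W'' (Lit 0) (Mul (Read ''W'' (Lit 0))
            (Mul (Lit 2) (Mul (Read ''input'' (Read ''i'' (Lit 0))) (Read ''input'' (Read ''i'' (Lit 0))))))) u1 t' u2" "t' \<le> cc"
          using store[of "''W''" "Lit 0" "Mul (Read ''W'' (Lit 0))
            (Mul (Lit 2) (Mul (Read ''input'' (Read ''i'' (Lit 0))) (Read ''input'' (Read ''i'' (Lit 0)))))" u1] F1 r False
          by (auto simp: u2_def fs factor_def)
        have "\<not> bval u1 ?bc" using r False by simp
        from exec.CondFalse[OF this t'(1)] show ?thesis using t'(2) b1(3)[OF F1] by (intro that) auto
      qed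
      have "exec cell_factor_step u (t + t') u2" unfolding cell_factor_step_def by (rule exec.Seq[OF t(1) t'(1)])
      moreover have "t + t' \<le> c3" using t(2) t'(2) by (simp add: c3_def)
      moreover have "?I1 (Suc k) u2" using F2 k by (simp add: u2_def u1_def)
      ultimately show ?thesis by blast
    qed
    have len: "aval u input_length = int ?l" if "?F u" for u using Fi[OF that] by (simp add: input_length_def cells)
    have "\<exists>t u'. exec (Loop ?b1 cell_factor_step) s2 t u' \<and> t \<le> (?l + 1) * (2 * c3 + 1) \<and> ?I1 ?l u'"
    proof (rule exec_Loop_count[where I = ?I1])
      fix k u assume k: "k < ?l" and I: "?I1 k u"
      have "bval u ?b1" using I k len[of u] by simp
      thus "bval u ?b1 \<and> bcost u ?b1 \<le> c3 \<and> (\<exists>t s'. exec cell_factor_step u t s' \<and> t \<le> c3 \<and> ?I1 (Suc k) s')"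
        using b1(1)[of u] body1[OF k I] I by blast
    next
      fix u assume I: "?I1 ?l u"
      have "\<not> bval u ?b1" using I len[of u] by simp
      thus "\<not> bval u ?b1 \<and> bcost u ?b1 \<le> c3" using b1(1)[of u] I by blast
    next
      show "?I1 0 s2" using F2 by (simp add: s2_def s1_def factors_def)
    qed
    then obtain t3 s3 where t3: "exec (Loop ?b1 cell_factor_step) s2 t3 s3" "t3 \<le> (?l + 1) * (2 * c3 + 1)" "?I1 ?l s3" by blast
    define s4 where "s4 = upd s3 ''B'' 0 ?W"
    define s5 where "s5 = upd s4 ''i'' 0 0"
    have F3: "?F s3" using t3(3) by blast
    have F4: "?F s4" unfolding s4_def by (rule step[OF F3]) (use \<beta>_less[of 1] W1 in auto)
    have F5: "?F s5" unfolding s5_def by (rule step[OF F4]) auto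
    obtain t4 where t4: "exec (Store ''B'' (Lit 0) (Read ''W'' (Lit 0))) s3 t4 s4" "t4 \<le> cc"
      using store[of "''B''" "Lit 0" "Read ''W'' (Lit 0)" s3] t3(3) by (auto simp: s4_def)
    obtain t5 where t5: "exec (Store ''i'' (Lit 0) (Lit 0)) s4 t5 s5" "t5 \<le> cc"
      using store[of "''i''" "Lit 0" "Lit 0" s4] F4 by (auto simp: s5_def)
    let ?I2 = "\<lambda>k u. ?F u \<and> u ''i'' 0 = int k \<and> u ''W'' 0 = ?W \<and> u ''B'' 0 = ?W ^ (k + 1)"
    have body2: "\<exists>t u'. exec power_step u t u' \<and> t \<le> c3 \<and> ?I2 (Suc k) u'" if k: "k < 4 * ?l" and I: "?I2 k u" for k u
    proof -
      define u1 where "u1 = upd u ''i'' 0 (int k + 1)"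
      define u2 where "u2 = upd u1 ''B'' 0 (?W ^ (Suc k + 1))"
      have F: "?F u" using I by blast
      have F1: "?F u1" unfolding u1_def by (rule step[OF F]) (use small[of "Suc k"] k in auto)
      have "0 \<le> ?W ^ (Suc k + 1)" using W1 by (intro zero_le_power) simp
      hence "\<bar>?W ^ (Suc k + 1)\<bar> < 2 ^ \<beta>" using \<beta>_less[of "Suc k + 1"] k by simp
      hence F2: "?F u2" unfolding u2_def by (intro step[OF F1]) auto
      obtain t where t: "exec (Store ''i'' (Lit 0) (Add (Read ''i'' (Lit 0)) (Lit 1))) u t u1" "t \<le> cc"
        using store[of "''i''" "Lit 0" "Add (Read ''i'' (Lit 0)) (Lit 1)" u] F I by (auto simp: u1_def)
      obtain t' where t': "exec (Store ''B'' (Lit 0) (Mul (Read ''B'' (Lit 0)) (Read ''W'' (Lit 0)))) u1 t' u2" "t' \<le> cc"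
        using store[of "''B''" "Lit 0" "Mul (Read ''B'' (Lit 0)) (Read ''W'' (Lit 0))" u1] F1 I
        by (auto simp: u2_def u1_def mult.commute mult.left_commute)
      have "exec power_step u (t + t') u2" unfolding power_step_def by (rule exec.Seq[OF t(1) t'(1)])
      moreover have "t + t' \<le> c3" using t(2) t'(2) by (simp add: c3_def)
      moreover have "?I2 (Suc k) u2" using F2 I by (simp add: u2_def u1_def)
      ultimately show ?thesis by blast
    qed
    have "\<exists>t u'. exec (Loop ?b2 power_step) s5 t u' \<and> t \<le> (4 * ?l + 1) * (2 * c3 + 1) \<and> ?I2 (4 * ?l) u'"
    proof (rule exec_Loop_count[where I = ?I2])
      fix k u assume k: "k < 4 * ?l" and I: "?I2 k u"
      have "bval u ?b2" using I k len[of u] by simp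
      thus "bval u ?b2 \<and> bcost u ?b2 \<le> c3 \<and> (\<exists>t s'. exec power_step u t s' \<and> t \<le> c3 \<and> ?I2 (Suc k) s')"
        using b1(2)[of u] body2[OF k I] I by blast
    next
      fix u assume I: "?I2 (4 * ?l) u"
      have "\<not> bval u ?b2" using I len[of u] by simp
      thus "\<not> bval u ?b2 \<and> bcost u ?b2 \<le> c3" using b1(2)[of u] I by blast
    next
      show "?I2 0 s5" using F5 t3(3) by (simp add: s5_def s4_def)
    qed
    then obtain t6 s6 where t6: "exec (Loop ?b2 power_step) s5 t6 s6" "t6 \<le> (4 * ?l + 1) * (2 * c3 + 1)" "?I2 (4 * ?l) s6" by blast
    define s7 where "s7 = upd s6 ''L'' 0 (int ?l ^ 5)"
    have F6: "?F s6" using t6(3) by blast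
    have F7: "?F s7" unfolding s7_def by (rule step[OF F6]) (use l5 in auto)
    have pow5: "x * x * x * x * x = x ^ 5" for x :: int by (simp add: eval_nat_numeral)
    obtain t7 where t7: "exec (Store ''L'' (Lit 0) (Mul (Mul (Mul (Mul input_length input_length) input_length) input_length) input_length)) s6 t7 s7" "t7 \<le> cc"
      using store[of "''L''" "Lit 0" "Mul (Mul (Mul (Mul input_length input_length) input_length) input_length) input_length" s6] F6
      by (auto simp: s7_def len pow5)
    have "exec prelude s (t1 + (t2 + (t3 + (t4 + (t5 + (t6 + t7)))))) s7"
      unfolding prelude_def
      by (rule exec.Seq[OF t1(1) exec.Seq[OF t2(1) exec.Seq[OF t3(1) exec.Seq[OF t4(1) exec.Seq[OF t5(1) exec.Seq[OF t6(1) t7(1)]]]]]])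
    moreover have "t1 + (t2 + (t3 + (t4 + (t5 + (t6 + t7))))) \<le> 50 * c * (?l + 1) * (\<beta> + 1)"
    proof -
      have cc1: "1 \<le> cc" by (simp add: cc_def c_def)
      have c3: "2 * c3 + 1 \<le> 9 * cc" using cc1 by (simp add: c3_def)
      have "t3 + t6 \<le> (?l + 1) * (2 * c3 + 1) + (4 * ?l + 1) * (2 * c3 + 1)" using t3(2) t6(2) by linarith
      also have "\<dots> = (5 * ?l + 2) * (2 * c3 + 1)" by (simp add: algebra_simps)
      also have "\<dots> \<le> (5 * (?l + 1)) * (9 * cc)" by (rule mult_le_mono[OF _ c3]) simp
      finally have "t3 + t6 \<le> 45 * ((?l + 1) * cc)" by (simp only: mult.assoc mult.left_commute)
      moreover have "1 * cc \<le> (?l + 1) * cc" by (rule mult_le_mono1) simp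
      ultimately have "t1 + (t2 + (t3 + (t4 + (t5 + (t6 + t7))))) \<le> 50 * ((?l + 1) * cc)"
        using t1(2) t2(2) t4(2) t5(2) t7(2) by linarith
      also have "50 * ((?l + 1) * cc) = 50 * c * (?l + 1) * (\<beta> + 1)" unfolding cc_def by (simp only: ac_simps)
      finally show ?thesis .
    qed
    moreover have "mem_bounded \<beta> s7" "frame {''W'', ''B'', ''L'', ''i''} s s7" using F7 by blast+
    moreover have "s7 ''W'' 0 = ?W" "s7 ''B'' 0 = ?W ^ (4 * ?l + 1)" "s7 ''L'' 0 = int ?l ^ 5"
      using t6(3) by (simp_all add: s7_def)
    ultimately show "\<exists>t s'. exec prelude s t s' \<and> t \<le> 50 * c * (?l + 1) * (?\<beta> + 1) \<and> mem_bounded ?\<beta> s' \<and>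
         frame {''W'', ''B'', ''L'', ''i''} s s' \<and>
         s' ''W'' 0 = ?W \<and> s' ''B'' 0 = ?W ^ (4 * ?l + 1) \<and> s' ''L'' 0 = int ?l ^ 5"
      unfolding \<beta>_def by blast
  qed
qed

section \<open>The complete algorithm\<close>

lemma list_array_nth: "a < length zs \<Longrightarrow> list_array zs (1 + int a) = zs ! a"
  by (simp add: list_array_def nat_add_distrib)

lemma list_array_le_factors: "\<bar>list_array zs a\<bar> \<le> factors (list_array zs) (length zs)"
proof -
  let ?W = "factors (list_array zs) (length zs)"
  consider "a = 0" | "1 \<le> a" "a \<le> int (length zs)" | "a \<noteq> 0" "\<not> (1 \<le> a \<and> a \<le> int (length zs))" by blast
  thus ?thesis
  proof cases
    case 1
    have "int (length zs) < 2 ^ length zs" by (rule of_nat_less_two_power)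
    also have "\<dots> \<le> ?W" by (rule two_power_le_factors)
    finally show ?thesis using 1 by (simp add: list_array_def)
  next
    case 2
    define b where "b = nat a - 1"
    have b: "b < length zs" "a = 1 + int b" using 2 by (auto simp: b_def)
    have "\<bar>list_array zs a\<bar> \<le> factor (list_array zs a)" by (rule abs_le_factor)
    also have "\<dots> \<le> ?W"
    proof (rule zdvd_imp_le)
      show "factor (list_array zs a) dvd ?W" unfolding b(2) by (rule factor_dvd_factors[OF b(1)])
      show "0 < ?W" using factors_ge_1[of "list_array zs" "length zs"] by linarith
    qed
    finally show ?thesis .
  next
    case 3
    thus ?thesis using factors_ge_1[of "list_array zs" "length zs"] by (auto simp: list_array_def)
  qed
qed

lemma bit_size_le_input_size: "z \<in> set zs \<Longrightarrow> bit_size z \<le> input_size zs"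
  unfolding input_size_def by (rule member_le_sum_list) simp_all

lemma initial_mem_bounded:
  assumes "zs \<noteq> []"
  shows "mem_bounded (2 * input_size zs * (4 * length zs + 1) + 1) (initial_mem zs [])"
  unfolding mem_bounded_def
proof (intro allI)
  fix x a
  let ?\<beta> = "2 * input_size zs * (4 * length zs + 1) + 1"
  have le: "k \<le> ?\<beta>" if "k \<le> input_size zs" for k
  proof -
    have "input_size zs * 1 \<le> (2 * input_size zs) * (4 * length zs + 1)" by (intro mult_le_mono) auto
    thus ?thesis using that by linarith
  qed
  have "\<bar>list_array zs a\<bar> < 2 ^ ?\<beta>"
  proof -
    consider "a = 0" | "1 \<le> a" "a \<le> int (length zs)" | "a \<noteq> 0" "\<not> (1 \<le> a \<and> a \<le> int (length zs))" by blast
    thus ?thesis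
    proof cases
      case 1
      have "int (length zs) < 2 ^ length zs" by (rule of_nat_less_two_power)
      also have "\<dots> \<le> 2 ^ ?\<beta>" by (intro power_increasing le length_le_input_size) simp
      finally show ?thesis using 1 by (simp add: list_array_def)
    next
      case 2
      hence z: "list_array zs a \<in> set zs" by (simp add: list_array_def)
      have "\<bar>list_array zs a\<bar> < 2 ^ (bit_size (list_array zs a) - 1)" by (rule abs_less_bit_size)
      also have "\<dots> \<le> 2 ^ ?\<beta>" using bit_size_le_input_size[OF z] by (intro power_increasing le) auto
      finally show ?thesis .
    qed (auto simp: list_array_def)
  qed
  thus "\<bar>initial_mem zs [] x a\<bar> < 2 ^ ?\<beta>" by (auto simp: initial_mem_def list_array_def)
qed

definition body_prog :: prog where
  "body_prog = Sq setup_prog (Sq descent emit_answer)"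

text \<open>The parameter is the number of input cells before the instance. It is 0 for the deterministic
  algorithm and 2 for a round of the probabilistic one, whose input starts with the encoded error
  bound.\<close>
definition srsr_com :: "int \<Rightarrow> com" where
  "srsr_com z = Seq (Store ''z'' (Lit 0) (Lit z)) (Seq prelude (compile body_prog))"

lemma wf_body_prog: "wf_prog body_prog"
  by (simp add: body_prog_def setup_prog_def setup_block_def descent_def scan_levels_def update_point_def
      emit_answer_def append_out_def reset_rows_def process_level_def process_element_def record_level_def
      insert_element_def insert_row_def load_row_def reduce_row_def find_pivot_def push_row_def
      emit_block_def select_basis_def emit_vectors_def emit_vector_def)

text \<open>With \<open>N = n * D\<close> the left-hand side is at most \<open>5 * N ^ 4\<close>, and both 5 and \<open>N\<close> are below the length.\<close>
lemma descent_time_cap: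
  fixes n D l :: nat
  assumes "n \<ge> 1" "D \<ge> 1" "3 + 2 * (n * D) \<le> l"
  shows "int n * int (n ^ 3 * D ^ 2) + 2 * int (n ^ 3 * D ^ 2) + 2 \<le> int l ^ 5"
proof -
  define N where "N = n * D"
  have "1 * 1 \<le> n * D" by (rule mult_le_mono[OF assms(1,2)])
  hence N: "1 \<le> N" "N \<le> l" "5 \<le> l" using assms(3) unfolding N_def by linarith+
  have D: "D ^ 2 \<le> D ^ 3" using assms(2) by (intro power_increasing) auto
  have K: "n ^ 3 * D ^ 2 \<le> N ^ 3" using D by (simp add: N_def power_mult_distrib)
  have "n * 1 \<le> n * D" using assms(2) by (intro mult_le_mono2)
  hence "n * (n ^ 3 * D ^ 2) \<le> N * N ^ 3" using K by (intro mult_le_mono) (simp_all add: N_def)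
  moreover have "N ^ 3 \<le> N ^ 4" "1 \<le> N ^ 4" using N(1) by (auto intro: power_increasing one_le_power)
  moreover have "N * N ^ 3 = N ^ 4" by (simp add: eval_nat_numeral)
  ultimately have "n * (n ^ 3 * D ^ 2) + 2 * (n ^ 3 * D ^ 2) + 2 \<le> 5 * N ^ 4" using K by linarith
  also have "\<dots> \<le> l * l ^ 4" using N by (intro mult_le_mono power_mono) auto
  also have "\<dots> = l ^ 5" by (simp add: eval_nat_numeral)
  finally have "int (n * (n ^ 3 * D ^ 2) + 2 * (n ^ 3 * D ^ 2) + 2) \<le> int (l ^ 5)" by (simp only: of_nat_le_iff)
  thus ?thesis by simp
qed

context srsr_data
begin

text \<open>The caps suffice: \<open>W ^ (3 * l)\<close> dominates \<open>fact (D + 1) * (W * W) ^ (D + 1)\<close>, since \<open>D + 1 \<le> l \<le> W\<close>, and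
  \<open>W ^ 5\<close> dominates \<open>l ^ 5\<close>.\<close>
lemma body_prog_correct:
  fixes zs :: "int list" and z :: nat
  assumes zs: "zs = pre @ code" "length pre = z"
    and s: "s ''z'' 0 = int z" "s ''input'' = list_array zs"
      "s ''W'' 0 = factors (list_array zs) (length zs)"
      "s ''B'' 0 = s ''W'' 0 ^ (4 * length zs + 1)" "s ''L'' 0 = int (length zs) ^ 5"
    and zero: "\<And>x. x \<in> {''X'', ''S'', ''A'', ''output''} \<Longrightarrow> s x = (\<lambda>_. 0)"
  shows "correct_output (output_of (sem body_prog s))"
proof -
  define l where "l = length zs"
  define W where "W = factors (list_array zs) l"
  have W1: "1 \<le> W" unfolding W_def by (rule factors_ge_1)
  have W2: "2 ^ l \<le> W" unfolding W_def by (rule two_power_le_factors)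
  have lW: "int l \<le> W" using of_nat_less_two_power[of l] W2 by linarith
  have len: "l = z + (2 + m + 2 * n * D)" using zs by (simp add: l_def code_length)
  have cell: "list_array zs (int (z + 1 + a)) = code ! a" if "a < length code" for a
  proof -
    have "list_array zs (1 + int (z + a)) = zs ! (z + a)" by (rule list_array_nth) (use zs that in simp)
    also have "\<dots> = code ! a" using zs by (simp add: nth_append)
    finally show ?thesis by (simp add: ac_simps)
  qed
  have cell_le: "\<bar>list_array zs a\<bar> \<le> W" for a unfolding W_def l_def by (rule list_array_le_factors)
  have cell_dvd: "code ! a dvd W" if "a < length code" "code ! a \<noteq> 0" for a
  proof -
    have a: "z + a < l" using that zs by (simp add: l_def)
    have "list_array zs (1 + int (z + a)) = code ! a" using cell[OF that(1)] by (simp add: ac_simps)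
    moreover from this have "code ! a dvd factor (list_array zs (1 + int (z + a)))" using dvd_factor that(2) by simp
    ultimately show ?thesis using factor_dvd_factors[OF a, of "list_array zs"] dvd_trans unfolding W_def by blast
  qed
  have entry: "code ! (2 + m + 2 * n * off j + (2 * i * d (Suc j) + 2 * x)) = fst (quotient_of (v (Suc j) (Suc i) $ x)) \<and>
      code ! (2 + m + 2 * n * off j + (2 * i * d (Suc j) + (2 * x + 1))) = snd (quotient_of (v (Suc j) (Suc i) $ x)) \<and>
      2 + m + 2 * n * off j + (2 * i * d (Suc j) + (2 * x + 1)) < length code"
    if "i < n" "j < m" "x < d (Suc j)" for i j x
    using code_entry[OF that(1,2), of "2 * x"] code_entry[OF that(1,2), of "2 * x + 1"] that(3)
      nth_encode_vec[of x "v (Suc j) (Suc i)"] v_carrier[OF that(1,2)] by simp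
  \<comment> \<open>Every denominator is a nonzero input cell, hence divides \<open>W\<close>.\<close>
  have den_dvd: "snd (quotient_of (v (Suc j) (Suc i) $ x)) dvd W" if "i < n" "j < m" "x < d (Suc j)" for i j x
  proof -
    have "snd (quotient_of (v (Suc j) (Suc i) $ x)) \<noteq> 0" using quotient_of_denom_pos'[of "v (Suc j) (Suc i) $ x"] by simp
    thus ?thesis using cell_dvd entry[OF that] by metis
  qed
  interpret srsr_problem n m d v W
    by unfold_locales (use W1 den_dvd in auto)
  have U_le: "\<bar>U p x\<bar> \<le> W * W" if pin: "p \<in> pairs {..<n}" for p x
  proof -
    obtain i j where p: "p = (i, j)" "i < n" "j < m" using pin by auto
    show ?thesis
    proof (cases "off j \<le> x \<and> x < off (Suc j)")
      case True
      define y where "y = x - off j"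
      have y: "y < d (Suc j)" using True by (auto simp: y_def off_Suc)
      let ?q = "quotient_of (v (Suc j) (Suc i) $ y)"
      have "\<bar>fst ?q\<bar> \<le> W"
        using entry[OF p(2,3) y] cell[of "2 + m + 2 * n * off j + (2 * i * d (Suc j) + 2 * y)"] cell_le
        by (metis Suc_eq_plus1 add_Suc_right less_SucI not_less_eq)
      hence "\<bar>fst ?q * W\<bar> \<le> W * W" using W1 by (simp add: abs_mult mult_right_mono)
      moreover have "\<bar>fst ?q * W div snd ?q\<bar> \<le> \<bar>fst ?q * W\<bar>" by (rule abs_div_le)
      ultimately show ?thesis using True by (simp add: U_def p y_def)
    next
      case False
      thus ?thesis using W1 by (auto simp: U_def p)
    qed
  qed
  have sW: "s ''W'' 0 = W" "s ''B'' 0 = W ^ (4 * l + 1)" "s ''L'' 0 = int l ^ 5"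
    using s(3,4,5) by (simp_all add: W_def l_def)
  have WB: "W ^ k \<le> s ''B'' 0" if "k \<le> 4 * l + 1" for k
    unfolding sW using W1 that by (intro power_increasing) auto
  have input_le: "\<bar>s ''input'' a\<bar> \<le> s ''B'' 0" for a
    using cell_le[of a] WB[of 1] s(2) by simp
  have "int l ^ 5 \<le> W ^ 5" using lW by (intro power_mono) auto
  hence LB: "s ''L'' 0 \<le> s ''B'' 0" using WB[of 5] len unfolding sW(3) by linarith
  have "1 \<le> n" "1 \<le> D" using n_pos D_pos by simp_all
  moreover have "3 + 2 * (n * D) \<le> l" using len m_pos by simp
  ultimately have cap: "int n * int (n ^ 3 * D ^ 2) + 2 * int (n ^ 3 * D ^ 2) + 2 \<le> s ''L'' 0"
    unfolding sW(3) by (rule descent_time_cap)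
  have "int l ^ 1 \<le> int l ^ 5" using len by (intro power_increasing) auto
  hence lenL: "int (z + length code) \<le> s ''L'' 0" unfolding sW(3) using len by (simp add: code_length)
  define \<sigma> where "\<sigma> = sem setup_prog s"
  have input: "\<forall>a<length code. s ''input'' (int (z + 1 + a)) = code ! a" using cell s(2) by simp
  note setup_facts = setup_prog_correct[where s = s and z = z, OF s(1) input input_le lenL LB cap, folded \<sigma>_def]
  have fr: "frame (writes setup_prog) s \<sigma>" unfolding \<sigma>_def by (rule frame_sem)
  have keep: "\<sigma> x = s x" if "x \<in> {''W'', ''B'', ''L'', ''input'', ''X'', ''S'', ''A'', ''output''}" for x
    by (rule frameD[OF fr]) (use that in \<open>auto simp: writes_setup_prog\<close>)
  have minors: "fact (Suc D) * (W * W) ^ Suc D \<le> \<sigma> ''B'' 0"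
  proof -
    have "n * D \<ge> 1 * D" using n_pos by (intro mult_le_mono1) simp
    hence Dl: "Suc D \<le> l" using len unfolding mult.assoc by linarith
    have "(fact (Suc D) :: int) \<le> of_nat (Suc D) ^ Suc D" using fact_le_power[of "Suc D", where 'a = int] by (simp only: of_nat_power)
    also have "\<dots> \<le> W ^ Suc D" using Dl lW by (intro power_mono) auto
    also have "\<dots> \<le> W ^ l" using W1 Dl by (intro power_increasing)
    finally have f: "(fact (Suc D) :: int) \<le> W ^ l" .
    have "(W * W) ^ Suc D = W ^ (2 * Suc D)" by (simp add: power_mult power2_eq_square del: power_Suc mult_Suc_right)
    also have "\<dots> \<le> W ^ (2 * l)" using W1 Dl by (intro power_increasing mult_le_mono2)
    finally have w: "(W * W) ^ Suc D \<le> W ^ (2 * l)" .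
    have "fact (Suc D) * (W * W) ^ Suc D \<le> W ^ l * W ^ (2 * l)"
      by (rule mult_mono[OF f w]) (use W1 in auto)
    also have "\<dots> = W ^ (3 * l)" by (simp flip: power_add)
    also have "\<dots> \<le> s ''B'' 0" by (rule WB) simp
    finally show ?thesis using keep by simp
  qed
  \<comment> \<open>The entries of the vectors are numerators times quotients of \<open>W\<close>, hence at most \<open>W * W\<close>.\<close>
  interpret machine n m d v W \<sigma> "W * W"
  proof unfold_locales
    show "\<sigma> ''n'' 0 = int n" "\<sigma> ''m'' 0 = int m" "\<sigma> ''D'' 0 = int D" "\<sigma> ''W'' 0 = W"
      "\<sigma> ''K'' 0 = int (n ^ 3 * D ^ 2)" "\<sigma> ''k'' 0 = \<sigma> ''K'' 0 + 1" "\<sigma> ''T'' 0 = int n * \<sigma> ''K'' 0 + 1"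
      using setup_facts(1-6) keep sW by auto
    show "\<sigma> ''d'' (int j) = int (d (Suc j))" "\<sigma> ''o'' (int j) = int (off j)" if "j < m" for j
      using setup_facts(7,8)[of j] that by auto
    show "\<sigma> ''input'' (\<sigma> ''b'' (int j) + (2 * (int i * int (d (Suc j)) + int x) + 1))
          = fst (quotient_of (v (Suc j) (Suc i) $ x)) \<and>
        \<sigma> ''input'' (\<sigma> ''b'' (int j) + (2 * (int i * int (d (Suc j)) + int x) + 1) + 1)
          = snd (quotient_of (v (Suc j) (Suc i) $ x))" if ijx: "i < n" "j < m" "x < d (Suc j)" for i j x
    proof -
      let ?a = "2 + m + 2 * n * off j + (2 * i * d (Suc j) + 2 * x)"
      let ?b = "2 + m + 2 * n * off j + (2 * i * d (Suc j) + (2 * x + 1))"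
      have lt: "?a < length code" "?b < length code" using entry[OF ijx] by simp_all
      have 1: "\<sigma> ''b'' (int j) + (2 * (int i * int (d (Suc j)) + int x) + 1) = int (z + 1 + ?a)"
        "\<sigma> ''b'' (int j) + (2 * (int i * int (d (Suc j)) + int x) + 1) + 1 = int (z + 1 + ?b)"
        using setup_facts(9)[of j] ijx by (simp_all add: algebra_simps)
      have "\<sigma> ''input'' = list_array zs" using keep s(2) by simp
      thus ?thesis unfolding 1 using cell[OF lt(1)] cell[OF lt(2)] entry[OF ijx] by simp
    qed
    show "\<bar>\<sigma> ''input'' a\<bar> \<le> \<sigma> ''B'' 0" for a using input_le keep by simp
    show "\<bar>U p x\<bar> \<le> W * W" if "p \<in> pairs {..<n}" for p x by (rule U_le[OF that])
    show "1 \<le> W * W" using mult_mono[of 1 W 1 W] W1 by simp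
    show "fact (Suc D) * (W * W) ^ Suc D \<le> \<sigma> ''B'' 0" by (rule minors)
    show "\<sigma> ''L'' 0 \<le> \<sigma> ''B'' 0" using LB keep by simp
    show "int n * \<sigma> ''K'' 0 + 2 * \<sigma> ''K'' 0 + 2 \<le> \<sigma> ''L'' 0" using cap setup_facts(4) keep by auto
  qed
  have "correct_output (output_of (sem (Sq descent emit_answer) \<sigma>))"
    by (rule main_correct) (use zero keep in \<open>simp_all add: static_def\<close>)
  thus ?thesis by (simp add: body_prog_def \<sigma>_def)
qed

end

lemma srsr_com_run:
  "\<exists>p :: nat poly. \<forall>n m d v zs pre. srsr_instance n m d v \<longrightarrow> zs = pre @ encode_instance n m d v \<longrightarrow> length pre = z \<longrightarrow>
     (\<exists>k ys. run (srsr_com (int z)) zs [] k ys \<and> k \<le> poly p (input_size zs) \<and> srsr_data.correct_output n m d v ys)"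
proof -
  obtain C0 where C0: "\<And>s \<beta>. mem_bounded \<beta> s \<Longrightarrow>
      \<exists>t. exec (Store ''z'' (Lit 0) (Lit (int z))) s t (upd s ''z'' (aval s (Lit 0)) (aval s (Lit (int z)))) \<and> t \<le> C0 * (\<beta> + 1)"
    using exec_Store_bound by blast
  obtain C1 where C1: "\<And>s zs. s ''input'' = list_array zs \<Longrightarrow> zs \<noteq> [] \<Longrightarrow>
      mem_bounded (2 * input_size zs * (4 * length zs + 1) + 1) s \<Longrightarrow>
      (\<exists>t s'. exec prelude s t s' \<and> t \<le> C1 * (length zs + 1) * (2 * input_size zs * (4 * length zs + 1) + 1 + 1) \<and>
         mem_bounded (2 * input_size zs * (4 * length zs + 1) + 1) s' \<and>
         frame {''W'', ''B'', ''L'', ''i''} s s' \<and>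
         s' ''W'' 0 = factors (list_array zs) (length zs) \<and>
         s' ''B'' 0 = factors (list_array zs) (length zs) ^ (4 * length zs + 1) \<and> s' ''L'' 0 = int (length zs) ^ 5)"
    using prelude_exec[unfolded Let_def] by metis
  obtain C2 e where C2: "poly_cost body_prog C2 e" using exec_compile[OF wf_body_prog] by blast
  \<comment> \<open>\<open>q\<close> bounds the number of bits of the memory, and the first factor of \<open>p\<close> the number of steps.\<close>
  define q :: "nat poly" where "q = [:2, 2, 8:]"
  define p where "p = ([:C0:] + [:C1:] * [:1, 1:] + [:C2:] * (monom 1 5 + [:1:]) ^ e) * q"
  have q: "poly q N = 2 * N * (4 * N + 1) + 2" for N by (simp add: q_def algebra_simps)
  have p: "poly p N = (C0 + C1 * (N + 1) + C2 * (N ^ 5 + 1) ^ e) * (2 * N * (4 * N + 1) + 2)" for N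
  proof -
    have "poly [:c:] N = c" "poly [:1, 1:] N = N + 1" "poly (monom 1 5) N = N ^ 5" for c :: nat
      by (simp_all add: poly_monom)
    thus ?thesis by (simp only: p_def poly_mult poly_add q poly_power)
  qed
  show ?thesis
  proof (rule exI[of _ p], intro allI impI)
    fix n m :: nat and d v and zs pre :: "int list"
    assume inst: "srsr_instance n m d v" and zs: "zs = pre @ encode_instance n m d v" and z: "length pre = z"
    interpret srsr_data n m d v by unfold_locales (rule inst)
    let ?\<beta> = "2 * input_size zs * (4 * length zs + 1) + 1"
    have ne: "zs \<noteq> []" using code_length zs by auto
    define s0 where "s0 = initial_mem zs []"
    have b0: "mem_bounded ?\<beta> s0" unfolding s0_def by (rule initial_mem_bounded[OF ne])
    define s1 where "s1 = upd s0 ''z'' 0 (int z)"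
    obtain t0 where t0: "exec (Store ''z'' (Lit 0) (Lit (int z))) s0 t0 s1" "t0 \<le> C0 * (?\<beta> + 1)"
      using C0[OF b0] by (auto simp: s1_def)
    have "z \<le> length zs" using zs z by simp
    hence "int z \<le> \<bar>s0 ''input'' 0\<bar>" by (simp add: s0_def initial_mem_def list_array_def)
    hence "\<bar>int z\<bar> < 2 ^ ?\<beta>" using b0 unfolding mem_bounded_def abs_of_nat by (blast intro: le_less_trans)
    hence b1: "mem_bounded ?\<beta> s1" unfolding s1_def by (rule bounded_upd[OF b0])
    have inp1: "s1 ''input'' = list_array zs" by (simp add: s1_def s0_def initial_mem_def)
    obtain t1 s2 where t1: "exec prelude s1 t1 s2" "t1 \<le> C1 * (length zs + 1) * (?\<beta> + 1)" "mem_bounded ?\<beta> s2"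
      "frame {''W'', ''B'', ''L'', ''i''} s1 s2"
      "s2 ''W'' 0 = factors (list_array zs) (length zs)"
      "s2 ''B'' 0 = factors (list_array zs) (length zs) ^ (4 * length zs + 1)" "s2 ''L'' 0 = int (length zs) ^ 5"
      using C1[OF inp1 ne b1] by blast
    have f: "s2 x = s1 x" if "x \<notin> {''W'', ''B'', ''L'', ''i''}" for x by (rule frameD[OF t1(4) that])
    have cap: "s2 ''L'' 0 \<le> int (length zs ^ 5)" using t1(7) by simp
    obtain t2 where t2: "exec (compile body_prog) s2 t2 (sem body_prog s2)"
      "t2 \<le> C2 * (length zs ^ 5 + 1) ^ e * (?\<beta> + 1)"
      by (rule poly_costD[OF C2 t1(3) cap])
    have "correct_output (output_of (sem body_prog s2))"
    proof (rule body_prog_correct[OF zs z])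
      show "s2 x = (\<lambda>_. 0)" if "x \<in> {''X'', ''S'', ''A'', ''output''}" for x
        using that by (auto simp: f s1_def s0_def initial_mem_def)
    qed (use t1 in \<open>simp_all add: f s1_def s0_def initial_mem_def\<close>)
    moreover have "run (srsr_com (int z)) zs [] (t0 + (t1 + t2)) (output_of (sem body_prog s2))"
      unfolding run_def srsr_com_def s0_def[symmetric]
      using exec.Seq[OF t0(1) exec.Seq[OF t1(1) t2(1)]] by blast
    moreover have "t0 + (t1 + t2) \<le> poly p (input_size zs)"
    proof -
      let ?N = "input_size zs"
      have l: "length zs \<le> ?N" by (rule length_le_input_size)
      have "2 * ?N * (4 * length zs + 1) \<le> 2 * ?N * (4 * ?N + 1)" using l by (intro mult_le_mono) auto
      hence \<beta>: "?\<beta> + 1 \<le> 2 * ?N * (4 * ?N + 1) + 2" by linarith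
      have "t0 + (t1 + t2) \<le> C0 * (?\<beta> + 1) + (C1 * (length zs + 1) * (?\<beta> + 1) + C2 * (length zs ^ 5 + 1) ^ e * (?\<beta> + 1))"
        using t0(2) t1(2) t2(2) by linarith
      also have "\<dots> = (C0 + C1 * (length zs + 1) + C2 * (length zs ^ 5 + 1) ^ e) * (?\<beta> + 1)"
        by (simp only: add_mult_distrib add.assoc)
      also have "\<dots> \<le> (C0 + C1 * (?N + 1) + C2 * (?N ^ 5 + 1) ^ e) * (2 * ?N * (4 * ?N + 1) + 2)"
        by (rule mult_le_mono[OF _ \<beta>]) (use l in \<open>intro add_le_mono mult_le_mono power_mono; simp\<close>)
      finally show ?thesis unfolding p .
    qed
    ultimately show "\<exists>k ys. run (srsr_com (int z)) zs [] k ys \<and> k \<le> poly p (input_size zs) \<and> correct_output ys" by blast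
  qed
qed

text \<open>The output of length 2 with sample set \<open>N = 1\<close> and \<open>K = 0\<close> scalars per round.\<close>
definition trivial_setup :: com where
  "trivial_setup = Seq (Store ''output'' (Lit 0) (Lit 2)) (Seq (Store ''output'' (Lit 1) (Lit 1)) (Store ''output'' (Lit 2) (Lit 0)))"

lemma trivial_setup_run: "\<exists>k. run trivial_setup xs rs k [1, 0]"
proof -
  let ?s = "upd (upd (upd (initial_mem xs rs) ''output'' 0 2) ''output'' 1 1) ''output'' 2 0"
  have store: "\<exists>k. exec (Store x (Lit a) (Lit b)) s k (upd s x a b)" for x a b s
    using exec.Store[of x "Lit a" "Lit b" s] unfolding upd_def by auto
  obtain k1 where 1: "exec (Store ''output'' (Lit 0) (Lit 2)) (initial_mem xs rs) k1 (upd (initial_mem xs rs) ''output'' 0 2)"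
    using store by blast
  obtain k2 where 2: "exec (Store ''output'' (Lit 1) (Lit 1)) (upd (initial_mem xs rs) ''output'' 0 2) k2
      (upd (upd (initial_mem xs rs) ''output'' 0 2) ''output'' 1 1)" using store by blast
  obtain k3 where 3: "exec (Store ''output'' (Lit 2) (Lit 0)) (upd (upd (initial_mem xs rs) ''output'' 0 2) ''output'' 1 1) k3 ?s"
    using store by blast
  have "exec trivial_setup (initial_mem xs rs) (k1 + (k2 + k3)) ?s"
    unfolding trivial_setup_def by (rule exec.Seq[OF 1 exec.Seq[OF 2 3]])
  moreover have "output_of ?s = [1, 0]" by (simp add: output_of_def upt_rec)
  ultimately show ?thesis unfolding run_def by blast
qed

lemma trivial_setup_result: "setup_result trivial_setup xs e N K \<longleftrightarrow> N = 1 \<and> K = 0"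
proof
  assume "setup_result trivial_setup xs e N K"
  then obtain k where "run trivial_setup (encode_rat e @ xs) [] k [int N, int K]"
    by (auto simp: setup_result_def deterministic_output_def)
  moreover obtain k' where "run trivial_setup (encode_rat e @ xs) [] k' [1, 0]"
    using trivial_setup_run by blast
  ultimately have "[int N, int K] = [1, 0]" using run_deterministic by blast
  thus "N = 1 \<and> K = 0" by simp
next
  assume "N = 1 \<and> K = 0"
  thus "setup_result trivial_setup xs e N K"
    using trivial_setup_run by (auto simp: setup_result_def deterministic_output_def)
qed

lemma draws_0: "draws N 0 = return_pmf []"
  by (simp add: draws_def)

lemma round_result_run:
  assumes "run R (encode_rat e @ xs) rs k ys" "ys \<noteq> []"
  shows "round_result R xs e rs = Some ys"
proof -
  have "(THE ys. \<exists>k. run R (encode_rat e @ xs) rs k ys) = ys"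
    using assms(1) run_deterministic by (intro the_equality) blast+
  thus ?thesis using assms(2) by (simp add: round_result_def)
qed

text \<open>A round that always produces the same output is never repeated.\<close>
lemma rounds_of_certain_round:
  assumes "round_pmf R xs e N K = return_pmf (Some ys)" "Some zs \<in> set_pmf (rounds_pmf R xs e N K t)"
  shows "zs = ys"
  using assms by (cases t) (simp_all add: bind_return_pmf)

lemma (in srsr_data) correct_output_nonempty: "correct_output ys \<Longrightarrow> ys \<noteq> []"
  by (auto simp: correct_output_def decides_and_computes_srsr_def no_solution_answer_def answers_def split: if_splits)

lemma (in srsr_data) correct_output_real_vec:
  assumes "correct_output ys"
  shows "decides_and_computes_srsr n m d (\<lambda>j i. real_vec (v j i)) ys \<and>
    ((\<exists>T. srsr_solution n m d (\<lambda>j i. real_vec (v j i)) T) \<longrightarrow>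
       (\<forall>T. answers m d ys T \<longrightarrow> optimal_srsr_solution n m d (\<lambda>j i. real_vec (v j i)) T))"
proof -
  have "(\<lambda>j i. real_vec (v j i)) = X" by (intro ext) (simp add: X_def)
  thus ?thesis using assms by (simp add: correct_output_def)
qed

theorem theorem1:
  shows "\<exists>P S R :: com.
    polynomial_time P srsr_inputs \<and>
    probabilistic_algorithm S R srsr_inputs \<and>
    (\<forall>(n :: nat) (m :: nat) (d :: nat \<Rightarrow> nat) (v :: nat \<Rightarrow> nat \<Rightarrow> rat vec).
      srsr_instance n m d v \<longrightarrow>
      (let xs = encode_instance n m d v;
           X = (\<lambda>j i. real_vec (v j i))
       in
       (\<forall>ys. deterministic_output P xs ys \<or> probabilistic_output S R xs ys \<longrightarrow>
          decides_and_computes_srsr n m d X ys \<and>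
          ((\<exists>T. srsr_solution n m d X T) \<longrightarrow>
             (\<forall>T. answers m d ys T \<longrightarrow> optimal_srsr_solution n m d X T)))))"
proof -
  obtain p where p: "\<And>n m d v. srsr_instance n m d v \<Longrightarrow>
     (\<exists>k ys. run (srsr_com 0) (encode_instance n m d v) [] k ys \<and> k \<le> poly p (input_size (encode_instance n m d v)) \<and>
        srsr_data.correct_output n m d v ys)"
    using srsr_com_run[of 0] by (metis append_Nil list.size(3) of_nat_0)
  have r: "\<exists>k ys. run (srsr_com 2) (encode_rat e @ encode_instance n m d v) [] k ys \<and> srsr_data.correct_output n m d v ys"
    if inst: "srsr_instance n m d v" for n m d v e
  proof -
    have "length (encode_rat e) = 2" by (simp add: encode_rat_def)
    thus ?thesis using srsr_com_run[of 2] inst by (metis of_nat_numeral)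
  qed
  have round: "\<exists>ys. round_pmf (srsr_com 2) (encode_instance n m d v) e 1 0 = return_pmf (Some ys) \<and>
      srsr_data.correct_output n m d v ys" if inst: "srsr_instance n m d v" for n m d v e
  proof -
    interpret srsr_data n m d v by unfold_locales (rule inst)
    obtain k ys where ys: "run (srsr_com 2) (encode_rat e @ encode_instance n m d v) [] k ys" "correct_output ys"
      using r[OF inst] by blast
    have "round_result (srsr_com 2) (encode_instance n m d v) e [] = Some ys"
      by (rule round_result_run[OF ys(1) correct_output_nonempty[OF ys(2)]])
    thus ?thesis using ys(2) by (auto simp: round_pmf_def draws_0)
  qed
  have "polynomial_time (srsr_com 0) srsr_inputs"
    unfolding polynomial_time_def srsr_inputs_def using p by blast
  moreover have "probabilistic_algorithm trivial_setup (srsr_com 2) srsr_inputs"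
    unfolding probabilistic_algorithm_def
  proof (intro ballI allI impI)
    fix xs and e :: rat assume xs: "xs \<in> srsr_inputs" and e: "e > 0"
    then obtain n m d v where inst: "srsr_instance n m d v" and xs: "xs = encode_instance n m d v"
      unfolding srsr_inputs_def by blast
    have "\<forall>rs\<in>set_pmf (draws 1 0). \<exists>k ys. run (srsr_com 2) (encode_rat e @ xs) rs k ys"
      using r[OF inst, of e] xs by (auto simp: draws_0)
    moreover have "measure_pmf.prob (round_pmf (srsr_com 2) xs e 1 0) {r. r \<noteq> None} \<ge> 1 - real_of_rat e"
      using round[OF inst, of e] e xs by (auto simp: measure_return_pmf)
    ultimately show "\<exists>N K. setup_result trivial_setup xs e N K \<and>
        (\<forall>rs\<in>set_pmf (draws N K). \<exists>k ys. run (srsr_com 2) (encode_rat e @ xs) rs k ys) \<and>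
        measure_pmf.prob (round_pmf (srsr_com 2) xs e N K) {r. r \<noteq> None} \<ge> 1 - real_of_rat e"
      using trivial_setup_result by blast
  qed
  moreover have "srsr_data.correct_output n m d v ys"
    if inst: "srsr_instance n m d v"
      and out: "deterministic_output (srsr_com 0) (encode_instance n m d v) ys \<or>
        probabilistic_output trivial_setup (srsr_com 2) (encode_instance n m d v) ys" for n m d v ys
    using out
  proof
    assume "deterministic_output (srsr_com 0) (encode_instance n m d v) ys"
    thus ?thesis using p[OF inst] run_deterministic unfolding deterministic_output_def by blast
  next
    assume "probabilistic_output trivial_setup (srsr_com 2) (encode_instance n m d v) ys"
    then obtain e t where "Some ys \<in> set_pmf (rounds_pmf (srsr_com 2) (encode_instance n m d v) e 1 0 t)"
      unfolding probabilistic_output_def trivial_setup_result by blast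
    thus ?thesis using round[OF inst, of e] rounds_of_certain_round by blast
  qed
  hence "\<forall>n m d v. srsr_instance n m d v \<longrightarrow>
      (let xs = encode_instance n m d v;
           X = (\<lambda>j i. real_vec (v j i))
       in
       (\<forall>ys. deterministic_output (srsr_com 0) xs ys \<or> probabilistic_output trivial_setup (srsr_com 2) xs ys \<longrightarrow>
          decides_and_computes_srsr n m d X ys \<and>
          ((\<exists>T. srsr_solution n m d X T) \<longrightarrow>
             (\<forall>T. answers m d ys T \<longrightarrow> optimal_srsr_solution n m d X T))))"
    unfolding Let_def using srsr_data.correct_output_real_vec[unfolded srsr_data_def] by blast
  ultimately show ?thesis by blast
qed

end
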